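(* Let $\vec\Phi:\Sigma\to\mathbb{R}^m$ be a smooth immersion of a 4-dimensional manifold $\Sigma$ satisfying $\vec{\mathcal W}=\vec 0$, where $\vec{\mathcal W}$ is the Willmore-type operator defined in the context. Define $$\begin{aligned}\vec V^j:={}&|\pi_{\vec n}\nabla\vec H|^2\nabla^j\vec\Phi-2(\pi_{\vec n}\nabla^j\vec H\cdot\pi_{\vec n}\nabla_i\vec H)\nabla^i\vec\Phi+(\vec h_i^j\cdot\Delta_\perp\vec H)\nabla^i\vec\Phi\\&+\tfrac12\nabla^j\Delta_\perp\vec H-2(\vec h_i^j\cdot\nabla^i\vec H)\vec H+2(\vec H\cdot\vec h_i^j)\pi_{\vec n}\nabla^i\vec H-2\nabla_i\big((\vec H\cdot\vec h^{ij})\vec H\big)\\&+4\pi_{\vec n}\nabla_i\big((\vec H\cdot\vec h^{ij})\vec H\big)-\tfrac12\nabla^j\big((\vec H\cdot\vec h^{ik})\vec h_{ik}\big)-|\vec H\cdot\vec h|^2\nabla^j\vec\Phi\\&+\pi_{\vec n}\nabla^j\big((\vec H\cdot\vec h^{ik})\vec h_{ik}\big)+7|\vec H|^4\nabla^j\vec\Phi+7\nabla^j(|\vec H|^2\vec H)-14\pi_{\vec n}\nabla^j(|\vec H|^2\vec H).\end{aligned}$$ Then the following conservation laws hold (corresponding to the invariance of $\mathcal{E}(\Sigma)=\int_\Sigma(|\pi_{\vec n}\nabla\vec H|^2-|\vec H\cdot\vec h|^2+7|\vec H|^4)\,d\mathrm{vol}_g$ under translation, dilation and rotation respectively): $$\nabla_j\vec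 V^j=\vec 0,\qquad \nabla_j\big(\vec\Phi\cdot\vec V^j-\nabla^j|\vec H|^2\big)=0,\qquad \nabla_j\big(\vec\Phi\wedge\vec V^j+\vec M^j\big)=\vec 0,$$ where $\vec M^j$ denotes the 2-vector $$\begin{aligned}\vec M^j:={}&\tfrac12\Delta_\perp\vec H\wedge\nabla^j\vec\Phi+2\vec H\wedge\pi_{\vec n}\nabla^j\vec H+2(\vec H\cdot\vec h^{ij})\vec H\wedge\nabla_i\vec\Phi\\&+\tfrac12(\vec H\cdot\vec h^{ik})\vec h_{ik}\wedge\nabla^j\vec\Phi-7|\vec H|^2\vec H\wedge\nabla^j\vec\Phi.\end{aligned}$$
   Context: $g_{ij}=\nabla_i\vec\Phi\cdot\nabla_j\vec\Phi$ is the induced metric, $\nabla$ its Levi-Civita connection (acting componentwise on $\mathbb{R}^m$-valued and multivector-valued tensors). Indices are raised and lowered with $g$, and repeated indices are summed. $\vec h_{ij}=\nabla_i\nabla_j\vec\Phi$ is the second fundamental form, $\vec H=\frac14g^{ij}\vec h_{ij}$ the mean curvature vector, $\pi_{\vec n}$ the projection onto the normal bundle, $|\pi_{\vec n}\nabla\vec H|^2=\pi_{\vec n}\nabla_i\vec H\cdot\pi_{\vec n}\nabla^i\vec H$, $|\vec H\cdot\vec h|^2=(\vec H\cdot\vec h_{ij})(\vec H\cdot\vec h^{ij})$, $|\vec H|^4=(\vec H\cdot\vec H)^2$. $\Delta_\perp\vec X=\pi_{\vec n}\nabla^j\pi_{\vec n}\nabla_j\vec X$ for normal $\vec X$. The wedge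 $\wedge$ is the exterior product of vectors in $\mathbb{R}^m$. The Willmore-type operator is $$\begin{aligned}\vec{\mathcal W}:={}&-\tfrac12\Delta_\perp^2\vec H-\tfrac12(\vec h_{ik}\cdot\Delta_\perp\vec H)\vec h^{ik}-4|\pi_{\vec n}\nabla\vec H|^2\vec H+2\pi_{\vec n}\nabla_j\big((\vec h^j_i\cdot\nabla^i\vec H)\vec H\big)\\&-2\pi_{\vec n}\nabla_j\big((\vec H\cdot\vec h^j_i)\pi_{\vec n}\nabla^i\vec H\big)+2(\pi_{\vec n}\nabla_i\vec H\cdot\pi_{\vec n}\nabla_j\vec H)\vec h^{ij}\\&-\tfrac12\Delta_\perp\big((\vec H\cdot\vec h^{ij})\vec h_{ij}\big)-2\pi_{\vec n}\nabla_i\nabla_k\big((\vec H\cdot\vec h^{ik})\vec H\big)-28|\vec H|^4\vec H\\&-\tfrac12(\vec H\cdot\vec h^{ij})(\vec h_{ij}\cdot\vec h_{pq})\vec h^{pq}-4(\vec H\cdot\vec h_{ij})(\vec H\cdot\vec h^i_k)\vec h^{jk}+4|\vec H\cdot\vec h|^2\vec H\\&+7\Delta_\perp(|\vec H|^2\vec H)+7|\vec H|^2(\vec H\cdot\vec h_{ij})\vec h^{ij}.\end{aligned}$$ *)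

theory Defs
  imports "HOL-Analysis.Analysis"
begin

section \<open>Smooth maps, manifolds and immersions\<close>

definition partial_deriv :: "4 \<Rightarrow> (real^4 \<Rightarrow> 'v::real_normed_vector) \<Rightarrow> real^4 \<Rightarrow> 'v" where
  "partial_deriv i F x = frechet_derivative F (at x) (axis i 1)"

text \<open>Continuous differentiability of order \<open>k\<close>, for maps whose values off the open set \<open>S\<close>
  are irrelevant.\<close>

fun Ck_on :: "nat \<Rightarrow> (real^4) set \<Rightarrow> (real^4 \<Rightarrow> 'v::real_normed_vector) \<Rightarrow> bool" where
  "Ck_on 0 S F \<longleftrightarrow> continuous_on S F"
| "Ck_on (Suc k) S F \<longleftrightarrow>
     (\<forall>x\<in>S. F differentiable (at x)) \<and> (\<forall>i. Ck_on k S (partial_deriv i F))"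

definition smooth_map_on :: "(real^4) set \<Rightarrow> (real^4 \<Rightarrow> 'v::real_normed_vector) \<Rightarrow> bool" where
  "smooth_map_on S F \<longleftrightarrow> (\<forall>k. Ck_on k S F)"

text \<open>A chart is a pair \<open>(U, \<phi>)\<close> of a coordinate domain and a coordinate map; \<open>\<phi>\<close> is a total
  function of which only the values on \<open>U\<close> matter. The manifold is the topological space \<open>X\<close>
  together with the atlas \<open>A\<close>, which need not be maximal.\<close>

type_synonym 'a chart = "'a set \<times> ('a \<Rightarrow> real^4)"

definition smooth_manifold4 :: "'a topology \<Rightarrow> 'a chart set \<Rightarrow> bool" where
  "smooth_manifold4 X A \<longleftrightarrow>
     Hausdorff_space X \<and> second_countable X \<and>
     (\<Union>(U, \<phi>)\<in>A. U) = topspace X \<and>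
     (\<forall>(U, \<phi>)\<in>A. openin X U \<and> open (\<phi> ` U) \<and>
        homeomorphic_map (subtopology X U) (top_of_set (\<phi> ` U)) \<phi>) \<and>
     (\<forall>(U, \<phi>)\<in>A. \<forall>(V, \<psi>)\<in>A. smooth_map_on (\<phi> ` (U \<inter> V)) (\<psi> \<circ> inv_into U \<phi>))"

definition local_rep :: "'a chart \<Rightarrow> ('a \<Rightarrow> 'v) \<Rightarrow> real^4 \<Rightarrow> 'v" where
  "local_rep c F = F \<circ> inv_into (fst c) (snd c)"

definition chart_range :: "'a chart \<Rightarrow> (real^4) set" where
  "chart_range c = snd c ` fst c"

definition smooth_immersion :: "'a chart set \<Rightarrow> ('a \<Rightarrow> real^'m) \<Rightarrow> bool" where
  "smooth_immersion A \<Phi> \<longleftrightarrow>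
     (\<forall>c\<in>A. smooth_map_on (chart_range c) (local_rep c \<Phi>) \<and>
        (\<forall>x\<in>chart_range c. inj (frechet_derivative (local_rep c \<Phi>) (at x))))"

section \<open>Two-vectors\<close>

text \<open>The exterior square of \<open>\<real>\<^sup>m\<close> is realised as the space of skew-symmetric matrices, with
  \<open>e\<^sub>a \<and> e\<^sub>b\<close> corresponding to \<open>E\<^sub>a\<^sub>b - E\<^sub>b\<^sub>a\<close>.\<close>

definition wedge :: "real^'m \<Rightarrow> real^'m \<Rightarrow> real^'m^'m" (infixl "\<and>\<and>" 72) where
  "u \<and>\<and> v = (\<chi> a b. u $ a * v $ b - u $ b * v $ a)"

section \<open>Geometry of an immersion in local coordinates\<close>

text \<open>Here \<open>f\<close> is the immersion read in one chart. A tensor field with values in \<open>'v\<close> is given by its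
  coordinate components: index arguments first, then the point. The position of an index
  (covariant or contravariant) is a matter of the individual field and is recorded below with
  \<open>_\<close> and \<open>^\<close>.\<close>

locale parametrization =
  fixes f :: "real^4 \<Rightarrow> real^'m"
begin

definition g :: "4 \<Rightarrow> 4 \<Rightarrow> real^4 \<Rightarrow> real" where
  "g i j x = partial_deriv i f x \<bullet> partial_deriv j f x"

definition ginv :: "4 \<Rightarrow> 4 \<Rightarrow> real^4 \<Rightarrow> real" where
  "ginv i j x = matrix_inv (\<chi> a b. g a b x) $ i $ j"

text \<open>\<open>Gamma k i j\<close> is the Christoffel symbol with upper index \<open>k\<close>.\<close>

definition Gamma :: "4 \<Rightarrow> 4 \<Rightarrow> 4 \<Rightarrow> real^4 \<Rightarrow> real" where
  "Gamma k i j x = (1/2) * (\<Sum>l\<in>UNIV. ginv k l x *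
     (partial_deriv i (g j l) x + partial_deriv j (g i l) x - partial_deriv l (g i j) x))"

text \<open>The covariant derivatives \<open>\<nabla>_i T_j\<close>, \<open>\<nabla>_i T^j\<close> and \<open>\<nabla>_i T^{jk}\<close>; on functions, \<open>\<nabla>_i\<close> is
  \<^const>\<open>partial_deriv\<close>.\<close>

definition cd_lo :: "(4 \<Rightarrow> real^4 \<Rightarrow> 'v::real_normed_vector) \<Rightarrow> 4 \<Rightarrow> 4 \<Rightarrow> real^4 \<Rightarrow> 'v" where
  "cd_lo T i j x = partial_deriv i (T j) x - (\<Sum>k\<in>UNIV. Gamma k i j x *\<^sub>R T k x)"

definition cd_up :: "(4 \<Rightarrow> real^4 \<Rightarrow> 'v::real_normed_vector) \<Rightarrow> 4 \<Rightarrow> 4 \<Rightarrow> real^4 \<Rightarrow> 'v" where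
  "cd_up T i j x = partial_deriv i (T j) x + (\<Sum>k\<in>UNIV. Gamma j i k x *\<^sub>R T k x)"

definition cd_upup ::
    "(4 \<Rightarrow> 4 \<Rightarrow> real^4 \<Rightarrow> 'v::real_normed_vector) \<Rightarrow> 4 \<Rightarrow> 4 \<Rightarrow> 4 \<Rightarrow> real^4 \<Rightarrow> 'v" where
  "cd_upup T i j k x = partial_deriv i (T j k) x
     + (\<Sum>l\<in>UNIV. Gamma j i l x *\<^sub>R T l k x) + (\<Sum>l\<in>UNIV. Gamma k i l x *\<^sub>R T j l x)"

text \<open>\<open>\<nabla>^i F\<close> for a function \<open>F\<close>, the divergence \<open>\<nabla>_j T^j\<close>, and the vector field
  \<open>\<nabla>_k T^{jk}\<close> (index \<open>j\<close> free).\<close>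

definition grad_up :: "(real^4 \<Rightarrow> 'v::real_normed_vector) \<Rightarrow> 4 \<Rightarrow> real^4 \<Rightarrow> 'v" where
  "grad_up F i x = (\<Sum>a\<in>UNIV. ginv i a x *\<^sub>R partial_deriv a F x)"

definition dvg :: "(4 \<Rightarrow> real^4 \<Rightarrow> 'v::real_normed_vector) \<Rightarrow> real^4 \<Rightarrow> 'v" where
  "dvg T x = (\<Sum>j\<in>UNIV. cd_up T j j x)"

definition dvg2 :: "(4 \<Rightarrow> 4 \<Rightarrow> real^4 \<Rightarrow> 'v::real_normed_vector) \<Rightarrow> 4 \<Rightarrow> real^4 \<Rightarrow> 'v" where
  "dvg2 T j x = (\<Sum>k\<in>UNIV. cd_upup T k j k x)"

text \<open>\<open>normal_proj x\<close> is the orthogonal projection of \<open>\<real>\<^sup>m\<close> onto the normal space at \<open>x\<close>, i.e. onto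
  the orthogonal complement of the span of the coordinate tangent vectors.\<close>

definition tangent_space :: "real^4 \<Rightarrow> (real^'m) set" where
  "tangent_space x = span (range (\<lambda>i. partial_deriv i f x))"

definition normal_proj :: "real^4 \<Rightarrow> real^'m \<Rightarrow> real^'m" where
  "normal_proj x v = closest_point (orthogonal_comp (tangent_space x)) v"

definition pgrad :: "(real^4 \<Rightarrow> real^'m) \<Rightarrow> 4 \<Rightarrow> real^4 \<Rightarrow> real^'m" where
  "pgrad N i x = normal_proj x (partial_deriv i N x)"

definition pgrad_up :: "(real^4 \<Rightarrow> real^'m) \<Rightarrow> 4 \<Rightarrow> real^4 \<Rightarrow> real^'m" where
  "pgrad_up N i x = normal_proj x (grad_up N i x)"

definition lap_perp :: "(real^4 \<Rightarrow> real^'m) \<Rightarrow> real^4 \<Rightarrow> real^'m" where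
  "lap_perp N x = normal_proj x (\<Sum>j\<in>UNIV. \<Sum>k\<in>UNIV. ginv j k x *\<^sub>R cd_lo (pgrad N) k j x)"

text \<open>The second fundamental form as \<open>h_{ij}\<close>, \<open>h_i^j\<close> and \<open>h^{ij}\<close>.\<close>

definition h :: "4 \<Rightarrow> 4 \<Rightarrow> real^4 \<Rightarrow> real^'m" where
  "h i j x = cd_lo (\<lambda>k. partial_deriv k f) i j x"

definition h_mix :: "4 \<Rightarrow> 4 \<Rightarrow> real^4 \<Rightarrow> real^'m" where
  "h_mix i j x = (\<Sum>a\<in>UNIV. ginv j a x *\<^sub>R h i a x)"

definition h_up :: "4 \<Rightarrow> 4 \<Rightarrow> real^4 \<Rightarrow> real^'m" where
  "h_up i j x = (\<Sum>a\<in>UNIV. \<Sum>b\<in>UNIV. (ginv i a x * ginv j b x) *\<^sub>R h a b x)"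

definition H :: "real^4 \<Rightarrow> real^'m" where
  "H x = (1/4) *\<^sub>R (\<Sum>i\<in>UNIV. \<Sum>j\<in>UNIV. ginv i j x *\<^sub>R h i j x)"

text \<open>Recurring expressions: \<open>|H|^2\<close>, \<open>|\<pi> \<nabla>H|^2\<close>, \<open>|H \<cdot> h|^2\<close>, \<open>(H \<cdot> h^{ij}) h_{ij}\<close> and
  \<open>(H \<cdot> h^{ij}) H\<close>.\<close>

definition H_sq :: "real^4 \<Rightarrow> real" where
  "H_sq x = H x \<bullet> H x"

definition pgradH_sq :: "real^4 \<Rightarrow> real" where
  "pgradH_sq x = (\<Sum>i\<in>UNIV. pgrad H i x \<bullet> pgrad_up H i x)"

definition Hh_sq :: "real^4 \<Rightarrow> real" where
  "Hh_sq x = (\<Sum>i\<in>UNIV. \<Sum>j\<in>UNIV. (H x \<bullet> h i j x) * (H x \<bullet> h_up i j x))"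

definition Hhh :: "real^4 \<Rightarrow> real^'m" where
  "Hhh x = (\<Sum>i\<in>UNIV. \<Sum>j\<in>UNIV. (H x \<bullet> h_up i j x) *\<^sub>R h i j x)"

definition HhH :: "4 \<Rightarrow> 4 \<Rightarrow> real^4 \<Rightarrow> real^'m" where
  "HhH i j x = (H x \<bullet> h_up i j x) *\<^sub>R H x"

definition willmore :: "real^4 \<Rightarrow> real^'m" where
  "willmore x =
    - (1/2) *\<^sub>R lap_perp (lap_perp H) x
    - (1/2) *\<^sub>R (\<Sum>i\<in>UNIV. \<Sum>k\<in>UNIV. (h i k x \<bullet> lap_perp H x) *\<^sub>R h_up i k x)
    - (4 * pgradH_sq x) *\<^sub>R H x
    + 2 *\<^sub>R normal_proj x
        (dvg (\<lambda>j y. (\<Sum>i\<in>UNIV. h_mix i j y \<bullet> grad_up H i y) *\<^sub>R H y) x)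
    - 2 *\<^sub>R normal_proj x
        (dvg (\<lambda>j y. \<Sum>i\<in>UNIV. (H y \<bullet> h_mix i j y) *\<^sub>R pgrad_up H i y) x)
    + 2 *\<^sub>R (\<Sum>i\<in>UNIV. \<Sum>j\<in>UNIV. (pgrad H i x \<bullet> pgrad H j x) *\<^sub>R h_up i j x)
    - (1/2) *\<^sub>R lap_perp Hhh x
    - 2 *\<^sub>R normal_proj x (dvg (dvg2 HhH) x)
    - (28 * (H_sq x)\<^sup>2) *\<^sub>R H x
    - (1/2) *\<^sub>R (\<Sum>i\<in>UNIV. \<Sum>j\<in>UNIV. \<Sum>p\<in>UNIV. \<Sum>q\<in>UNIV.
        ((H x \<bullet> h_up i j x) * (h i j x \<bullet> h p q x)) *\<^sub>R h_up p q x)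
    - 4 *\<^sub>R (\<Sum>i\<in>UNIV. \<Sum>j\<in>UNIV. \<Sum>k\<in>UNIV.
        ((H x \<bullet> h i j x) * (H x \<bullet> h_mix k i x)) *\<^sub>R h_up j k x)
    + (4 * Hh_sq x) *\<^sub>R H x
    + 7 *\<^sub>R lap_perp (\<lambda>y. H_sq y *\<^sub>R H y) x
    + (7 * H_sq x) *\<^sub>R (\<Sum>i\<in>UNIV. \<Sum>j\<in>UNIV. (H x \<bullet> h i j x) *\<^sub>R h_up i j x)"

text \<open>In the terms \<open>\<nabla>_i((H \<cdot> h^{ij}) H)\<close> below, \<^const>\<open>dvg2\<close> contracts the second index instead of
  the first; \<^const>\<open>HhH\<close> is therefore transposed.\<close>

definition V :: "4 \<Rightarrow> real^4 \<Rightarrow> real^'m" where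
  "V j x =
    pgradH_sq x *\<^sub>R grad_up f j x
    - 2 *\<^sub>R (\<Sum>i\<in>UNIV. (pgrad_up H j x \<bullet> pgrad H i x) *\<^sub>R grad_up f i x)
    + (\<Sum>i\<in>UNIV. (h_mix i j x \<bullet> lap_perp H x) *\<^sub>R grad_up f i x)
    + (1/2) *\<^sub>R grad_up (lap_perp H) j x
    - 2 *\<^sub>R ((\<Sum>i\<in>UNIV. h_mix i j x \<bullet> grad_up H i x) *\<^sub>R H x)
    + 2 *\<^sub>R (\<Sum>i\<in>UNIV. (H x \<bullet> h_mix i j x) *\<^sub>R pgrad_up H i x)
    - 2 *\<^sub>R dvg2 (\<lambda>a b. HhH b a) j x
    + 4 *\<^sub>R normal_proj x (dvg2 (\<lambda>a b. HhH b a) j x)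
    - (1/2) *\<^sub>R grad_up Hhh j x
    - Hh_sq x *\<^sub>R grad_up f j x
    + normal_proj x (grad_up Hhh j x)
    + (7 * (H_sq x)\<^sup>2) *\<^sub>R grad_up f j x
    + 7 *\<^sub>R grad_up (\<lambda>y. H_sq y *\<^sub>R H y) j x
    - 14 *\<^sub>R normal_proj x (grad_up (\<lambda>y. H_sq y *\<^sub>R H y) j x)"

definition M :: "4 \<Rightarrow> real^4 \<Rightarrow> real^'m^'m" where
  "M j x =
    (1/2) *\<^sub>R (lap_perp H x \<and>\<and> grad_up f j x)
    + 2 *\<^sub>R (H x \<and>\<and> pgrad_up H j x)
    + 2 *\<^sub>R (\<Sum>i\<in>UNIV. (H x \<bullet> h_up i j x) *\<^sub>R (H x \<and>\<and> partial_deriv i f x))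
    + (1/2) *\<^sub>R (Hhh x \<and>\<and> grad_up f j x)
    - (7 * H_sq x) *\<^sub>R (H x \<and>\<and> grad_up f j x)"

end

end

theory Submission
  imports Defs
begin

text \<open>The three laws are pointwise identities in a single chart, so everything happens on one
parametrized patch \<open>f : S \<rightarrow> \<real>\<^sup>m\<close>. Tensor calculus in coordinates is traded for a calculus whose indices
\<open>a, b, \<dots>\<close> run over the coordinates of the ambient space. Let \<open>e_i = \<partial>_i f\<close>, let \<open>e^i = \<nabla>^i f\<close> be the dual
tangent vectors, and let \<open>\<delta>_a = \<Sum>_i (e^i)_a \<partial>_i\<close> be the derivative along the tangential part
\<open>E_a = \<delta>_a f\<close> of the \<open>a\<close>-th coordinate vector. The vectors \<open>E_a\<close> form a Parseval frame of the tangent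
space: \<open>\<Sum>_a E_a \<otimes> E_a\<close> is the tangential projection. Consequently a contraction with the metric is a
plain sum over ambient components (\<open>contract\<close>), the divergence of \<open>T\<close> is \<open>\<Sum>_a \<delta>_a T_a\<close> (\<open>dvg_eq\<close>),
the \<open>\<delta>_a\<close> are derivations, and no Christoffel symbols remain. The price is that \<open>\<delta>_a\<close> of a tangential
tensor is not tangential; the error always carries an ambient index of a normal vector and
vanishes as soon as that index is contracted with a tangential tensor (\<open>normal_contract\<close>).

The geometry enters through the Gauss formula \<open>\<delta>_a E_b = B_ab + \<Sum>_c (B_ac)_b E_c\<close> (\<open>delta_E\<close>), where \<open>B\<close>
is the second fundamental form, the symmetry of the Hessian (\<open>hessian_commute\<close>), and two
consequences of these: the Codazzi equation (\<open>codazzi\<close>) and the Ricci equation in the contracted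
form that is needed (\<open>normal_ricci\<close>).

Write \<open>D = \<pi>_n \<delta>\<close> for the normal connection, \<open>A_ab = H \<bullet> B_ab\<close>, and collect
\<open>Z = \<onehalf> \<Delta>_\<perp> H + \<onehalf> (H \<bullet> h^ij) h_ij - 7 |H|^2 H\<close>. Separating tangential and normal parts, the current is
\<open>V_a = \<Sum>_b stress_ab E_b + flux_a\<close> with
\<open>stress_ab = (|DH|^2 - |A|^2 + 7 |H|^4) E_a \<bullet> E_b + B_ab \<bullet> Z - 2 D_a H \<bullet> D_b H + 2 A^2_ab\<close>, which is
symmetric, and
\<open>flux_a = D_a Z - 2 (\<Sum>_b B_ab \<bullet> D_b H) H + 2 \<Sum>_b A_ab D_b H + 2 \<pi>_n (\<nabla>_b (A_ab H))\<close>, which is normal.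

The normal part of \<open>\<Sum>_a \<delta>_a V_a\<close> is \<open>- W\<close> (\<open>normal_part_div_V\<close>). Its tangential part vanishes for every
immersion (\<open>tangential_part_div_V\<close>): this is the Noether identity coming from the invariance of the
energy under reparametrization, and it follows from the Codazzi and Ricci equations. This gives
the first law. Since \<open>\<delta>_a f = E_a\<close>, the divergence of \<open>f \<bullet> V\<close> is then the trace of the stress, which
equals \<open>\<Delta> |H|^2\<close> (\<open>dilation_trace\<close>, \<open>laplacian_H_sq\<close>), and the divergence of \<open>f \<and> V\<close> is
\<open>\<Sum>_a E_a \<and> flux_a\<close> because the stress is symmetric; the divergence of \<open>M\<close> is its negative
(\<open>div_con_M\<close>).\<close>

section \<open>Calculus of smooth maps on an open set\<close>

lemma partial_deriv_eq:
  assumes "(F has_derivative F') (at x)"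
  shows "partial_deriv i F x = F' (axis i 1)"
  using frechet_derivative_at[OF assms] by (simp add: partial_deriv_def)

lemma partial_deriv_cong:
  assumes "open S" "x \<in> S" "\<And>y. y \<in> S \<Longrightarrow> F y = G y"
  shows "partial_deriv i F x = partial_deriv i G x"
proof -
  have "(F has_derivative f') (at x) = (G has_derivative f') (at x)" for f'
    using has_derivative_transform_within_open[OF _ assms(1,2)] assms(3) by metis
  then show ?thesis
    by (simp add: partial_deriv_def frechet_derivative_def)
qed

lemma partial_deriv_const [simp]: "partial_deriv i (\<lambda>y. c) = (\<lambda>y. 0)"
  by (rule ext) (simp add: partial_deriv_eq[OF has_derivative_const])

lemma partial_deriv_add:
  assumes "F differentiable at x" "G differentiable at x"
  shows "partial_deriv i (\<lambda>y. F y + G y) x = partial_deriv i F x + partial_deriv i G x"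
proof -
  have "(F has_derivative frechet_derivative F (at x)) (at x)"
    "(G has_derivative frechet_derivative G (at x)) (at x)"
    using assms by (simp_all add: frechet_derivative_works)
  from has_derivative_add[OF this] show ?thesis
    unfolding partial_deriv_def[of i F] partial_deriv_def[of i G] by (rule partial_deriv_eq)
qed

lemma partial_deriv_linear:
  assumes "bounded_linear l" "F differentiable at x"
  shows "partial_deriv i (\<lambda>y. l (F y)) x = l (partial_deriv i F x)"
proof -
  have "(F has_derivative frechet_derivative F (at x)) (at x)"
    using assms(2) by (simp add: frechet_derivative_works)
  from bounded_linear.has_derivative[OF assms(1) this] show ?thesis
    unfolding partial_deriv_def[of i F] by (rule partial_deriv_eq)
qed

lemma partial_deriv_bilinear:
  assumes "bounded_bilinear bop" "F differentiable at x" "G differentiable at x"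
  shows "partial_deriv i (\<lambda>y. bop (F y) (G y)) x
    = bop (partial_deriv i F x) (G x) + bop (F x) (partial_deriv i G x)"
proof -
  have "(F has_derivative frechet_derivative F (at x)) (at x)"
    "(G has_derivative frechet_derivative G (at x)) (at x)"
    using assms(2,3) by (simp_all add: frechet_derivative_works)
  from bounded_bilinear.FDERIV[OF assms(1) this] show ?thesis
    unfolding partial_deriv_def[of i F] partial_deriv_def[of i G]
    by (subst partial_deriv_eq) (auto simp: add.commute)
qed

lemma Ck_on_cong:
  assumes "open S" "\<And>y. y \<in> S \<Longrightarrow> F y = G y" "Ck_on k S F"
  shows "Ck_on k S G"
  using assms(2,3)
proof (induction k arbitrary: F G)
  case 0
  then show ?case by (auto cong: continuous_on_cong)
next
  case (Suc k)
  have "G differentiable at x" if "x \<in> S" for x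
  proof -
    have "F differentiable at x" using Suc.prems(2) that by simp
    then obtain F' where "(F has_derivative F') (at x)" by (auto simp: differentiable_def)
    then have "(G has_derivative F') (at x)"
      by (rule has_derivative_transform_within_open[OF _ \<open>open S\<close> that]) (rule Suc.prems(1))
    then show ?thesis by (auto simp: differentiable_def)
  qed
  moreover have "Ck_on k S (partial_deriv i G)" for i
  proof (rule Suc.IH)
    show "Ck_on k S (partial_deriv i F)" using Suc.prems(2) by simp
    show "partial_deriv i F y = partial_deriv i G y" if "y \<in> S" for y
      using that by (intro partial_deriv_cong[OF assms(1)] Suc.prems(1))
  qed
  ultimately show ?case by simp
qed

lemma Ck_on_Suc_imp: "Ck_on (Suc k) S F \<Longrightarrow> Ck_on k S F"
proof (induction k arbitrary: F)
  case 0
  then show ?case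
    by (simp add: continuous_at_imp_continuous_on differentiable_imp_continuous_within)
next
  case (Suc k)
  then have "Ck_on k S (partial_deriv i F)" for i
    using Suc.IH[of "partial_deriv i F"] by simp
  with Suc.prems show ?case by simp
qed

lemma Ck_on_add:
  assumes "open S" "Ck_on k S F" "Ck_on k S G"
  shows "Ck_on k S (\<lambda>y. F y + G y)"
  using assms(2,3)
proof (induction k arbitrary: F G)
  case 0
  then show ?case by (simp add: continuous_on_add)
next
  case (Suc k)
  have "Ck_on k S (partial_deriv i (\<lambda>y. F y + G y))" for i
  proof (rule Ck_on_cong[OF assms(1)])
    show "Ck_on k S (\<lambda>y. partial_deriv i F y + partial_deriv i G y)"
      using Suc.prems by (intro Suc.IH) simp_all
    show "partial_deriv i F y + partial_deriv i G y = partial_deriv i (\<lambda>y. F y + G y) y" if "y \<in> S" for y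
      using Suc.prems that by (simp add: partial_deriv_add)
  qed
  with Suc.prems show ?case by (simp add: differentiable_add)
qed

lemma Ck_on_bilinear:
  assumes "open S" "bounded_bilinear bop" "Ck_on k S F" "Ck_on k S G"
  shows "Ck_on k S (\<lambda>y. bop (F y) (G y))"
  using assms(3,4)
proof (induction k arbitrary: F G)
  case 0
  then show ?case
    by (simp add: bounded_bilinear.continuous_on[OF assms(2)])
next
  case (Suc k)
  interpret bounded_bilinear bop by fact
  have "Ck_on k S (\<lambda>y. bop (partial_deriv i F y) (G y) + bop (F y) (partial_deriv i G y))" for i
    using Suc.prems Ck_on_Suc_imp[OF Suc.prems(1)] Ck_on_Suc_imp[OF Suc.prems(2)]
    by (intro Ck_on_add[OF assms(1)] Suc.IH) simp_all
  then have "Ck_on k S (partial_deriv i (\<lambda>y. bop (F y) (G y)))" for i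
    by (rule Ck_on_cong[OF assms(1), rotated])
      (use Suc.prems in \<open>simp add: partial_deriv_bilinear[OF assms(2)]\<close>)
  moreover have "(\<lambda>y. bop (F y) (G y)) differentiable at x" if "x \<in> S" for x
  proof -
    have "F differentiable at x" "G differentiable at x" using Suc.prems that by auto
    then obtain F' G' where "(F has_derivative F') (at x)" "(G has_derivative G') (at x)"
      by (auto simp: differentiable_def)
    from FDERIV[OF this] show ?thesis by (auto simp: differentiable_def)
  qed
  ultimately show ?case by simp
qed

locale open_domain =
  fixes S :: "(real^4) set"
  assumes open_S: "open S"
begin

abbreviation sm :: "(real^4 \<Rightarrow> 'v::real_normed_vector) \<Rightarrow> bool" where
  "sm \<equiv> smooth_map_on S"

lemma sm_diff_at: "sm F \<Longrightarrow> x \<in> S \<Longrightarrow> F differentiable at x"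
  by (metis Ck_on.simps(2) smooth_map_on_def)

lemma sm_cong: "sm F \<Longrightarrow> (\<And>y. y \<in> S \<Longrightarrow> F y = G y) \<Longrightarrow> sm G"
  unfolding smooth_map_on_def by (metis Ck_on_cong[OF open_S, of F G])

lemma sm_partial [intro!, simp]: "sm F \<Longrightarrow> sm (partial_deriv i F)"
  unfolding smooth_map_on_def by (metis Ck_on.simps(2))

lemma sm_const [intro!, simp]:
  fixes c :: "'v::real_normed_vector"
  shows "sm (\<lambda>y. c)"
proof -
  have "Ck_on k S (\<lambda>y. c)" for k and c :: 'v
    by (induction k arbitrary: c) auto
  then show ?thesis by (simp add: smooth_map_on_def)
qed

lemma sm_bilinear:
  assumes "bounded_bilinear bop" "sm F" "sm G"
  shows "sm (\<lambda>y. bop (F y) (G y))"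
  using assms(2,3) by (simp add: smooth_map_on_def Ck_on_bilinear[OF open_S assms(1)])

lemma sm_add [intro!, simp]: "sm F \<Longrightarrow> sm G \<Longrightarrow> sm (\<lambda>y. F y + G y)"
  by (simp add: smooth_map_on_def Ck_on_add[OF open_S])

lemmas sm_scaleR [intro!, simp] = sm_bilinear[OF bounded_bilinear_scaleR]
lemmas sm_inner [intro!, simp] = sm_bilinear[OF bounded_bilinear_inner]
lemmas sm_mult [intro!, simp] = sm_bilinear[OF bounded_bilinear_mult]

lemma sm_uminus [intro!, simp]: "sm F \<Longrightarrow> sm (\<lambda>y. - F y)"
  using sm_scaleR[OF sm_const[of "-1"], of F] by simp

lemma sm_minus [intro!, simp]: "sm F \<Longrightarrow> sm G \<Longrightarrow> sm (\<lambda>y. F y - G y)"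
  using sm_add[OF _ sm_uminus, of F G] by simp

lemma sm_sum [intro!, simp]: "(\<And>i. i \<in> I \<Longrightarrow> sm (F i)) \<Longrightarrow> sm (\<lambda>y. \<Sum>i\<in>I. F i y)"
  by (induction I rule: infinite_finite_induct) auto

lemma sm_prod [intro!, simp]:
  fixes F :: "'i \<Rightarrow> real^4 \<Rightarrow> real"
  shows "(\<And>i. i \<in> I \<Longrightarrow> sm (F i)) \<Longrightarrow> sm (\<lambda>y. \<Prod>i\<in>I. F i y)"
  by (induction I rule: infinite_finite_induct) auto

lemma sm_power [intro!, simp]:
  fixes F :: "real^4 \<Rightarrow> real"
  shows "sm F \<Longrightarrow> sm (\<lambda>y. F y ^ n)"
  by (induction n) auto

lemma sm_nth [intro!, simp]:
  fixes F :: "real^4 \<Rightarrow> real^'n"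
  shows "sm F \<Longrightarrow> sm (\<lambda>y. F y $ a)"
  using sm_inner[OF _ sm_const[of "axis a 1"], of F] by (simp add: inner_axis)

lemma sm_det [intro!, simp]:
  fixes F :: "'n::finite \<Rightarrow> 'n \<Rightarrow> real^4 \<Rightarrow> real"
  assumes "\<And>i j. sm (F i j)"
  shows "sm (\<lambda>y. det (\<chi> i j. F i j y))"
  unfolding det_def using assms by auto

text \<open>The derivative of \<open>1/F\<close> is \<open>- \<partial>F / F^2\<close>, so differentiability of order \<open>k\<close> for \<open>1/F\<close> gives order \<open>k + 1\<close>.\<close>

lemma sm_recip:
  fixes F :: "real^4 \<Rightarrow> real"
  assumes "sm F" "\<And>y. y \<in> S \<Longrightarrow> F y \<noteq> 0"
  shows "sm (\<lambda>y. inverse (F y))"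
proof -
  have "Ck_on k S (\<lambda>y. inverse (F y))" for k
  proof (induction k)
    case 0
    have "continuous_on S F" using assms(1) unfolding smooth_map_on_def by (metis Ck_on.simps(1))
    then show ?case using assms(2) by (simp add: continuous_on_inverse)
  next
    case (Suc k)
    have d: "((\<lambda>y. inverse (F y)) has_derivative
        (\<lambda>h. - (inverse (F x) * frechet_derivative F (at x) h * inverse (F x)))) (at x)"
      if "x \<in> S" for x
      using sm_diff_at[OF assms(1) that] assms(2)[OF that]
      by (intro Deriv.has_derivative_inverse) (auto simp: frechet_derivative_works)
    have "Ck_on k S (\<lambda>y. - partial_deriv i F y)" for i
      using sm_uminus[OF sm_partial[OF assms(1)]] by (simp add: smooth_map_on_def)
    then have "Ck_on k S (\<lambda>y. inverse (F y) * ((- partial_deriv i F y) * inverse (F y)))" for i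
      by (rule Ck_on_bilinear[OF open_S bounded_bilinear_mult Suc
            Ck_on_bilinear[OF open_S bounded_bilinear_mult _ Suc]])
    then have "Ck_on k S (partial_deriv i (\<lambda>y. inverse (F y)))" for i
    proof (rule Ck_on_cong[OF open_S, rotated])
      show "inverse (F y) * ((- partial_deriv i F y) * inverse (F y)) = partial_deriv i (\<lambda>y. inverse (F y)) y"
        if "y \<in> S" for y
        unfolding partial_deriv_eq[OF d[OF that]] by (simp add: partial_deriv_def)
    qed
    moreover have "\<forall>x\<in>S. (\<lambda>y. inverse (F y)) differentiable at x"
      using d differentiable_def by blast
    ultimately show ?case by simp
  qed
  then show ?thesis by (simp add: smooth_map_on_def)
qed

lemma partial_deriv_line:
  fixes F :: "real^4 \<Rightarrow> real"
  assumes "F differentiable at (p + s *\<^sub>R axis i 1)"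
  shows "((\<lambda>s. F (p + s *\<^sub>R axis i 1)) has_real_derivative
    partial_deriv i F (p + s *\<^sub>R axis i 1)) (at s)"
proof -
  have 1: "((\<lambda>s. p + s *\<^sub>R axis i 1) has_derivative (\<lambda>h. h *\<^sub>R axis i 1)) (at s)"
    by (auto intro!: derivative_eq_intros)
  have 2: "(F has_derivative frechet_derivative F (at (p + s *\<^sub>R axis i 1))) (at (p + s *\<^sub>R axis i 1))"
    using assms by (simp add: frechet_derivative_works)
  interpret bounded_linear "frechet_derivative F (at (p + s *\<^sub>R axis i 1))"
    using 2 by (rule has_derivative_bounded_linear)
  show ?thesis
    using has_derivative_compose[OF 1 2]
    by (simp add: has_field_derivative_def partial_deriv_def scaleR mult_commute_abs)
qed

text \<open>Two applications of the mean value theorem, first in direction \<open>i\<close> to a difference in direction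
\<open>j\<close>, then in direction \<open>j\<close>. The left-hand side is symmetric in \<open>i\<close> and \<open>j\<close>; this is what makes mixed
derivatives commute.\<close>

lemma second_difference:
  fixes F :: "real^4 \<Rightarrow> real"
  assumes F: "sm F" and r: "cball x r \<subseteq> S" and s: "0 < s" "2 * s \<le> r"
  shows "\<exists>y \<in> cball x (2 * s).
    F (x + s *\<^sub>R axis i 1 + s *\<^sub>R axis j 1) - F (x + s *\<^sub>R axis i 1) - F (x + s *\<^sub>R axis j 1) + F x
      = s * s * partial_deriv j (partial_deriv i F) y"
proof -
  have near: "x + t *\<^sub>R axis i 1 + u *\<^sub>R axis j 1 \<in> cball x (2 * s)"
    if "0 \<le> t" "t \<le> s" "0 \<le> u" "u \<le> s" for t u
  proof -
    have "norm (t *\<^sub>R axis i (1::real) + u *\<^sub>R axis j 1 :: real^4) \<le> t + u"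
      using norm_triangle_ineq[of "t *\<^sub>R axis i (1::real) :: real^4" "u *\<^sub>R axis j 1"] that
      by simp
    moreover have "dist x (x + t *\<^sub>R axis i 1 + u *\<^sub>R axis j 1)
        = norm (t *\<^sub>R axis i (1::real) + u *\<^sub>R axis j 1 :: real^4)"
      unfolding dist_norm by (subst norm_minus_commute) (simp add: add.assoc)
    ultimately show ?thesis using that by simp
  qed
  have inS: "x + t *\<^sub>R axis i 1 + u *\<^sub>R axis j 1 \<in> S"
    if "0 \<le> t" "t \<le> s" "0 \<le> u" "u \<le> s" for t u
    using near[OF that] r s by auto
  define \<phi> where "\<phi> t = F (x + s *\<^sub>R axis j 1 + t *\<^sub>R axis i 1) - F (x + t *\<^sub>R axis i 1)" for t
  have "DERIV \<phi> t :> partial_deriv i F (x + s *\<^sub>R axis j 1 + t *\<^sub>R axis i 1)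
      - partial_deriv i F (x + t *\<^sub>R axis i 1)" if "0 \<le> t" "t \<le> s" for t
    unfolding \<phi>_def using that inS[of t s] inS[of t 0] s
    by (intro DERIV_diff partial_deriv_line sm_diff_at[OF F]) (auto simp: ac_simps)
  from MVT2[OF s(1) this] obtain \<sigma> where \<sigma>: "0 < \<sigma>" "\<sigma> < s" and e1: "\<phi> s - \<phi> 0 = (s - 0) *
      (partial_deriv i F (x + s *\<^sub>R axis j 1 + \<sigma> *\<^sub>R axis i 1)
      - partial_deriv i F (x + \<sigma> *\<^sub>R axis i 1))" by blast
  have "DERIV (\<lambda>u. partial_deriv i F (x + \<sigma> *\<^sub>R axis i 1 + u *\<^sub>R axis j 1)) u :>
      partial_deriv j (partial_deriv i F) (x + \<sigma> *\<^sub>R axis i 1 + u *\<^sub>R axis j 1)"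
    if "0 \<le> u" "u \<le> s" for u
    using that inS[of \<sigma> u] \<sigma>
    by (intro partial_deriv_line sm_diff_at[OF sm_partial[OF F]]) auto
  from MVT2[OF s(1) this] obtain \<tau> where \<tau>: "0 < \<tau>" "\<tau> < s" and e2:
     "partial_deriv i F (x + \<sigma> *\<^sub>R axis i 1 + s *\<^sub>R axis j 1)
      - partial_deriv i F (x + \<sigma> *\<^sub>R axis i 1 + 0 *\<^sub>R axis j 1) = (s - 0) *
      partial_deriv j (partial_deriv i F) (x + \<sigma> *\<^sub>R axis i 1 + \<tau> *\<^sub>R axis j 1)" by blast
  show ?thesis
  proof (rule bexI)
    show "x + \<sigma> *\<^sub>R axis i 1 + \<tau> *\<^sub>R axis j 1 \<in> cball x (2 * s)"
      using near \<sigma> \<tau> by simp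
    show "F (x + s *\<^sub>R axis i 1 + s *\<^sub>R axis j 1) - F (x + s *\<^sub>R axis i 1) - F (x + s *\<^sub>R axis j 1) + F x
      = s * s * partial_deriv j (partial_deriv i F) (x + \<sigma> *\<^sub>R axis i 1 + \<tau> *\<^sub>R axis j 1)"
      using e1 e2 by (simp add: \<phi>_def ac_simps)
  qed
qed

text \<open>Schwarz: both mixed derivatives at nearby points equal the same second difference quotient, so a
gap between them at \<open>x\<close> would contradict their continuity.\<close>

lemma partial_deriv_commute_real:
  fixes F :: "real^4 \<Rightarrow> real"
  assumes F: "sm F" and x: "x \<in> S"
  shows "partial_deriv i (partial_deriv j F) x = partial_deriv j (partial_deriv i F) x"
proof (rule ccontr)
  let ?P = "partial_deriv i (partial_deriv j F)" and ?Q = "partial_deriv j (partial_deriv i F)"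
  assume "?P x \<noteq> ?Q x"
  then have eta: "0 < dist (?P x) (?Q x) / 2" by simp
  have "isCont ?P x" "isCont ?Q x"
    by (simp_all add: differentiable_imp_continuous_within sm_diff_at[OF _ x] F)
  note this[unfolded continuous_at_eps_delta, rule_format, OF eta]
  then obtain r1 r2 where r1: "r1 > 0" "\<And>y. dist y x < r1 \<Longrightarrow> dist (?P y) (?P x) < dist (?P x) (?Q x) / 2"
    and r2: "r2 > 0" "\<And>y. dist y x < r2 \<Longrightarrow> dist (?Q y) (?Q x) < dist (?P x) (?Q x) / 2"
    by blast
  obtain r0 where r0: "r0 > 0" "cball x r0 \<subseteq> S"
    using open_S x open_contains_cball by blast
  define s where "s = Min {r0, r1, r2} / 4"
  have s: "0 < s" "2 * s \<le> r0" "2 * s < r1" "2 * s < r2"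
    using r0 r1 r2 by (auto simp: s_def min_def)
  obtain y where y: "y \<in> cball x (2 * s)" "F (x + s *\<^sub>R axis j 1 + s *\<^sub>R axis i 1) - F (x + s *\<^sub>R axis j 1)
      - F (x + s *\<^sub>R axis i 1) + F x = s * s * ?P y"
    using second_difference[OF F r0(2) s(1,2), of j i] by blast
  obtain z where z: "z \<in> cball x (2 * s)" "F (x + s *\<^sub>R axis i 1 + s *\<^sub>R axis j 1) - F (x + s *\<^sub>R axis i 1)
      - F (x + s *\<^sub>R axis j 1) + F x = s * s * ?Q z"
    using second_difference[OF F r0(2) s(1,2), of i j] by blast
  have swap: "x + s *\<^sub>R axis j 1 + s *\<^sub>R axis i 1 = x + s *\<^sub>R axis i 1 + s *\<^sub>R axis j 1"
    by simp
  have "s * s * ?P y = s * s * ?Q z"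
    using y(2)[unfolded swap] z(2) by linarith
  then have "?P y = ?Q z" using s by simp
  moreover have "dist (?P y) (?P x) < dist (?P x) (?Q x) / 2" "dist (?Q z) (?Q x) < dist (?P x) (?Q x) / 2"
    using y(1) z(1) s by (intro r1 r2; simp add: dist_commute)+
  ultimately show False
    using dist_triangle3[of "?P x" "?Q x" "?P y"] by simp
qed

text \<open>The scalar case applied to the functions \<open>F \<bullet> b\<close>.\<close>

lemma partial_deriv_commute:
  fixes F :: "real^4 \<Rightarrow> 'v::real_inner"
  assumes F: "sm F" and x: "x \<in> S"
  shows "partial_deriv i (partial_deriv j F) x = partial_deriv j (partial_deriv i F) x"
proof -
  have l: "bounded_linear (\<lambda>u::'v. u \<bullet> b)" for b by (rule bounded_linear_inner_left)
  have *: "partial_deriv i (partial_deriv j (\<lambda>y. F y \<bullet> b)) x = partial_deriv i (partial_deriv j F) x \<bullet> b" for i j b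
  proof -
    have "partial_deriv i (partial_deriv j (\<lambda>y. F y \<bullet> b)) x = partial_deriv i (\<lambda>y. partial_deriv j F y \<bullet> b) x"
      by (intro partial_deriv_cong[OF open_S x] partial_deriv_linear l sm_diff_at F)
    also have "\<dots> = partial_deriv i (partial_deriv j F) x \<bullet> b"
      by (intro partial_deriv_linear l sm_diff_at[OF _ x] sm_partial F)
    finally show ?thesis .
  qed
  have "partial_deriv i (partial_deriv j F) x \<bullet> b = partial_deriv j (partial_deriv i F) x \<bullet> b" for b
    using partial_deriv_commute_real[of "\<lambda>y. F y \<bullet> b" x i j] F x by (simp add: *)
  then have "(partial_deriv i (partial_deriv j F) x - partial_deriv j (partial_deriv i F) x) \<bullet> b = 0" for b
    by (simp add: inner_diff_left)
  then show ?thesis by (metis inner_eq_zero_iff right_minus_eq)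
qed

end

section \<open>The coordinate frame and its dual\<close>

locale immersed_patch = open_domain S + parametrization f
  for S :: "(real^4) set" and f :: "real^4 \<Rightarrow> real^'m" +
  assumes smooth_f: "sm f"
    and immersed: "\<And>x. x \<in> S \<Longrightarrow> inj (frechet_derivative f (at x))"
begin

abbreviation e :: "4 \<Rightarrow> real^4 \<Rightarrow> real^'m" where "e i \<equiv> partial_deriv i f"

abbreviation dual :: "4 \<Rightarrow> real^4 \<Rightarrow> real^'m" where "dual i \<equiv> grad_up f i"

lemmas diff_at = sm_diff_at

lemma sm_e [intro!, simp]: "sm (e i)"
  by (rule sm_partial[OF smooth_f])

lemma sm_g [intro!, simp]: "sm (g i j)"
  unfolding g_def[abs_def] by simp

text \<open>A vector in the kernel of a Gram matrix is sent to a vector of length 0, here by the injective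
differential of \<open>f\<close>.\<close>

lemma g_invertible:
  assumes x: "x \<in> S"
  shows "invertible (\<chi> a b. g a b x)"
  unfolding invertible_left_inverse matrix_left_invertible_ker
proof (intro allI impI)
  fix c :: "real^4" assume "(\<chi> a b. g a b x) *v c = 0"
  then have 0: "(\<Sum>b\<in>UNIV. g a b x * c $ b) = 0" for a
    by (simp add: vec_eq_iff matrix_vector_mult_def)
  let ?F = "frechet_derivative f (at x)"
  have lin: "linear ?F"
    using diff_at[OF smooth_f x] by (rule linear_frechet_derivative)
  have c: "c = (\<Sum>i\<in>UNIV. c $ i *\<^sub>R axis i 1)"
    by (simp add: vec_eq_iff axis_def if_distrib cong: if_cong)
  have "?F c = (\<Sum>i\<in>UNIV. c $ i *\<^sub>R e i x)"
    by (subst c) (simp add: linear_sum[OF lin] linear_cmul[OF lin] partial_deriv_def)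
  then have "?F c \<bullet> ?F c = (\<Sum>a\<in>UNIV. c $ a * (\<Sum>b\<in>UNIV. g a b x * c $ b))"
    by (simp add: inner_sum_left inner_sum_right g_def sum_distrib_left mult_ac inner_commute)
  then have "?F c = 0" by (simp add: 0)
  then have "?F c = ?F 0" by (simp add: linear_0[OF lin])
  then show "c = 0" using immersed[OF x] by (simp add: inj_def)
qed

lemma ginv_g:
  assumes x: "x \<in> S"
  shows "(\<Sum>b\<in>UNIV. ginv a b x * g b c x) = (if a = c then 1 else 0)"
proof -
  have "matrix_inv (\<chi> a b. g a b x) ** (\<chi> a b. g a b x) = mat 1"
    unfolding matrix_inv_def
    using someI_ex[OF g_invertible[OF x, unfolded invertible_def]] by blast
  then show ?thesis
    by (simp add: vec_eq_iff matrix_matrix_mult_def mat_def ginv_def)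
qed

lemma g_ginv:
  assumes x: "x \<in> S"
  shows "(\<Sum>b\<in>UNIV. g a b x * ginv b c x) = (if a = c then 1 else 0)"
proof -
  have "(\<chi> a b. g a b x) ** matrix_inv (\<chi> a b. g a b x) = mat 1"
    unfolding matrix_inv_def
    using someI_ex[OF g_invertible[OF x, unfolded invertible_def]] by blast
  then show ?thesis
    by (simp add: vec_eq_iff matrix_matrix_mult_def mat_def ginv_def)
qed

text \<open>Cramer's rule exhibits the entries of the inverse as quotients of determinants of smooth entries.\<close>

lemma sm_ginv [intro!, simp]: "sm (ginv i j)"
proof -
  let ?G = "\<lambda>x. \<chi> a b. g a b x"
  have det: "det (?G x) \<noteq> 0" if "x \<in> S" for x
    using g_invertible[OF that] by (simp add: invertible_det_nz)
  have "inverse (det (?G x)) * det (\<chi> r l. (if l = i then \<lambda>_. axis j 1 $ r else g r l) x) = ginv i j x"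
    if x: "x \<in> S" for x
  proof -
    have "?G x *v (\<chi> b. ginv b j x) = axis j 1"
      by (simp add: vec_eq_iff matrix_vector_mult_def g_ginv[OF x] axis_def)
    then have "(\<chi> b. ginv b j x) = (\<chi> k. det (\<chi> r l. if l = k then axis j 1 $ r else ?G x $ r $ l) / det (?G x))"
      by (simp only: cramer[OF det[OF x]])
    then have "ginv i j x = det (\<chi> r l. if l = i then axis j 1 $ r else g r l x) / det (?G x)"
      by (simp add: vec_eq_iff cong: if_cong)
    also have "(\<lambda>r l. if l = i then axis j 1 $ r else g r l x)
        = (\<lambda>r l. (if l = i then \<lambda>_. axis j 1 $ r else g r l) x)"
      by (intro ext) simp
    finally show ?thesis by (simp add: field_simps)
  qed
  moreover have "sm (\<lambda>x. inverse (det (?G x)) * det (\<chi> r l. (if l = i then \<lambda>_. axis j 1 $ r else g r l) x))"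
    by (intro sm_mult sm_recip sm_det det) auto
  ultimately show ?thesis by (rule sm_cong[rotated])
qed

lemma sm_grad_up [intro!, simp]: "sm F \<Longrightarrow> sm (grad_up F i)"
  unfolding grad_up_def[abs_def] by (intro sm_sum sm_scaleR sm_ginv sm_partial)

lemma dual_e:
  assumes x: "x \<in> S"
  shows "dual i x \<bullet> e j x = (if i = j then 1 else 0)"
  using ginv_g[OF x, of i j] by (simp add: grad_up_def inner_sum_left g_def)

lemma e_dual: "x \<in> S \<Longrightarrow> e j x \<bullet> dual i x = (if i = j then 1 else 0)"
  by (metis dual_e inner_commute)

lemma dual_dual:
  assumes x: "x \<in> S"
  shows "dual i x \<bullet> dual j x = ginv i j x"
proof -
  have "dual i x \<bullet> dual j x = (\<Sum>a\<in>UNIV. ginv i a x * (e a x \<bullet> dual j x))"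
    unfolding grad_up_def[of f i] by (simp add: inner_sum_left)
  also have "\<dots> = (\<Sum>a\<in>UNIV. if j = a then ginv i a x else 0)"
    by (rule sum.cong) (auto simp: e_dual[OF x])
  finally show ?thesis by simp
qed

lemma ginv_commute: "x \<in> S \<Longrightarrow> ginv i j x = ginv j i x"
  by (metis dual_dual inner_commute)

lemma sum_delta_scaleR: "(\<Sum>k\<in>(UNIV::'i::finite set). (if i = k then 1 else 0) *\<^sub>R (X k :: 'v::real_vector)) = X i"
proof -
  have "(\<Sum>k\<in>UNIV. (if i = k then 1 else 0) *\<^sub>R X k) = (\<Sum>k\<in>UNIV. if i = k then X k else 0)"
    by (rule sum.cong) auto
  then show ?thesis by simp
qed

lemma in_normal_space_iff:
  "v \<in> orthogonal_comp (tangent_space x) \<longleftrightarrow> (\<forall>i. v \<bullet> e i x = 0)"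
proof -
  have "subspace {w. v \<bullet> w = 0}"
    by (auto simp: subspace_def inner_add_right)
  then have "(\<forall>w\<in>span (range (\<lambda>i. e i x)). v \<bullet> w = 0) \<longleftrightarrow> (\<forall>i. v \<bullet> e i x = 0)"
    using span_minimal[of "range (\<lambda>i. e i x)" "{w. v \<bullet> w = 0}"] by (auto intro: span_base)
  then show ?thesis
    by (simp add: orthogonal_comp_def tangent_space_def orthogonal_def inner_commute)
qed

text \<open>The subtracted vector is tangential and has the same inner products with the \<open>e_i\<close> as \<open>v\<close>; by
Pythagoras the difference is the point of the normal space closest to \<open>v\<close>.\<close>

lemma normal_proj_eq:
  assumes x: "x \<in> S"
  shows "normal_proj x v = v - (\<Sum>i\<in>UNIV. (v \<bullet> dual i x) *\<^sub>R e i x)"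
proof -
  let ?N = "orthogonal_comp (tangent_space x)"
  define t where "t = (\<Sum>i\<in>UNIV. (v \<bullet> dual i x) *\<^sub>R e i x)"
  define t' where "t' = (\<Sum>i\<in>UNIV. (v \<bullet> e i x) *\<^sub>R dual i x)"
  have tt: "t = t'"
  proof -
    have "t = (\<Sum>i\<in>UNIV. \<Sum>a\<in>UNIV. (ginv i a x * (v \<bullet> e a x)) *\<^sub>R e i x)"
      by (simp add: t_def grad_up_def inner_sum_right scaleR_sum_left)
    also have "\<dots> = (\<Sum>a\<in>UNIV. \<Sum>i\<in>UNIV. (ginv i a x * (v \<bullet> e a x)) *\<^sub>R e i x)"
      by (rule sum.swap)
    also have "\<dots> = t'"
      by (simp add: t'_def grad_up_def scaleR_sum_right ginv_commute[OF x, of _ i for i] mult.commute)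
    finally show ?thesis .
  qed
  have te: "t \<bullet> e j x = v \<bullet> e j x" for j
  proof -
    have "t \<bullet> e j x = (\<Sum>i\<in>UNIV. (if i = j then 1 else 0) *\<^sub>R (v \<bullet> e i x))"
      unfolding tt t'_def by (simp add: inner_sum_left dual_e[OF x] mult.commute)
    then show ?thesis using sum_delta_scaleR[of j "\<lambda>i. v \<bullet> e i x"] by (simp add: eq_commute)
  qed
  have t_orth: "t \<bullet> w = 0" if "\<And>i. w \<bullet> e i x = 0" for w
    using that inner_commute[of t w] by (simp add: t_def inner_sum_right)
  have n: "v - t \<in> ?N"
    unfolding in_normal_space_iff by (simp add: inner_diff_left te)
  have "v - t = closest_point ?N v"
  proof (rule closest_point_unique)
    show "convex ?N" "closed ?N"
      by (auto intro: subspace_imp_convex closed_subspace subspace_orthogonal_comp)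
    show "v - t \<in> ?N" by (rule n)
    show "\<forall>z\<in>?N. dist v (v - t) \<le> dist v z"
    proof
      fix z assume "z \<in> ?N"
      then have "t \<bullet> (v - t - z) = 0"
        by (intro t_orth) (simp add: in_normal_space_iff inner_diff_left te)
      then have "norm (t + (v - t - z)) ^ 2 = norm t ^ 2 + norm (v - t - z) ^ 2"
        by (intro norm_add_Pythagorean) (simp add: orthogonal_def)
      then have "norm t ^ 2 \<le> norm (v - z) ^ 2" by simp
      then show "dist v (v - t) \<le> dist v z" by (simp add: dist_norm power2_le_iff_abs_le)
    qed
  qed
  then show ?thesis by (simp add: normal_proj_def t_def)
qed

text \<open>Expanding \<open>g_ij = e_i \<bullet> e_j\<close> in the definition of the Christoffel symbols, the six terms collapse to
\<open>2 e_l \<bullet> \<partial>_i e_j\<close> because \<open>\<partial>_i e_j = \<partial>_j e_i\<close>.\<close>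

lemma Gamma_eq:
  assumes x: "x \<in> S"
  shows "Gamma k i j x = dual k x \<bullet> partial_deriv i (e j) x"
proof -
  have dg: "partial_deriv i (g j l) x = partial_deriv i (e j) x \<bullet> e l x + e j x \<bullet> partial_deriv i (e l) x" for i j l
    unfolding g_def[abs_def] by (intro partial_deriv_bilinear[OF bounded_bilinear_inner] diff_at x sm_e)
  have c: "partial_deriv i (e j) x = partial_deriv j (e i) x" for i j
    by (rule partial_deriv_commute[OF smooth_f x])
  have "partial_deriv i (g j l) x + partial_deriv j (g i l) x - partial_deriv l (g i j) x
      = 2 * (e l x \<bullet> partial_deriv i (e j) x)" for l
    unfolding dg using c[of i j] c[of i l] c[of j l] by (simp add: inner_commute)
  then show ?thesis
    by (simp add: Gamma_def grad_up_def inner_sum_left sum_distrib_left mult_ac)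
qed

text \<open>By \<open>Gamma_eq\<close> the Christoffel terms in \<open>\<nabla>_i \<nabla>_j f\<close> subtract exactly the tangential part of \<open>\<partial>_i e_j\<close>.\<close>

lemma h_eq: "x \<in> S \<Longrightarrow> h i j x = normal_proj x (partial_deriv i (e j) x)"
  by (simp add: h_def cd_lo_def Gamma_eq normal_proj_eq inner_commute)

text \<open>Derivative of the duality relation \<open>dual_e\<close>.\<close>

lemma e_d_dual:
  assumes x: "x \<in> S"
  shows "e k x \<bullet> partial_deriv i (dual j) x = - Gamma j i k x"
proof -
  have "partial_deriv i (\<lambda>y. dual j y \<bullet> e k y) x = partial_deriv i (\<lambda>y. if j = k then 1 else (0::real)) x"
    by (rule partial_deriv_cong[OF open_S x]) (simp add: dual_e)
  moreover have "partial_deriv i (\<lambda>y. dual j y \<bullet> e k y) x = partial_deriv i (dual j) x \<bullet> e k x + dual j x \<bullet> partial_deriv i (e k) x"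
    by (intro partial_deriv_bilinear[OF bounded_bilinear_inner] diff_at x sm_e sm_grad_up smooth_f)
  ultimately show ?thesis by (simp add: Gamma_eq[OF x] inner_commute)
qed

section \<open>The ambient tangential frame\<close>

text \<open>The derivative along the tangential part of the \<open>a\<close>-th coordinate vector of the ambient space.\<close>

definition delta :: "'m \<Rightarrow> (real^4 \<Rightarrow> 'v::real_normed_vector) \<Rightarrow> real^4 \<Rightarrow> 'v" where
  "delta a F x = (\<Sum>i\<in>UNIV. (dual i x $ a) *\<^sub>R partial_deriv i F x)"

text \<open>The tangential part of the \<open>a\<close>-th coordinate vector: the function \<open>f\<close> is the position, and its
derivative along a tangent vector is that vector. The numbers \<open>E a x $ b\<close> are the entries of the
matrix of the tangential projection.\<close>

definition E :: "'m \<Rightarrow> real^4 \<Rightarrow> real^'m" where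
  "E a = delta a f"

lemma sm_dual [intro!, simp]: "sm (dual i)"
  by (intro sm_grad_up smooth_f)

lemma sm_delta [intro!, simp]: "sm F \<Longrightarrow> sm (delta a F)"
  unfolding delta_def[abs_def] by (intro sm_sum sm_scaleR sm_nth sm_dual sm_partial)

lemma sm_E [intro!, simp]: "sm (E a)"
  unfolding E_def by (intro sm_delta smooth_f)

lemma delta_cong: "x \<in> S \<Longrightarrow> (\<And>y. y \<in> S \<Longrightarrow> F y = G y) \<Longrightarrow> delta a F x = delta a G x"
  unfolding delta_def by (metis partial_deriv_cong[OF open_S, of x F G])

lemma delta_const [simp]: "delta a (\<lambda>y. c) x = 0"
  by (simp add: delta_def)

lemma delta_add: "x \<in> S \<Longrightarrow> sm F \<Longrightarrow> sm G \<Longrightarrow>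
  delta a (\<lambda>y. F y + G y) x = delta a F x + delta a G x"
  by (simp add: delta_def partial_deriv_add diff_at scaleR_add_right sum.distrib)

lemma delta_bilinear:
  assumes "bounded_bilinear bop" "x \<in> S" "sm F" "sm G"
  shows "delta a (\<lambda>y. bop (F y) (G y)) x = bop (delta a F x) (G x) + bop (F x) (delta a G x)"
proof -
  interpret bounded_bilinear bop by fact
  show ?thesis
    by (simp add: delta_def partial_deriv_bilinear[OF assms(1)] diff_at assms sum_left sum_right
        scaleR_left scaleR_right scaleR_add_right sum.distrib)
qed

lemmas delta_scaleR = delta_bilinear[OF bounded_bilinear_scaleR]
lemmas delta_inner = delta_bilinear[OF bounded_bilinear_inner]
lemmas delta_mult = delta_bilinear[OF bounded_bilinear_mult]

lemma delta_linear: "bounded_linear l \<Longrightarrow> x \<in> S \<Longrightarrow> sm F \<Longrightarrow> delta a (\<lambda>y. l (F y)) x = l (delta a F x)"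
  using bounded_linear.linear[of l]
  by (simp add: delta_def partial_deriv_linear diff_at linear_sum[of l] linear_cmul[of l])

lemma delta_uminus: "x \<in> S \<Longrightarrow> sm F \<Longrightarrow> delta a (\<lambda>y. - F y) x = - delta a F x"
  by (intro delta_linear bounded_linear_minus bounded_linear_ident)

lemma delta_minus: "x \<in> S \<Longrightarrow> sm F \<Longrightarrow> sm G \<Longrightarrow>
  delta a (\<lambda>y. F y - G y) x = delta a F x - delta a G x"
  using delta_add[of x F "\<lambda>y. - G y" a] by (simp add: delta_uminus)

lemma delta_cscaleR: "x \<in> S \<Longrightarrow> sm F \<Longrightarrow> delta a (\<lambda>y. c *\<^sub>R F y) x = c *\<^sub>R delta a F x"
  by (intro delta_linear bounded_linear_scaleR_right)

lemma delta_nth: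
  fixes F :: "real^4 \<Rightarrow> real^'n"
  shows "x \<in> S \<Longrightarrow> sm F \<Longrightarrow> delta a (\<lambda>y. F y $ b) x = delta a F x $ b"
  by (intro delta_linear bounded_linear_vec_nth)

lemma delta_sum: "x \<in> S \<Longrightarrow> (\<And>i. i \<in> I \<Longrightarrow> sm (F i)) \<Longrightarrow>
  delta a (\<lambda>y. \<Sum>i\<in>I. F i y) x = (\<Sum>i\<in>I. delta a (F i) x)"
  by (induction I rule: infinite_finite_induct) (simp_all add: delta_add)

lemma E_eq: "E a x = (\<Sum>i\<in>UNIV. (dual i x $ a) *\<^sub>R e i x)"
  by (simp add: E_def delta_def)

lemma E_commute:
  assumes x: "x \<in> S"
  shows "E a x $ b = E b x $ a"
proof -
  have *: "E a x $ b = (\<Sum>i\<in>UNIV. \<Sum>k\<in>UNIV. ginv i k x * (e k x $ a * e i x $ b))" for a b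
    by (simp add: E_eq grad_up_def sum_distrib_left sum_distrib_right mult_ac)
  show ?thesis
    unfolding * by (subst sum.swap) (simp add: ginv_commute[OF x] mult.commute)
qed

lemma delta_dir: "(\<Sum>a\<in>UNIV. v $ a *\<^sub>R delta a F x) = (\<Sum>i\<in>UNIV. (v \<bullet> dual i x) *\<^sub>R partial_deriv i F x)"
proof -
  have "(\<Sum>a\<in>UNIV. v $ a *\<^sub>R delta a F x) = (\<Sum>a\<in>UNIV. \<Sum>i\<in>UNIV. (v $ a * dual i x $ a) *\<^sub>R partial_deriv i F x)"
    by (simp add: delta_def scaleR_sum_right)
  also have "\<dots> = (\<Sum>i\<in>UNIV. \<Sum>a\<in>UNIV. (v $ a * dual i x $ a) *\<^sub>R partial_deriv i F x)"
    by (rule sum.swap)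
  finally show ?thesis by (simp add: inner_vec_def scaleR_sum_left)
qed

lemma E_dual:
  assumes x: "x \<in> S"
  shows "E a x \<bullet> dual i x = dual i x $ a"
  using sum_delta_scaleR[of i "\<lambda>j. dual j x $ a"]
  by (simp add: E_eq inner_sum_left e_dual[OF x] mult.commute)

text \<open>A derivative along \<open>E a\<close> sees only the tangential part of its direction. This lemma and \<open>E_E\<close>
express that the matrix \<open>E a x $ b\<close> is idempotent.\<close>

lemma E_delta:
  assumes x: "x \<in> S"
  shows "(\<Sum>b\<in>UNIV. E a x $ b *\<^sub>R delta b F x) = delta a F x"
  unfolding delta_dir by (simp add: E_dual[OF x] delta_def)

lemma E_E_sum: "x \<in> S \<Longrightarrow> (\<Sum>b\<in>UNIV. E a x $ b *\<^sub>R E b x) = E a x"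
  unfolding E_def by (fold E_def) (simp add: E_def E_delta[unfolded E_def])

lemma E_E:
  assumes x: "x \<in> S"
  shows "E a x \<bullet> E b x = E a x $ b"
proof -
  have "E a x $ b = (\<Sum>c\<in>UNIV. E a x $ c *\<^sub>R E c x) $ b"
    by (simp only: E_E_sum[OF x])
  also have "\<dots> = (\<Sum>c\<in>UNIV. E a x $ c * E b x $ c)"
    by (simp add: E_commute[OF x, of _ b])
  finally show ?thesis by (simp add: inner_vec_def)
qed

lemma inner_E:
  assumes x: "x \<in> S"
  shows "v \<bullet> E a x = (\<Sum>b\<in>UNIV. v $ b *\<^sub>R E b x) $ a"
  by (simp add: inner_vec_def E_commute[OF x, of _ a])

lemma sum_nth_E:
  assumes x: "x \<in> S"
  shows "(\<Sum>a\<in>UNIV. v $ a *\<^sub>R E a x) = (\<Sum>a\<in>UNIV. (v \<bullet> E a x) *\<^sub>R E a x)"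
proof -
  have "(\<Sum>a\<in>UNIV. (v \<bullet> E a x) *\<^sub>R E a x) = (\<Sum>a\<in>UNIV. \<Sum>b\<in>UNIV. (v $ b * E b x $ a) *\<^sub>R E a x)"
    by (simp add: inner_E[OF x] scaleR_sum_left)
  also have "\<dots> = (\<Sum>b\<in>UNIV. \<Sum>a\<in>UNIV. (v $ b * E b x $ a) *\<^sub>R E a x)"
    by (rule sum.swap)
  also have "\<dots> = (\<Sum>b\<in>UNIV. v $ b *\<^sub>R (\<Sum>a\<in>UNIV. E b x $ a *\<^sub>R E a x))"
    by (simp add: scaleR_sum_right)
  finally show ?thesis by (simp add: E_E_sum[OF x])
qed

lemma normal_proj_nth: "x \<in> S \<Longrightarrow> normal_proj x v = v - (\<Sum>a\<in>UNIV. v $ a *\<^sub>R E a x)"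
  by (simp add: normal_proj_eq E_def delta_dir)

lemma normal_proj_inner: "x \<in> S \<Longrightarrow> normal_proj x v = v - (\<Sum>a\<in>UNIV. (v \<bullet> E a x) *\<^sub>R E a x)"
  by (simp add: normal_proj_nth sum_nth_E)

lemma normal_proj_linear: "x \<in> S \<Longrightarrow> linear (normal_proj x)"
  by (rule linearI)
    (simp_all add: normal_proj_nth scaleR_add_left sum.distrib scaleR_sum_right scaleR_diff_right)

lemmas normal_proj_simps = linear_add[OF normal_proj_linear] linear_diff[OF normal_proj_linear]
  linear_cmul[OF normal_proj_linear] linear_sum[OF normal_proj_linear] linear_0[OF normal_proj_linear]
  linear_neg[OF normal_proj_linear]

lemma sum_delta_scaleR': "(\<Sum>k\<in>(UNIV::'i::finite set). (if k = i then 1 else 0) *\<^sub>R (X k :: 'v::real_vector)) = X i"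
  using sum_delta_scaleR[of i X] by (simp add: eq_commute[of i] cong: if_cong)

lemma normal_proj_e [simp]: "x \<in> S \<Longrightarrow> normal_proj x (e j x) = 0"
  by (simp add: normal_proj_eq e_dual sum_delta_scaleR')

lemma normal_proj_E [simp]: "x \<in> S \<Longrightarrow> normal_proj x (E a x) = 0"
  by (simp add: E_eq normal_proj_simps)

lemma normal_proj_orth [simp]: "x \<in> S \<Longrightarrow> normal_proj x v \<bullet> E a x = 0"
  by (simp add: normal_proj_nth inner_diff_left inner_sum_left E_E inner_E[of x v])

text \<open>Normality is tested on the frame \<open>E\<close>, since all tangential parts below are expanded in it.\<close>

definition normal :: "real^4 \<Rightarrow> real^'m \<Rightarrow> bool" where
  "normal x v \<longleftrightarrow> (\<forall>a. v \<bullet> E a x = 0)"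

lemma normalD: "normal x v \<Longrightarrow> v \<bullet> E a x = 0" "normal x v \<Longrightarrow> E a x \<bullet> v = 0"
  by (simp_all add: normal_def inner_commute)

lemma normal_normal_proj [simp, intro!]: "x \<in> S \<Longrightarrow> normal x (normal_proj x v)"
  by (simp add: normal_def)

lemma normal_add [simp, intro]: "normal x u \<Longrightarrow> normal x v \<Longrightarrow> normal x (u + v)"
  by (simp add: normal_def inner_add_left)

lemma normal_diff [simp, intro]: "normal x u \<Longrightarrow> normal x v \<Longrightarrow> normal x (u - v)"
  by (simp add: normal_def inner_diff_left)

lemma normal_scaleR [simp, intro]: "normal x u \<Longrightarrow> normal x (c *\<^sub>R u)"
  by (simp add: normal_def)

lemma normal_sum [simp, intro]: "(\<And>i. i \<in> I \<Longrightarrow> normal x (F i)) \<Longrightarrow> normal x (\<Sum>i\<in>I. F i)"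
  by (simp add: normal_def inner_sum_left)

lemma inner_normal_proj: "x \<in> S \<Longrightarrow> normal x n \<Longrightarrow> n \<bullet> normal_proj x v = n \<bullet> v"
  by (simp add: normal_proj_inner inner_diff_right inner_sum_right normalD)

lemma inner_normal_proj': "x \<in> S \<Longrightarrow> normal x n \<Longrightarrow> normal_proj x v \<bullet> n = v \<bullet> n"
  by (metis inner_commute inner_normal_proj)

lemma sm_normal_proj [intro!, simp]:
  assumes "sm N" shows "sm (\<lambda>y. normal_proj y (N y))"
proof (rule sm_cong)
  show "sm (\<lambda>y. N y - (\<Sum>a\<in>UNIV. N y $ a *\<^sub>R E a y))" using assms by auto
qed (simp add: normal_proj_nth)

text \<open>The normal connection, with its covariant index turned into an ambient one.\<close>

definition D :: "'m \<Rightarrow> (real^4 \<Rightarrow> real^'m) \<Rightarrow> real^4 \<Rightarrow> real^'m" where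
  "D a N x = normal_proj x (delta a N x)"

text \<open>The second fundamental form, with its two covariant indices turned into ambient ones; see
\<open>B_eq_h\<close>.\<close>

definition B :: "'m \<Rightarrow> 'm \<Rightarrow> real^4 \<Rightarrow> real^'m" where
  "B a b = D a (E b)"

lemma sm_D [intro!, simp]: "sm N \<Longrightarrow> sm (D a N)"
  unfolding D_def[abs_def] by auto

lemma sm_B [intro!, simp]: "sm (B a b)"
  unfolding B_def by auto

lemma normal_D [simp, intro!]: "x \<in> S \<Longrightarrow> normal x (D a N x)"
  by (simp add: D_def)

lemma normal_B [simp, intro!]: "x \<in> S \<Longrightarrow> normal x (B a b x)"
  by (simp add: B_def)

text \<open>Writing \<open>E_b\<close> as a combination of the \<open>e_j\<close>, derivatives of the coefficients only contribute
tangential vectors.\<close>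

lemma B_eq_h:
  assumes x: "x \<in> S"
  shows "B a b x = (\<Sum>i\<in>UNIV. \<Sum>j\<in>UNIV. (dual i x $ a * dual j x $ b) *\<^sub>R h i j x)"
proof -
  have "delta a (E b) x = (\<Sum>j\<in>UNIV. delta a (\<lambda>y. dual j y $ b) x *\<^sub>R e j x + (dual j x $ b) *\<^sub>R delta a (e j) x)"
    unfolding E_eq[abs_def] by (subst delta_sum[OF x]) (simp_all add: delta_scaleR x)
  then have "B a b x = (\<Sum>j\<in>UNIV. (dual j x $ b) *\<^sub>R normal_proj x (delta a (e j) x))"
    by (simp add: B_def D_def normal_proj_simps x)
  also have "\<dots> = (\<Sum>j\<in>UNIV. \<Sum>i\<in>UNIV. (dual i x $ a * dual j x $ b) *\<^sub>R h i j x)"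
    by (simp add: delta_def normal_proj_simps x h_eq scaleR_sum_right mult.commute)
  finally show ?thesis by (subst sum.swap)
qed

lemma h_commute: "x \<in> S \<Longrightarrow> h i j x = h j i x"
  by (simp add: h_eq partial_deriv_commute[OF smooth_f, of x i j])

lemma B_commute: "x \<in> S \<Longrightarrow> B a b x = B b a x"
  unfolding B_eq_h by (subst sum.swap) (simp add: h_commute[of x] mult.commute)

text \<open>The Gauss formula in the frame \<open>E\<close>. The tangential part is found by differentiating
\<open>E_c \<bullet> E_b = (E_c)_b\<close>: the left-hand side yields \<open>\<delta>E_c \<bullet> E_b\<close>, which is the \<open>b\<close>-component of the tangential
part of \<open>\<delta>E_c\<close>, so that \<open>E_c \<bullet> \<delta>E_b\<close> is the \<open>b\<close>-component of the normal part of \<open>\<delta>E_c\<close>. Its last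
summand carries \<open>b\<close> as the index of a normal vector.\<close>

lemma delta_E:
  assumes x: "x \<in> S"
  shows "delta a (E b) x = B a b x + (\<Sum>c\<in>UNIV. (B a c x $ b) *\<^sub>R E c x)"
proof -
  have "B a c x $ b = delta a (E b) x \<bullet> E c x" for c
  proof -
    have "delta a (\<lambda>y. E c y \<bullet> E b y) x = delta a (\<lambda>y. E c y $ b) x"
      by (rule delta_cong[OF x]) (simp add: E_E)
    then have "delta a (E c) x \<bullet> E b x + E c x \<bullet> delta a (E b) x = delta a (E c) x $ b"
      by (simp add: delta_inner delta_nth x)
    then show ?thesis
      by (simp add: B_def D_def normal_proj_nth x inner_E[OF x, symmetric, simplified] inner_commute)
  qed
  then show ?thesis by (simp add: B_def D_def normal_proj_inner x)
qed

lemma inner_delta_E: "x \<in> S \<Longrightarrow> normal x n \<Longrightarrow> n \<bullet> delta a (E b) x = n \<bullet> B a b x"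
  by (simp add: delta_E inner_add_right inner_sum_right normalD)

lemma E_B1: "x \<in> S \<Longrightarrow> (\<Sum>c\<in>UNIV. E a x $ c *\<^sub>R B c b x) = B a b x"
  by (simp add: B_def D_def normal_proj_simps(3,4)[symmetric] E_delta)

lemma E_B2: "x \<in> S \<Longrightarrow> (\<Sum>c\<in>UNIV. E a x $ c *\<^sub>R B b c x) = B b a x"
  using E_B1[of x a b] by (simp add: B_commute[of x b])

lemma E_D: "x \<in> S \<Longrightarrow> (\<Sum>c\<in>UNIV. E a x $ c *\<^sub>R D c N x) = D a N x"
  by (simp add: D_def normal_proj_simps(3,4)[symmetric] E_delta)

text \<open>The Weingarten formula: differentiate \<open>N \<bullet> E_b = 0\<close>.\<close>

lemma delta_normal:
  assumes x: "x \<in> S" and N: "sm N" "\<And>y. y \<in> S \<Longrightarrow> normal y (N y)"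
  shows "delta a N x = D a N x - (\<Sum>b\<in>UNIV. (N x \<bullet> B a b x) *\<^sub>R E b x)"
proof -
  have "delta a N x \<bullet> E b x = - (N x \<bullet> B a b x)" for b
  proof -
    have "delta a (\<lambda>y. N y \<bullet> E b y) x = delta a (\<lambda>y. 0) x"
      using N(2) by (intro delta_cong[OF x]) (simp add: normalD)
    then show ?thesis
      using inner_delta_E[OF x N(2)[OF x], of a b] N(1) by (simp add: delta_inner x)
  qed
  then show ?thesis by (simp add: D_def normal_proj_inner x sum_negf)
qed

text \<open>Both sides are the Hessian of \<open>F\<close> in the directions \<open>c\<close> and \<open>d\<close>. The operators \<open>\<delta>_a\<close> do not commute:
their commutator involves the components \<open>(B_ac)_b\<close>, and projecting the inner index with \<open>E\<close> removes it.
What is left is the symmetry of the mixed partial derivatives and of the Christoffel symbols.\<close>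

lemma hessian_commute:
  fixes F :: "real^4 \<Rightarrow> 'v::real_inner"
  assumes x: "x \<in> S" and F: "sm F"
  shows "(\<Sum>b\<in>UNIV. E d x $ b *\<^sub>R delta c (delta b F) x) = (\<Sum>b\<in>UNIV. E c x $ b *\<^sub>R delta d (delta b F) x)"
proof -
  have split: "(\<Sum>b\<in>UNIV. E d x $ b *\<^sub>R delta c (delta b F) x)
     = (\<Sum>j\<in>UNIV. (E d x \<bullet> delta c (dual j) x) *\<^sub>R partial_deriv j F x)
     + (\<Sum>j\<in>UNIV. (dual j x $ d) *\<^sub>R delta c (partial_deriv j F) x)" for c d
  proof -
    have "delta c (delta b F) x = (\<Sum>j\<in>UNIV. (delta c (dual j) x $ b) *\<^sub>R partial_deriv j F x
        + (dual j x $ b) *\<^sub>R delta c (partial_deriv j F) x)" for b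
      unfolding delta_def[of b F, abs_def]
      by (subst delta_sum[OF x]) (simp_all add: delta_scaleR delta_nth x F)
    then have "(\<Sum>b\<in>UNIV. E d x $ b *\<^sub>R delta c (delta b F) x)
       = (\<Sum>b\<in>UNIV. \<Sum>j\<in>UNIV. (E d x $ b * delta c (dual j) x $ b) *\<^sub>R partial_deriv j F x
        + (E d x $ b * dual j x $ b) *\<^sub>R delta c (partial_deriv j F) x)"
      by (simp add: scaleR_sum_right scaleR_add_right)
    also have "\<dots> = (\<Sum>j\<in>UNIV. \<Sum>b\<in>UNIV. (E d x $ b * delta c (dual j) x $ b) *\<^sub>R partial_deriv j F x
        + (E d x $ b * dual j x $ b) *\<^sub>R delta c (partial_deriv j F) x)"
      by (rule sum.swap)
    also have "\<dots> = (\<Sum>j\<in>UNIV. (E d x \<bullet> delta c (dual j) x) *\<^sub>R partial_deriv j F x)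
        + (\<Sum>j\<in>UNIV. (E d x \<bullet> dual j x) *\<^sub>R delta c (partial_deriv j F) x)"
      by (simp add: inner_vec_def scaleR_sum_left sum.distrib)
    finally show ?thesis by (simp add: E_dual[OF x])
  qed
  have 1: "E d x \<bullet> delta c (dual j) x = E c x \<bullet> delta d (dual j) x" for c d j
  proof -
    have *: "E d x \<bullet> delta c (dual j) x
        = (\<Sum>i\<in>UNIV. \<Sum>k\<in>UNIV. dual i x $ c * (dual k x $ d * - Gamma j i k x))" for c d
      by (simp add: E_eq delta_def[of c] inner_sum_left inner_sum_right e_d_dual[OF x] sum_distrib_left
          sum_negf)
    show ?thesis
      unfolding *
      by (subst sum.swap) (simp add: Gamma_eq[OF x] partial_deriv_commute[OF smooth_f x] mult.left_commute)
  qed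
  have 2: "(\<Sum>j\<in>UNIV. (dual j x $ d) *\<^sub>R delta c (partial_deriv j F) x)
     = (\<Sum>j\<in>UNIV. (dual j x $ c) *\<^sub>R delta d (partial_deriv j F) x)"
    unfolding delta_def scaleR_sum_right
    by (subst sum.swap) (simp add: partial_deriv_commute[OF F x] mult.commute)
  show ?thesis unfolding split using 1[of d c] 2 by simp
qed

lemma trace_E: "x \<in> S \<Longrightarrow> (\<Sum>a\<in>UNIV. E a x $ a) = 4"
proof -
  assume x: "x \<in> S"
  have "(\<Sum>a\<in>UNIV. E a x $ a) = (\<Sum>i\<in>UNIV. dual i x \<bullet> e i x)"
    unfolding E_eq inner_vec_def by (subst sum.swap) simp
  then show ?thesis by (simp add: dual_e x)
qed

section \<open>Ambient components of coordinate tensors\<close>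

text \<open>The ambient components of a field with a covariant index are its values on the frame \<open>E\<close>; those of
a field with a contravariant index are the ambient coordinates of the vector \<open>\<Sum>_j Y^j e_j\<close>. Raising
or lowering an index does not change them, which is the content of \<open>con_ginv\<close>.\<close>

definition cov :: "real^4 \<Rightarrow> (4 \<Rightarrow> 'v::real_vector) \<Rightarrow> 'm \<Rightarrow> 'v" where
  "cov x X a = (\<Sum>i\<in>UNIV. (dual i x $ a) *\<^sub>R X i)"

definition con :: "real^4 \<Rightarrow> (4 \<Rightarrow> 'v::real_vector) \<Rightarrow> 'm \<Rightarrow> 'v" where
  "con x Y a = (\<Sum>j\<in>UNIV. (e j x $ a) *\<^sub>R Y j)"

lemma cov_linear: "linear l \<Longrightarrow> cov x (\<lambda>i. l (X i)) a = l (cov x X a)"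
  by (simp add: cov_def linear_sum[of l] linear_cmul[of l])

lemma con_linear: "linear l \<Longrightarrow> con x (\<lambda>i. l (X i)) a = l (con x X a)"
  by (simp add: con_def linear_sum[of l] linear_cmul[of l])

lemma con_add: "con x (\<lambda>i. X i + Y i) a = con x X a + con x Y a"
  by (simp add: con_def scaleR_add_right sum.distrib)

lemma con_diff: "con x (\<lambda>i. X i - Y i) a = con x X a - con x Y a"
  by (simp add: con_def scaleR_diff_right sum_subtractf)

lemma con_sum: "con x (\<lambda>i. \<Sum>k\<in>I. X k i) a = (\<Sum>k\<in>I. con x (X k) a)"
  unfolding con_def scaleR_sum_right by (rule sum.swap)

lemma cov_sum: "cov x (\<lambda>i. \<Sum>k\<in>I. X k i) a = (\<Sum>k\<in>I. cov x (X k) a)"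
  unfolding cov_def scaleR_sum_right by (rule sum.swap)

lemmas bilinear_cov =
  cov_linear[OF bounded_linear.linear[OF bounded_linear_inner_left]]
  cov_linear[OF bounded_linear.linear[OF bounded_linear_inner_right]]
  cov_linear[OF bounded_linear.linear[OF bounded_linear_scaleR_left]]
  cov_linear[OF bounded_linear.linear[OF bounded_linear_scaleR_right]]
  cov_linear[OF bounded_linear.linear[OF bounded_linear_mult_left]]
  cov_linear[OF bounded_linear.linear[OF bounded_linear_mult_right]]

lemmas bilinear_con =
  con_linear[OF bounded_linear.linear[OF bounded_linear_inner_left]]
  con_linear[OF bounded_linear.linear[OF bounded_linear_inner_right]]
  con_linear[OF bounded_linear.linear[OF bounded_linear_scaleR_left]]
  con_linear[OF bounded_linear.linear[OF bounded_linear_scaleR_right]]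
  con_linear[OF bounded_linear.linear[OF bounded_linear_mult_left]]
  con_linear[OF bounded_linear.linear[OF bounded_linear_mult_right]]

text \<open>Duality of \<open>e_j\<close> and \<open>e^i\<close>, read as \<open>\<Sum>_a (e^i)_a (e_j)_a = \<delta>_ij\<close>.\<close>

lemma contract:
  assumes "bounded_bilinear bop" and x: "x \<in> S"
  shows "(\<Sum>i\<in>UNIV. bop (X i) (Y i)) = (\<Sum>a\<in>UNIV. bop (cov x X a) (con x Y a))"
proof -
  interpret bounded_bilinear bop by fact
  have "(\<Sum>a\<in>UNIV. bop (cov x X a) (con x Y a))
     = (\<Sum>a\<in>UNIV. \<Sum>i\<in>UNIV. \<Sum>j\<in>UNIV. (dual i x $ a * e j x $ a) *\<^sub>R bop (X i) (Y j))"
    unfolding cov_def con_def sum_left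
    by (simp add: sum_right scaleR_left scaleR_right scaleR_sum_right mult.commute)
  also have "\<dots> = (\<Sum>i\<in>UNIV. \<Sum>a\<in>UNIV. \<Sum>j\<in>UNIV. (dual i x $ a * e j x $ a) *\<^sub>R bop (X i) (Y j))"
    by (rule sum.swap)
  also have "\<dots> = (\<Sum>i\<in>UNIV. \<Sum>j\<in>UNIV. \<Sum>a\<in>UNIV. (dual i x $ a * e j x $ a) *\<^sub>R bop (X i) (Y j))"
    by (intro sum.cong refl sum.swap)
  also have "\<dots> = (\<Sum>i\<in>UNIV. \<Sum>j\<in>UNIV. (dual i x \<bullet> e j x) *\<^sub>R bop (X i) (Y j))"
    by (simp add: inner_vec_def scaleR_sum_left)
  also have "\<dots> = (\<Sum>i\<in>UNIV. bop (X i) (Y i))"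
    by (simp add: dual_e[OF x] sum_delta_scaleR)
  finally show ?thesis ..
qed

lemma contract2:
  assumes bop: "bounded_bilinear bop" and x: "x \<in> S"
  shows "(\<Sum>i\<in>UNIV. \<Sum>j\<in>UNIV. bop (X i j) (Y i j))
    = (\<Sum>a\<in>UNIV. \<Sum>b\<in>UNIV. bop (cov x (\<lambda>i. cov x (X i) b) a) (con x (\<lambda>i. con x (Y i) b) a))"
proof -
  have "(\<Sum>i\<in>UNIV. \<Sum>j\<in>UNIV. bop (X i j) (Y i j))
     = (\<Sum>b\<in>UNIV. \<Sum>i\<in>UNIV. bop (cov x (X i) b) (con x (Y i) b))"
    by (subst sum.swap) (simp add: contract[OF bop x])
  also have "\<dots> = (\<Sum>b\<in>UNIV. \<Sum>a\<in>UNIV. bop (cov x (\<lambda>i. cov x (X i) b) a) (con x (\<lambda>i. con x (Y i) b) a))"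
    by (simp add: contract[OF bop x])
  finally show ?thesis by (subst sum.swap)
qed

lemma delta_cov: "delta a F x = cov x (\<lambda>i. partial_deriv i F x) a"
  by (simp add: delta_def cov_def)

lemma B_cov: "x \<in> S \<Longrightarrow> B a b x = cov x (\<lambda>i. cov x (\<lambda>j. h i j x) b) a"
  by (simp add: B_eq_h cov_def scaleR_sum_right)

lemma con_ginv:
  assumes x: "x \<in> S"
  shows "con x (\<lambda>j. \<Sum>k\<in>UNIV. ginv j k x *\<^sub>R X k) a = cov x X a"
proof -
  have "con x (\<lambda>j. \<Sum>k\<in>UNIV. ginv j k x *\<^sub>R X k) a
     = (\<Sum>k\<in>UNIV. \<Sum>j\<in>UNIV. (ginv j k x * e j x $ a) *\<^sub>R X k)"
    unfolding con_def scaleR_sum_right by (subst sum.swap) (simp add: mult.commute)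
  then show ?thesis
    by (simp add: cov_def grad_up_def scaleR_sum_left ginv_commute[OF x, of k for k])
qed

lemma con_grad_up: "x \<in> S \<Longrightarrow> con x (\<lambda>j. grad_up F j x) a = delta a F x"
  by (simp add: grad_up_def con_ginv delta_cov)

lemma con_dual: "x \<in> S \<Longrightarrow> con x (\<lambda>j. dual j x) a = E a x"
  by (simp add: con_grad_up E_def)

lemma cov_e: "x \<in> S \<Longrightarrow> cov x (\<lambda>j. e j x) a = E a x"
  by (simp add: E_def delta_cov)

lemma con_pgrad_up: "x \<in> S \<Longrightarrow> con x (\<lambda>j. pgrad_up N j x) a = D a N x"
  by (simp add: pgrad_up_def con_linear[OF normal_proj_linear] con_grad_up D_def)

lemma cov_pgrad: "x \<in> S \<Longrightarrow> cov x (\<lambda>j. pgrad N j x) a = D a N x"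
  by (simp add: pgrad_def cov_linear[OF normal_proj_linear] delta_cov D_def)

lemma con_h_mix: "x \<in> S \<Longrightarrow> con x (\<lambda>j. h_mix i j x) a = cov x (\<lambda>k. h i k x) a"
  by (simp add: h_mix_def con_ginv)

lemma cov_con_swap: "cov x (\<lambda>i. con x (\<lambda>j. X i j) b) a = con x (\<lambda>j. cov x (\<lambda>i. X i j) a) b"
  unfolding cov_def con_def scaleR_sum_right by (subst sum.swap) (simp add: mult.commute)

lemma cov_h_mix: "x \<in> S \<Longrightarrow> con x (\<lambda>j. cov x (\<lambda>i. h_mix i j x) b) a = B b a x"
  unfolding cov_con_swap[symmetric] by (simp add: con_h_mix B_cov)

lemma con_h_up: "x \<in> S \<Longrightarrow> con x (\<lambda>i. con x (\<lambda>j. h_up i j x) b) a = B a b x"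
proof -
  assume x: "x \<in> S"
  have "con x (\<lambda>j. h_up i j x) b = (\<Sum>k\<in>UNIV. ginv i k x *\<^sub>R cov x (\<lambda>l. h k l x) b)" for i
  proof -
    have "h_up i j x = (\<Sum>l\<in>UNIV. ginv j l x *\<^sub>R (\<Sum>k\<in>UNIV. ginv i k x *\<^sub>R h k l x))" for j
      unfolding h_up_def by (subst sum.swap) (simp add: scaleR_sum_right mult.commute)
    then show ?thesis by (simp add: con_ginv[OF x] cov_sum bilinear_cov)
  qed
  then show ?thesis by (simp add: con_ginv[OF x] B_cov[OF x])
qed

lemma h_up_commute: "x \<in> S \<Longrightarrow> h_up i j x = h_up j i x"
  unfolding h_up_def by (subst sum.swap) (simp add: h_commute[of x] mult.commute)

text \<open>The common core of the divergence formulas for contravariant fields (\<open>u_j = e_j\<close>) and covariant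
fields (\<open>u_j = e^j\<close>). The derivatives of the frame vectors become the Christoffel terms.\<close>

lemma sum_delta_comp:
  assumes x: "x \<in> S" and u: "\<And>j. sm (u j)" and T: "\<And>j. sm (T j)"
  shows "(\<Sum>a\<in>UNIV. delta a (\<lambda>y. \<Sum>j\<in>UNIV. (u j y $ a) *\<^sub>R T j y) x)
    = (\<Sum>i\<in>UNIV. \<Sum>j\<in>UNIV. (dual i x \<bullet> partial_deriv i (u j) x) *\<^sub>R T j x
        + (dual i x \<bullet> u j x) *\<^sub>R partial_deriv i (T j) x)"
proof -
  let ?R = "\<lambda>a i j. (dual i x $ a * partial_deriv i (u j) x $ a) *\<^sub>R T j x
        + (dual i x $ a * u j x $ a) *\<^sub>R partial_deriv i (T j) x"
  have "delta a (\<lambda>y. \<Sum>j\<in>UNIV. (u j y $ a) *\<^sub>R T j y) x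
      = (\<Sum>j\<in>UNIV. \<Sum>i\<in>UNIV. ?R a i j)" for a
  proof -
    have "delta a (\<lambda>y. \<Sum>j\<in>UNIV. (u j y $ a) *\<^sub>R T j y) x
       = (\<Sum>j\<in>UNIV. delta a (u j) x $ a *\<^sub>R T j x + (u j x $ a) *\<^sub>R delta a (T j) x)"
      by (subst delta_sum[OF x]) (simp_all add: delta_scaleR delta_nth x u T)
    then show ?thesis
      by (simp add: delta_def scaleR_sum_right scaleR_sum_left sum.distrib mult.commute)
  qed
  then have "(\<Sum>a\<in>UNIV. delta a (\<lambda>y. \<Sum>j\<in>UNIV. (u j y $ a) *\<^sub>R T j y) x)
     = (\<Sum>a\<in>UNIV. \<Sum>j\<in>UNIV. \<Sum>i\<in>UNIV. ?R a i j)" by simp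
  also have "\<dots> = (\<Sum>j\<in>UNIV. \<Sum>a\<in>UNIV. \<Sum>i\<in>UNIV. ?R a i j)" by (rule sum.swap)
  also have "\<dots> = (\<Sum>j\<in>UNIV. \<Sum>i\<in>UNIV. \<Sum>a\<in>UNIV. ?R a i j)" by (intro sum.cong refl sum.swap)
  also have "\<dots> = (\<Sum>i\<in>UNIV. \<Sum>j\<in>UNIV. \<Sum>a\<in>UNIV. ?R a i j)" by (rule sum.swap)
  finally show ?thesis by (simp add: inner_vec_def scaleR_sum_left sum.distrib)
qed

lemma dvg_eq:
  assumes x: "x \<in> S" and T: "\<And>j. sm (T j)"
  shows "dvg T x = (\<Sum>a\<in>UNIV. delta a (\<lambda>y. con y (\<lambda>j. T j y) a) x)"
proof -
  have "(\<Sum>a\<in>UNIV. delta a (\<lambda>y. con y (\<lambda>j. T j y) a) x)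
     = (\<Sum>i\<in>UNIV. \<Sum>j\<in>UNIV. Gamma i i j x *\<^sub>R T j x
        + (if i = j then 1 else 0) *\<^sub>R partial_deriv i (T j) x)"
    unfolding con_def by (subst sum_delta_comp[OF x _ T]) (simp_all add: Gamma_eq[OF x] dual_e[OF x])
  also have "\<dots> = dvg T x"
    by (simp add: sum.distrib sum_delta_scaleR dvg_def cd_up_def)
  finally show ?thesis ..
qed

lemma div_cov:
  assumes x: "x \<in> S" and X: "\<And>j. sm (X j)"
  shows "(\<Sum>j\<in>UNIV. \<Sum>k\<in>UNIV. ginv j k x *\<^sub>R cd_lo X k j x)
    = (\<Sum>a\<in>UNIV. delta a (\<lambda>y. cov y (\<lambda>j. X j y) a) x)"
proof -
  have d: "dual i x \<bullet> partial_deriv i (dual j) x = - (\<Sum>k\<in>UNIV. ginv i k x * Gamma j i k x)" for i j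
    unfolding grad_up_def[of f i] by (simp add: inner_sum_left e_d_dual[OF x] sum_negf)
  have "(\<Sum>a\<in>UNIV. delta a (\<lambda>y. cov y (\<lambda>j. X j y) a) x)
     = (\<Sum>i\<in>UNIV. \<Sum>j\<in>UNIV. (- (\<Sum>k\<in>UNIV. ginv i k x * Gamma j i k x)) *\<^sub>R X j x
        + ginv i j x *\<^sub>R partial_deriv i (X j) x)"
    unfolding cov_def by (subst sum_delta_comp[OF x _ X]) (simp_all add: d dual_dual[OF x])
  also have "\<dots> = (\<Sum>i\<in>UNIV. \<Sum>j\<in>UNIV. ginv i j x *\<^sub>R partial_deriv i (X j) x)
      - (\<Sum>i\<in>UNIV. \<Sum>j\<in>UNIV. \<Sum>k\<in>UNIV. (ginv i k x * Gamma j i k x) *\<^sub>R X j x)"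
    by (simp add: sum.distrib sum_negf sum_subtractf scaleR_sum_left)
  also have "(\<Sum>i\<in>UNIV. \<Sum>j\<in>UNIV. \<Sum>k\<in>UNIV. (ginv i k x * Gamma j i k x) *\<^sub>R X j x)
     = (\<Sum>i\<in>UNIV. \<Sum>k\<in>UNIV. \<Sum>j\<in>UNIV. (ginv i k x * Gamma j i k x) *\<^sub>R X j x)"
    by (intro sum.cong refl sum.swap)
  also have "(\<Sum>i\<in>UNIV. \<Sum>j\<in>UNIV. ginv i j x *\<^sub>R partial_deriv i (X j) x)
      - (\<Sum>i\<in>UNIV. \<Sum>k\<in>UNIV. \<Sum>j\<in>UNIV. (ginv i k x * Gamma j i k x) *\<^sub>R X j x)
      = (\<Sum>i\<in>UNIV. \<Sum>j\<in>UNIV. ginv i j x *\<^sub>R cd_lo X i j x)"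
    by (simp add: cd_lo_def scaleR_diff_right scaleR_sum_right sum_subtractf)
  also have "\<dots> = (\<Sum>i\<in>UNIV. \<Sum>j\<in>UNIV. ginv j i x *\<^sub>R cd_lo X i j x)"
    by (simp add: ginv_commute[OF x])
  finally show ?thesis by (subst sum.swap) simp
qed

lemma sm_pgrad [intro!, simp]: "sm N \<Longrightarrow> sm (pgrad N i)"
  unfolding pgrad_def[abs_def] by (intro sm_normal_proj sm_partial)

lemma sm_pgrad_up [intro!, simp]: "sm N \<Longrightarrow> sm (pgrad_up N i)"
  unfolding pgrad_up_def[abs_def] by (intro sm_normal_proj sm_grad_up)

lemma lap_perp_eq:
  assumes x: "x \<in> S" and N: "sm N"
  shows "lap_perp N x = normal_proj x (\<Sum>a\<in>UNIV. delta a (D a N) x)"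
proof -
  have "delta a (\<lambda>y. cov y (\<lambda>j. pgrad N j y) a) x = delta a (D a N) x" for a
    by (rule delta_cong[OF x]) (simp add: cov_pgrad)
  then show ?thesis by (simp add: lap_perp_def div_cov x N)
qed

lemma E_e:
  assumes x: "x \<in> S"
  shows "E a x \<bullet> e j x = e j x $ a"
proof -
  have "e j x = (\<Sum>b\<in>UNIV. e j x $ b *\<^sub>R E b x)"
    using normal_proj_e[OF x, of j] by (simp add: normal_proj_nth x)
  then show ?thesis using inner_E[OF x, of "e j x" a] by (simp add: inner_commute)
qed

lemma E_eq': "x \<in> S \<Longrightarrow> E a x = (\<Sum>l\<in>UNIV. (e l x $ a) *\<^sub>R dual l x)"
  by (simp add: vec_eq_iff E_commute[of x a]) (simp add: E_eq mult.commute)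

lemma E_con:
  assumes x: "x \<in> S"
  shows "(\<Sum>c\<in>UNIV. E a x $ c *\<^sub>R con x X c) = con x X a"
proof -
  have "(\<Sum>c\<in>UNIV. E a x $ c *\<^sub>R con x X c) = (\<Sum>j\<in>UNIV. (E a x \<bullet> e j x) *\<^sub>R X j)"
    unfolding con_def scaleR_sum_right by (subst sum.swap) (simp add: inner_vec_def scaleR_sum_left)
  then show ?thesis by (simp add: E_e[OF x] con_def)
qed

lemma partial_deriv_sum:
  assumes x: "x \<in> S" and "\<And>j. j \<in> I \<Longrightarrow> sm (F j)"
  shows "partial_deriv k (\<lambda>y. \<Sum>j\<in>I. F j y) x = (\<Sum>j\<in>I. partial_deriv k (F j) x)"
  using assms(2) by (induction I rule: infinite_finite_induct) (simp_all add: partial_deriv_add diff_at x)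

text \<open>The divergence in one index leaves the other index free, and the sum over \<open>b\<close> alone has a spurious
normal part in \<open>c\<close> which comes from differentiating \<open>e_j\<close>. Contracting \<open>c\<close> with \<open>E\<close> removes it.\<close>

lemma con_dvg2:
  assumes x: "x \<in> S" and T: "\<And>i j. sm (T i j)"
  shows "con x (\<lambda>j. dvg2 T j x) a
    = (\<Sum>c\<in>UNIV. E a x $ c *\<^sub>R (\<Sum>b\<in>UNIV. delta b (\<lambda>y. con y (\<lambda>j. con y (\<lambda>k. T j k y) b) c) x))"
proof -
  have sw: "con y (\<lambda>j. con y (\<lambda>k. T j k y) b) c = (\<Sum>k\<in>UNIV. (e k y $ b) *\<^sub>R con y (\<lambda>j. T j k y) c)" for y b c
    unfolding con_def scaleR_sum_right by (subst sum.swap) (simp add: mult.commute)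
  have sc: "sm (\<lambda>y. con y (\<lambda>j. T j k y) c)" for k c
    unfolding con_def by (intro sm_sum sm_scaleR sm_nth sm_e T)
  have pd: "partial_deriv k (\<lambda>y. con y (\<lambda>j. T j k y) c) x
       = (\<Sum>j\<in>UNIV. (partial_deriv k (e j) x $ c) *\<^sub>R T j k x) + con x (\<lambda>j. partial_deriv k (T j k) x) c" for k c
    unfolding con_def
    by (subst partial_deriv_sum[OF x]) (simp_all add: T partial_deriv_bilinear[OF bounded_bilinear_scaleR] diff_at x
        partial_deriv_linear[OF bounded_linear_vec_nth] sum.distrib)
  have 1: "(\<Sum>b\<in>UNIV. delta b (\<lambda>y. con y (\<lambda>j. con y (\<lambda>k. T j k y) b) c) x)
     = (\<Sum>i\<in>UNIV. \<Sum>k\<in>UNIV. Gamma i i k x *\<^sub>R con x (\<lambda>j. T j k x) c)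
     + (\<Sum>k\<in>UNIV. con x (\<lambda>j. partial_deriv k (T j k) x) c)
     + (\<Sum>k\<in>UNIV. \<Sum>j\<in>UNIV. (partial_deriv k (e j) x $ c) *\<^sub>R T j k x)" for c
    unfolding sw
    by (subst sum_delta_comp[OF x])
      (simp_all add: sc pd dual_e[OF x] Gamma_eq[OF x, symmetric] sum.distrib sum_delta_scaleR)
  have 2: "(\<Sum>c\<in>UNIV. E a x $ c *\<^sub>R (\<Sum>k\<in>UNIV. \<Sum>j\<in>UNIV. (partial_deriv k (e j) x $ c) *\<^sub>R T j k x))
     = (\<Sum>k\<in>UNIV. \<Sum>j\<in>UNIV. con x (\<lambda>l. Gamma l k j x *\<^sub>R T j k x) a)"
  proof -
    have "(\<Sum>c\<in>UNIV. E a x $ c *\<^sub>R (\<Sum>k\<in>UNIV. \<Sum>j\<in>UNIV. (partial_deriv k (e j) x $ c) *\<^sub>R T j k x))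
      = (\<Sum>c\<in>UNIV. \<Sum>k\<in>UNIV. \<Sum>j\<in>UNIV. (E a x $ c * partial_deriv k (e j) x $ c) *\<^sub>R T j k x)"
      by (simp add: scaleR_sum_right)
    also have "\<dots> = (\<Sum>k\<in>UNIV. \<Sum>c\<in>UNIV. \<Sum>j\<in>UNIV. (E a x $ c * partial_deriv k (e j) x $ c) *\<^sub>R T j k x)"
      by (rule sum.swap)
    also have "\<dots> = (\<Sum>k\<in>UNIV. \<Sum>j\<in>UNIV. \<Sum>c\<in>UNIV. (E a x $ c * partial_deriv k (e j) x $ c) *\<^sub>R T j k x)"
      by (intro sum.cong refl sum.swap)
    also have "\<dots> = (\<Sum>k\<in>UNIV. \<Sum>j\<in>UNIV. (E a x \<bullet> partial_deriv k (e j) x) *\<^sub>R T j k x)"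
      by (simp add: inner_vec_def scaleR_sum_left)
    finally show ?thesis
      by (simp add: E_eq'[OF x] inner_sum_left Gamma_eq[OF x] con_def scaleR_sum_left)
  qed
  have "(\<Sum>c\<in>UNIV. E a x $ c *\<^sub>R (\<Sum>b\<in>UNIV. delta b (\<lambda>y. con y (\<lambda>j. con y (\<lambda>k. T j k y) b) c) x))
     = (\<Sum>c\<in>UNIV. \<Sum>i\<in>UNIV. \<Sum>k\<in>UNIV. Gamma i i k x *\<^sub>R E a x $ c *\<^sub>R con x (\<lambda>j. T j k x) c)
     + (\<Sum>c\<in>UNIV. \<Sum>k\<in>UNIV. E a x $ c *\<^sub>R con x (\<lambda>j. partial_deriv k (T j k) x) c)
     + (\<Sum>k\<in>UNIV. \<Sum>j\<in>UNIV. con x (\<lambda>l. Gamma l k j x *\<^sub>R T j k x) a)"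
    unfolding 1 2[symmetric] by (simp add: scaleR_add_right sum.distrib scaleR_sum_right mult.commute)
  also have "(\<Sum>c\<in>UNIV. \<Sum>k\<in>UNIV. E a x $ c *\<^sub>R con x (\<lambda>j. partial_deriv k (T j k) x) c)
     = (\<Sum>k\<in>UNIV. con x (\<lambda>j. partial_deriv k (T j k) x) a)"
    by (subst sum.swap) (simp add: E_con[OF x])
  also have "(\<Sum>c\<in>UNIV. \<Sum>i\<in>UNIV. \<Sum>k\<in>UNIV. Gamma i i k x *\<^sub>R E a x $ c *\<^sub>R con x (\<lambda>j. T j k x) c)
     = (\<Sum>i\<in>UNIV. \<Sum>c\<in>UNIV. \<Sum>k\<in>UNIV. Gamma i i k x *\<^sub>R E a x $ c *\<^sub>R con x (\<lambda>j. T j k x) c)"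
    by (rule sum.swap)
  also have "\<dots> = (\<Sum>i\<in>UNIV. \<Sum>k\<in>UNIV. \<Sum>c\<in>UNIV. Gamma i i k x *\<^sub>R E a x $ c *\<^sub>R con x (\<lambda>j. T j k x) c)"
    by (intro sum.cong refl sum.swap)
  also have "\<dots> = (\<Sum>i\<in>UNIV. \<Sum>k\<in>UNIV. Gamma i i k x *\<^sub>R con x (\<lambda>j. T j k x) a)"
    by (simp only: scaleR_sum_right[symmetric] E_con[OF x])
  also have "(\<Sum>i\<in>UNIV. \<Sum>k\<in>UNIV. Gamma i i k x *\<^sub>R con x (\<lambda>j. T j k x) a)
     + (\<Sum>k\<in>UNIV. con x (\<lambda>j. partial_deriv k (T j k) x) a)
     + (\<Sum>k\<in>UNIV. \<Sum>j\<in>UNIV. con x (\<lambda>l. Gamma l k j x *\<^sub>R T j k x) a)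
     = con x (\<lambda>j. dvg2 T j x) a"
    by (simp add: dvg2_def cd_upup_def con_add con_sum bilinear_con sum.distrib)
  finally show ?thesis ..
qed

section \<open>The Willmore-type operator and the currents in ambient components\<close>

lemma sm_Gamma [intro!, simp]: "sm (Gamma k i j)"
  unfolding Gamma_def[abs_def]
  by (intro sm_mult sm_const sm_sum sm_minus sm_add sm_partial sm_g sm_ginv)

lemma sm_h [intro!, simp]: "sm (h i j)"
  unfolding h_def[abs_def] cd_lo_def by simp

lemma sm_h_mix [intro!, simp]: "sm (h_mix i j)"
  unfolding h_mix_def[abs_def] by simp

lemma sm_h_up [intro!, simp]: "sm (h_up i j)"
  unfolding h_up_def[abs_def] by simp

lemma sm_H [intro!, simp]: "sm H"
  unfolding H_def[abs_def] by simp

lemma sm_H_sq [intro!, simp]: "sm H_sq"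
  unfolding H_sq_def[abs_def] by simp

lemma sm_pgradH_sq [intro!, simp]: "sm pgradH_sq"
  unfolding pgradH_sq_def[abs_def] by simp

lemma sm_Hh_sq [intro!, simp]: "sm Hh_sq"
  unfolding Hh_sq_def[abs_def] by simp

lemma sm_Hhh [intro!, simp]: "sm Hhh"
  unfolding Hhh_def[abs_def] by simp

lemma sm_HhH [intro!, simp]: "sm (HhH i j)"
  unfolding HhH_def[abs_def] by simp

lemma sm_dvg2 [intro!, simp]: "(\<And>i j. sm (T i j)) \<Longrightarrow> sm (dvg2 T j)"
  unfolding dvg2_def[abs_def] cd_upup_def by simp

lemma sm_lap_perp [intro!, simp]:
  assumes "sm N" shows "sm (lap_perp N)"
proof (rule sm_cong)
  show "sm (\<lambda>x. normal_proj x (\<Sum>a\<in>UNIV. delta a (D a N) x))"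
    using assms by (intro sm_normal_proj sm_sum sm_delta sm_D)
qed (simp add: lap_perp_eq assms)

lemma normal_lap_perp [simp]: "x \<in> S \<Longrightarrow> normal x (lap_perp N x)"
  by (simp add: lap_perp_def)

lemma H_eq:
  assumes x: "x \<in> S"
  shows "H x = (1/4) *\<^sub>R (\<Sum>a\<in>UNIV. B a a x)"
proof -
  have "(\<Sum>a\<in>UNIV. B a a x)
     = (\<Sum>a\<in>UNIV. \<Sum>i\<in>UNIV. \<Sum>j\<in>UNIV. (dual i x $ a * dual j x $ a) *\<^sub>R h i j x)"
    by (simp add: B_eq_h[OF x])
  also have "\<dots> = (\<Sum>i\<in>UNIV. \<Sum>a\<in>UNIV. \<Sum>j\<in>UNIV. (dual i x $ a * dual j x $ a) *\<^sub>R h i j x)"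
    by (rule sum.swap)
  also have "\<dots> = (\<Sum>i\<in>UNIV. \<Sum>j\<in>UNIV. \<Sum>a\<in>UNIV. (dual i x $ a * dual j x $ a) *\<^sub>R h i j x)"
    by (intro sum.cong refl sum.swap)
  also have "\<dots> = (\<Sum>i\<in>UNIV. \<Sum>j\<in>UNIV. (dual i x \<bullet> dual j x) *\<^sub>R h i j x)"
    by (simp add: inner_vec_def scaleR_sum_left)
  finally show ?thesis by (simp add: H_def dual_dual[OF x])
qed

lemma normal_H [simp]: "x \<in> S \<Longrightarrow> normal x (H x)"
  by (simp add: H_eq)

text \<open>The shape operator in the direction of the mean curvature vector, as a bilinear form on ambient
indices; \<open>A2\<close> below is the square of this operator.\<close>

definition A :: "'m \<Rightarrow> 'm \<Rightarrow> real^4 \<Rightarrow> real" where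
  "A a b x = H x \<bullet> B a b x"

lemma sm_A [intro!, simp]: "sm (A a b)"
  unfolding A_def[abs_def] by simp

lemma A_commute: "x \<in> S \<Longrightarrow> A a b x = A b a x"
  by (simp add: A_def B_commute[of x a b])

lemmas bounded_bilinear_scaleR_flip = bounded_bilinear.flip[OF bounded_bilinear_scaleR]

lemma Hhh_eq:
  assumes x: "x \<in> S"
  shows "Hhh x = (\<Sum>a\<in>UNIV. \<Sum>b\<in>UNIV. A a b x *\<^sub>R B a b x)"
  unfolding Hhh_def contract2[OF bounded_bilinear_scaleR_flip x]
  by (simp add: bilinear_con con_h_up[OF x] B_cov[OF x, symmetric] A_def)

lemma normal_Hhh [simp]: "x \<in> S \<Longrightarrow> normal x (Hhh x)"
  by (simp add: Hhh_eq)

lemma Hh_sq_eq: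
  assumes x: "x \<in> S"
  shows "Hh_sq x = (\<Sum>a\<in>UNIV. \<Sum>b\<in>UNIV. A a b x * A a b x)"
  unfolding Hh_sq_def contract2[OF bounded_bilinear_mult x]
  by (simp add: bilinear_con bilinear_cov con_h_up[OF x] B_cov[OF x, symmetric] A_def)

lemma pgradH_sq_eq:
  assumes x: "x \<in> S"
  shows "pgradH_sq x = (\<Sum>a\<in>UNIV. D a H x \<bullet> D a H x)"
  unfolding pgradH_sq_def contract[OF bounded_bilinear_inner x]
  by (simp add: con_pgrad_up[OF x] cov_pgrad[OF x])

text \<open>The normal field that is coupled to \<open>B\<close> in the stress and whose normal derivative is the leading
term of the flux. Its three summands enter both the operator and the currents only through this
combination.\<close>

definition Z :: "real^4 \<Rightarrow> real^'m" where
  "Z x = (1/2) *\<^sub>R lap_perp H x + (1/2) *\<^sub>R Hhh x - 7 *\<^sub>R (H_sq x *\<^sub>R H x)"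

definition energy_density :: "real^4 \<Rightarrow> real" where
  "energy_density x = pgradH_sq x - Hh_sq x + 7 * (H_sq x)\<^sup>2"

definition A2 :: "'m \<Rightarrow> 'm \<Rightarrow> real^4 \<Rightarrow> real" where
  "A2 a b x = (\<Sum>c\<in>UNIV. A a c x * A b c x)"

text \<open>The field \<open>\<nabla>_k ((H \<bullet> h^jk) H)\<close>, see \<open>con_dvg2_HhH\<close>.\<close>

definition divAH :: "'m \<Rightarrow> real^4 \<Rightarrow> real^'m" where
  "divAH a x = (\<Sum>c\<in>UNIV. E a x $ c *\<^sub>R (\<Sum>b\<in>UNIV. delta b (\<lambda>y. A c b y *\<^sub>R H y) x))"

definition BDH :: "'m \<Rightarrow> real^4 \<Rightarrow> real" where
  "BDH a x = (\<Sum>b\<in>UNIV. B a b x \<bullet> D b H x)"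

definition ADH :: "'m \<Rightarrow> real^4 \<Rightarrow> real^'m" where
  "ADH a x = (\<Sum>b\<in>UNIV. A a b x *\<^sub>R D b H x)"

lemma sm_Z [intro!, simp]: "sm Z"
  unfolding Z_def[abs_def] by simp

lemma sm_energy_density [intro!, simp]: "sm energy_density"
  unfolding energy_density_def[abs_def] by simp

lemma sm_A2 [intro!, simp]: "sm (A2 a b)"
  unfolding A2_def[abs_def] by simp

lemma sm_divAH [intro!, simp]: "sm (divAH a)"
  unfolding divAH_def[abs_def] by simp

lemma sm_BDH [intro!, simp]: "sm (BDH a)"
  unfolding BDH_def[abs_def] by simp

lemma sm_ADH [intro!, simp]: "sm (ADH a)"
  unfolding ADH_def[abs_def] by simp

lemma normal_Z [simp]: "x \<in> S \<Longrightarrow> normal x (Z x)"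
  by (simp add: Z_def)

lemma normal_ADH [simp]: "x \<in> S \<Longrightarrow> normal x (ADH a x)"
  by (simp add: ADH_def)

lemma con_HhH:
  assumes x: "x \<in> S"
  shows "con x (\<lambda>i. con x (\<lambda>j. HhH i j x) b) a = A a b x *\<^sub>R H x"
  by (simp add: HhH_def bilinear_con con_h_up[OF x] A_def)

lemma con_dvg2_HhH:
  assumes x: "x \<in> S"
  shows "con x (\<lambda>j. dvg2 HhH j x) a = divAH a x"
proof -
  have "delta b (\<lambda>y. con y (\<lambda>j. con y (\<lambda>k. HhH j k y) b) c) x = delta b (\<lambda>y. A c b y *\<^sub>R H y) x" for b c
    by (rule delta_cong[OF x]) (simp add: con_HhH)
  then show ?thesis by (simp add: con_dvg2[OF x] divAH_def)
qed

lemma dvg2_HhH_transpose: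
  assumes x: "x \<in> S"
  shows "dvg2 (\<lambda>a b. HhH b a) j x = dvg2 HhH j x"
proof -
  have "partial_deriv k (HhH j i) x = partial_deriv k (HhH i j) x" for i j k
    by (rule partial_deriv_cong[OF open_S x]) (simp add: HhH_def h_up_commute)
  moreover have "HhH j i x = HhH i j x" for i j
    by (simp add: HhH_def h_up_commute[OF x])
  ultimately show ?thesis by (simp add: dvg2_def cd_upup_def)
qed

lemma E_A:
  assumes x: "x \<in> S"
  shows "(\<Sum>d\<in>UNIV. E a x $ d * A d b x) = A a b x"
  unfolding A_def E_B1[OF x, of a b, symmetric] by (simp add: inner_sum_right)

lemma delta_normal_E:
  assumes x: "x \<in> S" and N: "sm N" "\<And>y. y \<in> S \<Longrightarrow> normal y (N y)"
  shows "delta a N x \<bullet> E c x = - (N x \<bullet> B a c x)"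
proof -
  have "delta a (\<lambda>y. N y \<bullet> E c y) x = delta a (\<lambda>y. 0) x"
    using N(2) by (intro delta_cong[OF x]) (simp add: normalD)
  then show ?thesis
    using inner_delta_E[OF x N(2)[OF x], of a c] N(1) by (simp add: delta_inner x)
qed

text \<open>The tangential part of \<open>\<nabla>_k ((H \<bullet> h^jk) H)\<close> comes from the shape operator acting on the second factor
\<open>H\<close> only.\<close>

lemma divAH_tangential:
  assumes x: "x \<in> S"
  shows "divAH a x = normal_proj x (divAH a x) - (\<Sum>c\<in>UNIV. A2 a c x *\<^sub>R E c x)"
proof -
  have "divAH a x \<bullet> E c x = - A2 a c x" for c
  proof -
    have d: "delta b (\<lambda>y. A d b y *\<^sub>R H y) x \<bullet> E c x = - (A d b x * A c b x)" for b d
      using delta_normal_E[OF x sm_H, of b c]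
      by (simp add: delta_scaleR x inner_add_left normalD A_def B_commute[OF x, of b c])
    have "divAH a x \<bullet> E c x = - (\<Sum>d\<in>UNIV. \<Sum>b\<in>UNIV. E a x $ d * A d b x * A c b x)"
      unfolding divAH_def by (simp add: inner_sum_left d sum_distrib_left sum_negf mult.assoc)
    also have "\<dots> = - (\<Sum>b\<in>UNIV. \<Sum>d\<in>UNIV. E a x $ d * A d b x * A c b x)"
      by (subst sum.swap) simp
    finally show ?thesis
      by (simp add: sum_distrib_right[symmetric] E_A[OF x] A2_def)
  qed
  then show ?thesis by (simp add: normal_proj_inner[OF x] sum_negf)
qed

lemma D_add: "x \<in> S \<Longrightarrow> sm F \<Longrightarrow> sm G \<Longrightarrow> D a (\<lambda>y. F y + G y) x = D a F x + D a G x"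
  by (simp add: D_def delta_add normal_proj_simps)

lemma D_minus: "x \<in> S \<Longrightarrow> sm F \<Longrightarrow> sm G \<Longrightarrow> D a (\<lambda>y. F y - G y) x = D a F x - D a G x"
  by (simp add: D_def delta_minus normal_proj_simps)

lemma D_cscaleR: "x \<in> S \<Longrightarrow> sm F \<Longrightarrow> D a (\<lambda>y. c *\<^sub>R F y) x = c *\<^sub>R D a F x"
  by (simp add: D_def delta_cscaleR normal_proj_simps)

lemma D_Z:
  assumes x: "x \<in> S"
  shows "D a Z x = (1/2) *\<^sub>R D a (lap_perp H) x + (1/2) *\<^sub>R D a Hhh x
    - 7 *\<^sub>R D a (\<lambda>y. H_sq y *\<^sub>R H y) x"
  unfolding Z_def[abs_def]
  by (simp only: D_add D_minus D_cscaleR x sm_add sm_minus sm_scaleR sm_const sm_lap_perp sm_H sm_Hhh sm_H_sq)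

text \<open>For a normal field \<open>N\<close> the gradient \<open>\<nabla>N\<close> differs from \<open>\<pi>_n \<nabla>N\<close> by the Weingarten term, so each
combination \<open>c (\<nabla>N - 2 \<pi>_n \<nabla>N)\<close> of the definition splits into \<open>- c DN\<close> and \<open>- c (B \<bullet> N)\<close>, and
\<open>\<onehalf> \<nabla>\<Delta>_\<perp> H\<close> together with the term \<open>h \<bullet> \<Delta>_\<perp> H\<close> becomes \<open>\<onehalf> D\<Delta>_\<perp> H\<close> plus \<open>\<onehalf> B \<bullet> \<Delta>_\<perp> H\<close>. These pieces
assemble to \<open>Z\<close>. In the same way the terms with \<open>\<nabla>_i ((H \<bullet> h^ij) H)\<close> leave \<open>2 A^2\<close> in the tangential part.\<close>

lemma con_V:
  assumes x: "x \<in> S"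
  shows "con x (\<lambda>j. V j x) a =
    (\<Sum>b\<in>UNIV. (energy_density x * E a x $ b + B a b x \<bullet> Z x - 2 * (D a H x \<bullet> D b H x) + 2 * A2 a b x) *\<^sub>R E b x)
    + D a Z x - (2 * BDH a x) *\<^sub>R H x + 2 *\<^sub>R ADH a x + 2 *\<^sub>R normal_proj x (divAH a x)"
proof -
  let ?L = "lap_perp H" and ?K = "\<lambda>y. H_sq y *\<^sub>R H y"
  have t1: "con x (\<lambda>j. c *\<^sub>R grad_up F j x) a = c *\<^sub>R delta a F x" for c and F :: "real^4 \<Rightarrow> real^'m"
    by (simp add: bilinear_con con_grad_up[OF x])
  have t2: "con x (\<lambda>j. 2 *\<^sub>R (\<Sum>i\<in>UNIV. (pgrad_up H j x \<bullet> pgrad H i x) *\<^sub>R grad_up f i x)) a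
     = 2 *\<^sub>R (\<Sum>b\<in>UNIV. (D a H x \<bullet> D b H x) *\<^sub>R E b x)"
    unfolding contract[OF bounded_bilinear_scaleR x]
    by (simp add: bilinear_con bilinear_cov con_sum cov_pgrad[OF x] con_pgrad_up[OF x] con_dual[OF x])
  have t3: "con x (\<lambda>j. \<Sum>i\<in>UNIV. (h_mix i j x \<bullet> ?L x) *\<^sub>R grad_up f i x) a
     = (\<Sum>b\<in>UNIV. (B a b x \<bullet> ?L x) *\<^sub>R E b x)"
    unfolding contract[OF bounded_bilinear_scaleR x]
    by (simp add: bilinear_con bilinear_cov con_sum cov_h_mix[OF x] con_dual[OF x] B_commute[OF x, of _ a])
  have t5: "con x (\<lambda>j. 2 *\<^sub>R ((\<Sum>i\<in>UNIV. h_mix i j x \<bullet> grad_up H i x) *\<^sub>R H x)) a = (2 * BDH a x) *\<^sub>R H x"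
    unfolding contract[OF bounded_bilinear_inner x]
    by (simp add: bilinear_con con_sum cov_h_mix[OF x] con_grad_up[OF x] BDH_def D_def inner_normal_proj x
        B_commute[OF x, of _ a])
  have t6: "con x (\<lambda>j. 2 *\<^sub>R (\<Sum>i\<in>UNIV. (H x \<bullet> h_mix i j x) *\<^sub>R pgrad_up H i x)) a = 2 *\<^sub>R ADH a x"
    unfolding contract[OF bounded_bilinear_scaleR x]
    by (simp add: bilinear_con bilinear_cov con_sum cov_h_mix[OF x] con_pgrad_up[OF x] ADH_def A_def
        B_commute[OF x, of _ a])
  have t7: "con x (\<lambda>j. c *\<^sub>R dvg2 (\<lambda>a b. HhH b a) j x) a = c *\<^sub>R divAH a x" for c
    by (simp add: dvg2_HhH_transpose[OF x] bilinear_con con_dvg2_HhH[OF x])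
  have t8: "con x (\<lambda>j. c *\<^sub>R normal_proj x (dvg2 (\<lambda>a b. HhH b a) j x)) a = c *\<^sub>R normal_proj x (divAH a x)" for c
    by (simp add: dvg2_HhH_transpose[OF x] bilinear_con con_linear[OF normal_proj_linear[OF x]] con_dvg2_HhH[OF x])
  have t9: "con x (\<lambda>j. normal_proj x (grad_up F j x)) a = D a F x"
      "con x (\<lambda>j. c *\<^sub>R normal_proj x (grad_up F j x)) a = c *\<^sub>R D a F x" for c F
    by (simp_all add: bilinear_con con_linear[OF normal_proj_linear[OF x]] con_grad_up[OF x] D_def)
  have V: "con x (\<lambda>j. V j x) a = pgradH_sq x *\<^sub>R E a x
    - 2 *\<^sub>R (\<Sum>b\<in>UNIV. (D a H x \<bullet> D b H x) *\<^sub>R E b x)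
    + (\<Sum>b\<in>UNIV. (B a b x \<bullet> ?L x) *\<^sub>R E b x)
    + (1/2) *\<^sub>R delta a ?L x
    - (2 * BDH a x) *\<^sub>R H x + 2 *\<^sub>R ADH a x
    - 2 *\<^sub>R divAH a x + 4 *\<^sub>R normal_proj x (divAH a x)
    - (1/2) *\<^sub>R delta a Hhh x - Hh_sq x *\<^sub>R E a x + D a Hhh x
    + (7 * (H_sq x)\<^sup>2) *\<^sub>R E a x + 7 *\<^sub>R delta a ?K x - 14 *\<^sub>R D a ?K x"
    unfolding V_def con_add con_diff t1 t2 t3 t5 t6 t7 t8 t9 E_def ..
  have dn: "delta a ?L x = D a ?L x - (\<Sum>b\<in>UNIV. (B a b x \<bullet> ?L x) *\<^sub>R E b x)"
    "delta a Hhh x = D a Hhh x - (\<Sum>b\<in>UNIV. (B a b x \<bullet> Hhh x) *\<^sub>R E b x)"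
    "delta a ?K x = D a ?K x - (\<Sum>b\<in>UNIV. (B a b x \<bullet> ?K x) *\<^sub>R E b x)"
    by (subst delta_normal[OF x]; simp add: inner_commute)+
  have phiE: "energy_density x *\<^sub>R E a x = (\<Sum>b\<in>UNIV. (energy_density x * E a x $ b) *\<^sub>R E b x)"
    using arg_cong[OF E_E_sum[OF x, of a], of "\<lambda>v. energy_density x *\<^sub>R v"] by (simp add: scaleR_sum_right)
  have T: "(\<Sum>b\<in>UNIV. (energy_density x * E a x $ b + B a b x \<bullet> Z x - 2 * (D a H x \<bullet> D b H x) + 2 * A2 a b x) *\<^sub>R E b x)
     = energy_density x *\<^sub>R E a x
       + (1/2) *\<^sub>R (\<Sum>b\<in>UNIV. (B a b x \<bullet> ?L x) *\<^sub>R E b x)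
       + (1/2) *\<^sub>R (\<Sum>b\<in>UNIV. (B a b x \<bullet> Hhh x) *\<^sub>R E b x)
       - 7 *\<^sub>R (\<Sum>b\<in>UNIV. (B a b x \<bullet> ?K x) *\<^sub>R E b x)
       - 2 *\<^sub>R (\<Sum>b\<in>UNIV. (D a H x \<bullet> D b H x) *\<^sub>R E b x)
       + 2 *\<^sub>R (\<Sum>b\<in>UNIV. A2 a b x *\<^sub>R E b x)"
    by (simp add: phiE Z_def mult.assoc inner_add_right inner_diff_right scaleR_add_left scaleR_diff_left
        sum.distrib sum_subtractf scaleR_sum_right)
  show ?thesis
    unfolding V T dn D_Z[OF x] divAH_tangential[OF x, of a, THEN arg_cong[where f="\<lambda>v. 2 *\<^sub>R v"]]
    by (rule vec_eq_iff[THEN iffD2]) (simp add: energy_density_def field_simps del: sum_component)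
qed

lemma bounded_bilinear_wedge: "bounded_bilinear ((\<and>\<and>) :: real^'m \<Rightarrow> real^'m \<Rightarrow> real^'m^'m)"
  by (rule bilinear_conv_bounded_bilinear[THEN iffD1])
    (auto simp: bilinear_def wedge_def vec_eq_iff algebra_simps intro!: linearI)

lemma wedge_commute: "u \<and>\<and> v = - (v \<and>\<and> u)"
  by (simp add: wedge_def vec_eq_iff)

lemma con_M:
  assumes x: "x \<in> S"
  shows "con x (\<lambda>j. M j x) a = Z x \<and>\<and> E a x + 2 *\<^sub>R (H x \<and>\<and> D a H x)
    + 2 *\<^sub>R (\<Sum>b\<in>UNIV. A a b x *\<^sub>R (H x \<and>\<and> E b x))"
proof -
  interpret w: bounded_bilinear "(\<and>\<and>) :: real^'m \<Rightarrow> real^'m \<Rightarrow> real^'m^'m"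
    by (rule bounded_bilinear_wedge)
  have lin: "linear ((\<and>\<and>) u)" for u :: "real^'m"
    by (rule bounded_linear.linear[OF w.bounded_linear_right])
  have t1: "con x (\<lambda>j. c *\<^sub>R (u \<and>\<and> grad_up F j x)) a = c *\<^sub>R (u \<and>\<and> delta a F x)" for c and u :: "real^'m" and F
    by (simp add: bilinear_con con_linear[OF lin] con_grad_up[OF x])
  have t2: "con x (\<lambda>j. c *\<^sub>R (u \<and>\<and> pgrad_up F j x)) a = c *\<^sub>R (u \<and>\<and> D a F x)" for c and u :: "real^'m" and F
    by (simp add: bilinear_con con_linear[OF lin] con_pgrad_up[OF x])
  have t3: "con x (\<lambda>j. 2 *\<^sub>R (\<Sum>i\<in>UNIV. (H x \<bullet> h_up i j x) *\<^sub>R (H x \<and>\<and> partial_deriv i f x))) a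
     = 2 *\<^sub>R (\<Sum>b\<in>UNIV. A a b x *\<^sub>R (H x \<and>\<and> E b x))"
    unfolding contract[OF bounded_bilinear_scaleR_flip x]
    by (simp add: bilinear_con con_sum cov_linear[OF lin] cov_e[OF x] h_up_commute[OF x] con_h_up[OF x] A_def B_commute[OF x])
  show ?thesis
    unfolding M_def con_add con_diff t1 t2 t3
    by (simp add: Z_def E_def w.add_left w.diff_left w.scaleR_left)
qed

lemma lap_perp_Z:
  assumes x: "x \<in> S"
  shows "lap_perp Z x = (1/2) *\<^sub>R lap_perp (lap_perp H) x + (1/2) *\<^sub>R lap_perp Hhh x
    - 7 *\<^sub>R lap_perp (\<lambda>y. H_sq y *\<^sub>R H y) x"
proof -
  have "delta a (D a Z) x = (1/2) *\<^sub>R delta a (D a (lap_perp H)) x + (1/2) *\<^sub>R delta a (D a Hhh) x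
    - 7 *\<^sub>R delta a (D a (\<lambda>y. H_sq y *\<^sub>R H y)) x" for a
  proof -
    have "delta a (D a Z) x = delta a (\<lambda>y. (1/2) *\<^sub>R D a (lap_perp H) y + (1/2) *\<^sub>R D a Hhh y
      - 7 *\<^sub>R D a (\<lambda>y. H_sq y *\<^sub>R H y) y) x"
      by (rule delta_cong[OF x]) (rule D_Z)
    then show ?thesis
      by (simp only: delta_add delta_minus delta_cscaleR x sm_add sm_minus sm_scaleR sm_const
          sm_D sm_lap_perp sm_H sm_Hhh sm_H_sq)
  qed
  then show ?thesis
    by (simp add: lap_perp_eq x normal_proj_simps sum.distrib sum_subtractf scaleR_sum_right)
qed

lemma sum_h_h_up:
  assumes x: "x \<in> S"
  shows "(\<Sum>i\<in>UNIV. \<Sum>j\<in>UNIV. (v \<bullet> h i j x) *\<^sub>R h_up i j x) = (\<Sum>a\<in>UNIV. \<Sum>b\<in>UNIV. (v \<bullet> B a b x) *\<^sub>R B a b x)"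
  unfolding contract2[OF bounded_bilinear_scaleR x]
  by (simp add: bilinear_cov con_h_up[OF x] B_cov[OF x, symmetric])

text \<open>All terms of the operator that contain \<open>\<Delta>_\<perp> H\<close>, \<open>(H \<bullet> h^ij) h_ij\<close> or \<open>|H|^2 H\<close> linearly combine into \<open>Z\<close>, and the three
multiples of \<open>H\<close> by squared norms into the energy density.\<close>

lemma willmore_eq:
  assumes x: "x \<in> S"
  shows "willmore x = - (lap_perp Z x + (\<Sum>a\<in>UNIV. \<Sum>b\<in>UNIV. (Z x \<bullet> B a b x) *\<^sub>R B a b x)
     + (4 * energy_density x) *\<^sub>R H x
     - 2 *\<^sub>R (\<Sum>a\<in>UNIV. \<Sum>b\<in>UNIV. (D a H x \<bullet> D b H x) *\<^sub>R B a b x)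
     + 4 *\<^sub>R (\<Sum>a\<in>UNIV. \<Sum>b\<in>UNIV. A2 a b x *\<^sub>R B a b x)
     - 2 *\<^sub>R normal_proj x (\<Sum>a\<in>UNIV. delta a (\<lambda>y. BDH a y *\<^sub>R H y) x)
     + 2 *\<^sub>R normal_proj x (\<Sum>a\<in>UNIV. delta a (ADH a) x)
     + 2 *\<^sub>R normal_proj x (\<Sum>a\<in>UNIV. delta a (divAH a) x))"
proof -
  let ?L = "lap_perp H x"
  have w2: "(\<Sum>i\<in>UNIV. \<Sum>k\<in>UNIV. (h i k x \<bullet> ?L) *\<^sub>R h_up i k x) = (\<Sum>a\<in>UNIV. \<Sum>b\<in>UNIV. (?L \<bullet> B a b x) *\<^sub>R B a b x)"
    using sum_h_h_up[OF x, of ?L] by (simp add: inner_commute[of ?L])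
  have w4: "dvg (\<lambda>j y. (\<Sum>i\<in>UNIV. h_mix i j y \<bullet> grad_up H i y) *\<^sub>R H y) x = (\<Sum>a\<in>UNIV. delta a (\<lambda>y. BDH a y *\<^sub>R H y) x)"
  proof -
    have "con y (\<lambda>j. (\<Sum>i\<in>UNIV. h_mix i j y \<bullet> grad_up H i y) *\<^sub>R H y) a = BDH a y *\<^sub>R H y" if y: "y \<in> S" for y a
      unfolding contract[OF bounded_bilinear_inner y]
      by (simp add: bilinear_con con_sum cov_h_mix[OF y] con_grad_up[OF y] BDH_def D_def inner_normal_proj y
          B_commute[OF y, of _ a])
    then show ?thesis by (subst dvg_eq[OF x]) (auto intro!: sum.cong delta_cong[OF x])
  qed
  have w5: "dvg (\<lambda>j y. \<Sum>i\<in>UNIV. (H y \<bullet> h_mix i j y) *\<^sub>R pgrad_up H i y) x = (\<Sum>a\<in>UNIV. delta a (ADH a) x)"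
  proof -
    have "con y (\<lambda>j. \<Sum>i\<in>UNIV. (H y \<bullet> h_mix i j y) *\<^sub>R pgrad_up H i y) a = ADH a y" if y: "y \<in> S" for y a
      unfolding contract[OF bounded_bilinear_scaleR y]
      by (simp add: bilinear_con bilinear_cov con_sum cov_h_mix[OF y] con_pgrad_up[OF y] ADH_def A_def
          B_commute[OF y, of _ a])
    then show ?thesis by (subst dvg_eq[OF x]) (auto intro!: sum.cong delta_cong[OF x])
  qed
  have w6: "(\<Sum>i\<in>UNIV. \<Sum>j\<in>UNIV. (pgrad H i x \<bullet> pgrad H j x) *\<^sub>R h_up i j x)
     = (\<Sum>a\<in>UNIV. \<Sum>b\<in>UNIV. (D a H x \<bullet> D b H x) *\<^sub>R B a b x)"
    unfolding contract2[OF bounded_bilinear_scaleR x]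
    by (simp add: bilinear_cov con_h_up[OF x] cov_pgrad[OF x])
  have w8: "dvg (dvg2 HhH) x = (\<Sum>a\<in>UNIV. delta a (divAH a) x)"
    by (subst dvg_eq[OF x]) (auto intro!: sum.cong delta_cong[OF x] con_dvg2_HhH)
  have w10: "(\<Sum>i\<in>UNIV. \<Sum>j\<in>UNIV. \<Sum>p\<in>UNIV. \<Sum>q\<in>UNIV.
        ((H x \<bullet> h_up i j x) * (h i j x \<bullet> h p q x)) *\<^sub>R h_up p q x)
     = (\<Sum>a\<in>UNIV. \<Sum>b\<in>UNIV. (Hhh x \<bullet> B a b x) *\<^sub>R B a b x)"
  proof -
    define l where "l v = (\<Sum>a\<in>UNIV. \<Sum>b\<in>UNIV. (v \<bullet> B a b x) *\<^sub>R B a b x)" for v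
    have lin: "linear l"
      by (rule linearI) (simp_all add: l_def inner_add_left scaleR_add_left sum.distrib scaleR_sum_right)
    have "(\<Sum>p\<in>UNIV. \<Sum>q\<in>UNIV. ((H x \<bullet> h_up i j x) * (h i j x \<bullet> h p q x)) *\<^sub>R h_up p q x)
        = (H x \<bullet> h_up i j x) *\<^sub>R l (h i j x)" for i j
      unfolding l_def sum_h_h_up[OF x, symmetric] by (simp add: scaleR_sum_right)
    then show ?thesis
      by (simp add: l_def[symmetric] Hhh_def linear_sum[OF lin] linear_cmul[OF lin])
  qed
  have w11: "(\<Sum>i\<in>UNIV. \<Sum>j\<in>UNIV. \<Sum>k\<in>UNIV.
        ((H x \<bullet> h i j x) * (H x \<bullet> h_mix k i x)) *\<^sub>R h_up j k x)
     = (\<Sum>a\<in>UNIV. \<Sum>b\<in>UNIV. A2 a b x *\<^sub>R B a b x)"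
  proof -
    have c: "(\<Sum>i\<in>UNIV. (H x \<bullet> h j i x) * (H x \<bullet> h_mix k i x))
        = (\<Sum>c\<in>UNIV. (H x \<bullet> cov x (\<lambda>i. h j i x) c) * (H x \<bullet> cov x (\<lambda>i. h k i x) c))" for j k
      unfolding contract[OF bounded_bilinear_mult x]
      by (simp add: bilinear_cov bilinear_con con_h_mix[OF x])
    have "(\<Sum>i\<in>UNIV. \<Sum>j\<in>UNIV. \<Sum>k\<in>UNIV.
        ((H x \<bullet> h i j x) * (H x \<bullet> h_mix k i x)) *\<^sub>R h_up j k x)
      = (\<Sum>j\<in>UNIV. \<Sum>i\<in>UNIV. \<Sum>k\<in>UNIV. ((H x \<bullet> h j i x) * (H x \<bullet> h_mix k i x)) *\<^sub>R h_up j k x)"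
      by (subst sum.swap) (simp add: h_commute[OF x])
    also have "\<dots> = (\<Sum>j\<in>UNIV. \<Sum>k\<in>UNIV. (\<Sum>i\<in>UNIV. (H x \<bullet> h j i x) * (H x \<bullet> h_mix k i x)) *\<^sub>R h_up j k x)"
      unfolding scaleR_sum_left by (intro sum.cong refl sum.swap)
    finally show ?thesis
      unfolding c contract2[OF bounded_bilinear_scaleR x]
      by (simp add: bilinear_cov cov_sum con_h_up[OF x] B_cov[OF x, symmetric] A2_def A_def)
  qed
  have Zs: "(\<Sum>a\<in>UNIV. \<Sum>b\<in>UNIV. (Z x \<bullet> B a b x) *\<^sub>R B a b x)
     = (1/2) *\<^sub>R (\<Sum>a\<in>UNIV. \<Sum>b\<in>UNIV. (?L \<bullet> B a b x) *\<^sub>R B a b x)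
     + (1/2) *\<^sub>R (\<Sum>a\<in>UNIV. \<Sum>b\<in>UNIV. (Hhh x \<bullet> B a b x) *\<^sub>R B a b x)
     - (7 * H_sq x) *\<^sub>R (\<Sum>a\<in>UNIV. \<Sum>b\<in>UNIV. (H x \<bullet> B a b x) *\<^sub>R B a b x)"
    by (simp add: Z_def inner_add_left inner_diff_left scaleR_add_left scaleR_diff_left sum.distrib
        sum_subtractf scaleR_sum_right mult.assoc)
  show ?thesis
    unfolding willmore_def w2 w4 w5 w6 w8 w10 w11 Zs lap_perp_Z[OF x] sum_h_h_up[OF x] energy_density_def
    by (simp add: algebra_simps)
qed

section \<open>The Codazzi equation\<close>

text \<open>A tangential index contracted with a normal vector gives zero.\<close>

lemma normal_contract:
  fixes X :: "'m \<Rightarrow> 'v::real_vector"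
  assumes x: "x \<in> S" and w: "normal x w" and X: "\<And>a. (\<Sum>b\<in>UNIV. E a x $ b *\<^sub>R X b) = X a"
  shows "(\<Sum>a\<in>UNIV. w $ a *\<^sub>R X a) = 0"
proof -
  have "(\<Sum>a\<in>UNIV. w $ a *\<^sub>R X a) = (\<Sum>a\<in>UNIV. \<Sum>b\<in>UNIV. (w $ a * E b x $ a) *\<^sub>R X b)"
    by (subst X[symmetric]) (simp add: scaleR_sum_right E_commute[OF x])
  also have "\<dots> = (\<Sum>b\<in>UNIV. (w \<bullet> E b x) *\<^sub>R X b)"
    by (subst sum.swap) (simp add: inner_vec_def scaleR_sum_left)
  finally show ?thesis using w by (simp add: normalD)
qed

lemma inner_delta_B:
  assumes x: "x \<in> S" and n: "normal x n"
  shows "n \<bullet> delta a (B b d) x = n \<bullet> delta a (delta b (E d)) x - (\<Sum>c\<in>UNIV. (B b c x $ d) * (n \<bullet> B a c x))"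
proof -
  have "delta a (B b d) x = delta a (\<lambda>y. delta b (E d) y - (\<Sum>c\<in>UNIV. (B b c y $ d) *\<^sub>R E c y)) x"
    by (rule delta_cong[OF x]) (simp add: delta_E)
  also have "\<dots> = delta a (delta b (E d)) x
      - (\<Sum>c\<in>UNIV. (delta a (B b c) x $ d) *\<^sub>R E c x + (B b c x $ d) *\<^sub>R delta a (E c) x)"
    by (simp add: delta_minus delta_sum delta_scaleR delta_nth x)
  finally show ?thesis
    by (simp add: inner_diff_right inner_sum_right inner_add_right normalD[OF n] inner_delta_E[OF x n])
qed

text \<open>Rewrite \<open>B\<close> by the Gauss formula as a second derivative of \<open>f\<close>. The correction term carries \<open>d\<close> as the
index of a normal vector and is annihilated by \<open>K\<close>; what remains is a symmetric Hessian of \<open>E_d\<close>, after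
the index \<open>b\<close> has been made tangential by \<open>E_c\<close>. The tensor \<open>K\<close> thus plays the role of the
tangential projections under which the Codazzi equation holds.\<close>

lemma codazzi:
  assumes x: "x \<in> S" and n: "normal x n"
    and K: "\<And>a d. (\<Sum>b\<in>UNIV. E a x $ b * K b d) = K a d" and K_sym: "\<And>a d. K a d = K d a"
  shows "(\<Sum>a\<in>UNIV. \<Sum>d\<in>UNIV. K a d * (\<Sum>b\<in>UNIV. E c x $ b * (n \<bullet> delta a (B b d) x)))
    = (\<Sum>a\<in>UNIV. \<Sum>d\<in>UNIV. K a d * (n \<bullet> delta c (B a d) x))"
proof -
  have K0: "(\<Sum>d\<in>UNIV. K p d * w $ d) = 0" if "normal x w" for p w
    using normal_contract[OF x that, of "\<lambda>d. K d p"] K[of _ p] by (simp add: K_sym[of p] mult.commute)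
  have flat: "(\<Sum>d\<in>UNIV. K p d * (n \<bullet> delta a (B b d) x)) = (\<Sum>d\<in>UNIV. K p d * (n \<bullet> delta a (delta b (E d)) x))" for p a b
  proof -
    have "(\<Sum>d\<in>UNIV. K p d * (\<Sum>c\<in>UNIV. (B b c x $ d) * (n \<bullet> B a c x)))
        = (\<Sum>c\<in>UNIV. (\<Sum>d\<in>UNIV. K p d * B b c x $ d) * (n \<bullet> B a c x))"
      unfolding sum_distrib_left sum_distrib_right by (subst sum.swap) (simp add: mult_ac)
    then show ?thesis
      by (simp add: inner_delta_B[OF x n] right_diff_distrib sum_subtractf K0[OF normal_B[OF x]])
  qed
  have "(\<Sum>a\<in>UNIV. \<Sum>d\<in>UNIV. K a d * (\<Sum>b\<in>UNIV. E c x $ b * (n \<bullet> delta a (B b d) x)))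
      = (\<Sum>a\<in>UNIV. \<Sum>b\<in>UNIV. E c x $ b * (\<Sum>d\<in>UNIV. K a d * (n \<bullet> delta a (B b d) x)))"
    unfolding sum_distrib_left by (rule sum.cong[OF refl], subst sum.swap) (simp add: mult_ac)
  also have "\<dots> = (\<Sum>a\<in>UNIV. \<Sum>d\<in>UNIV. K a d * (n \<bullet> (\<Sum>b\<in>UNIV. E c x $ b *\<^sub>R delta a (delta b (E d)) x)))"
    unfolding flat sum_distrib_left inner_sum_right by (rule sum.cong[OF refl], subst sum.swap) (simp add: mult_ac)
  also have "\<dots> = (\<Sum>a\<in>UNIV. \<Sum>d\<in>UNIV. K a d * (n \<bullet> (\<Sum>b\<in>UNIV. E a x $ b *\<^sub>R delta c (delta b (E d)) x)))"
    by (simp only: hessian_commute[OF x sm_E, of c])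
  also have "\<dots> = (\<Sum>a\<in>UNIV. \<Sum>b\<in>UNIV. \<Sum>d\<in>UNIV. E a x $ b * K a d * (n \<bullet> delta c (delta b (E d)) x))"
    unfolding sum_distrib_left inner_sum_right by (rule sum.cong[OF refl], subst sum.swap) (simp add: mult_ac)
  also have "\<dots> = (\<Sum>b\<in>UNIV. \<Sum>a\<in>UNIV. \<Sum>d\<in>UNIV. E a x $ b * K a d * (n \<bullet> delta c (delta b (E d)) x))"
    by (rule sum.swap)
  also have "\<dots> = (\<Sum>b\<in>UNIV. \<Sum>d\<in>UNIV. \<Sum>a\<in>UNIV. E b x $ a * K a d * (n \<bullet> delta c (delta b (E d)) x))"
    by (rule sum.cong[OF refl], subst sum.swap) (simp add: E_commute[OF x])
  also have "\<dots> = (\<Sum>b\<in>UNIV. \<Sum>d\<in>UNIV. K b d * (n \<bullet> delta c (B b d) x))"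
    by (simp add: sum_distrib_right[symmetric] K flat)
  finally show ?thesis .
qed

lemma trace_B:
  assumes x: "x \<in> S"
  shows "(\<Sum>a\<in>UNIV. B a c x $ a) = 0"
proof -
  have "(\<Sum>a\<in>UNIV. B a c x $ a) = (\<Sum>a\<in>UNIV. \<Sum>b\<in>UNIV. E a x $ b * B b c x $ a)"
    by (subst E_B1[OF x, symmetric]) simp
  also have "\<dots> = (\<Sum>b\<in>UNIV. E b x \<bullet> B b c x)"
    by (subst sum.swap) (simp add: inner_vec_def E_commute[OF x])
  finally show ?thesis using x by (simp add: normalD)
qed

text \<open>The Codazzi equation traced with \<open>K = E\<close>: \<open>\<nabla>^i h_ij = 4 \<nabla>_j H\<close> modulo tangential vectors.\<close>

lemma codazzi_trace:
  assumes x: "x \<in> S" and n: "normal x n"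
  shows "(\<Sum>a\<in>UNIV. \<Sum>b\<in>UNIV. E c x $ b * (n \<bullet> delta a (B a b) x)) = 4 * (n \<bullet> D c H x)"
proof -
  have E1: "(\<Sum>b\<in>UNIV. E a x $ b * E b x $ d) = E a x $ d" for a d
    using arg_cong[OF E_E_sum[OF x, of a], of "\<lambda>v. v $ d"] by simp
  have "(\<Sum>a\<in>UNIV. \<Sum>b\<in>UNIV. E c x $ b * (n \<bullet> delta a (B a b) x))
      = (\<Sum>a\<in>UNIV. \<Sum>b\<in>UNIV. E c x $ b * (n \<bullet> delta a (B b a) x))"
    by (intro sum.cong refl arg_cong2[where f="(*)"] arg_cong2[where f="(\<bullet>)"] delta_cong[OF x] B_commute)
  also have "\<dots> = (\<Sum>d\<in>UNIV. \<Sum>b\<in>UNIV. E c x $ b * (n \<bullet> (\<Sum>a\<in>UNIV. E d x $ a *\<^sub>R delta a (B b d) x)))"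
    by (simp only: E_delta[OF x])
  also have "\<dots> = (\<Sum>d\<in>UNIV. \<Sum>a\<in>UNIV. E a x $ d * (\<Sum>b\<in>UNIV. E c x $ b * (n \<bullet> delta a (B b d) x)))"
    unfolding inner_sum_right sum_distrib_left
    by (rule sum.cong[OF refl], subst sum.swap) (simp add: mult_ac E_commute[OF x])
  also have "\<dots> = (\<Sum>a\<in>UNIV. \<Sum>d\<in>UNIV. E a x $ d * (\<Sum>b\<in>UNIV. E c x $ b * (n \<bullet> delta a (B b d) x)))"
    by (rule sum.swap)
  also have "\<dots> = (\<Sum>a\<in>UNIV. \<Sum>d\<in>UNIV. E a x $ d * (n \<bullet> delta c (B a d) x))"
    by (rule codazzi[OF x n E1 E_commute[OF x]])
  also have "\<dots> = n \<bullet> delta c (\<lambda>y. \<Sum>a\<in>UNIV. B a a y) x"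
  proof -
    have "delta c (\<lambda>y. \<Sum>a\<in>UNIV. B a a y) x = delta c (\<lambda>y. \<Sum>a\<in>UNIV. \<Sum>d\<in>UNIV. E a y $ d *\<^sub>R B a d y) x"
      by (rule delta_cong[OF x]) (simp add: E_B2)
    also have "\<dots> = (\<Sum>a\<in>UNIV. \<Sum>d\<in>UNIV. delta c (E a) x $ d *\<^sub>R B a d x + E a x $ d *\<^sub>R delta c (B a d) x)"
      by (simp add: delta_sum delta_scaleR delta_nth x)
    also have "\<dots> = (\<Sum>a\<in>UNIV. \<Sum>d\<in>UNIV. delta c (E a) x $ d *\<^sub>R B a d x) + (\<Sum>a\<in>UNIV. \<Sum>d\<in>UNIV. E a x $ d *\<^sub>R delta c (B a d) x)"
      by (simp add: sum.distrib)
    also have "(\<Sum>a\<in>UNIV. \<Sum>d\<in>UNIV. delta c (E a) x $ d *\<^sub>R B a d x) = 0"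
    proof -
      have 1: "(\<Sum>d\<in>UNIV. w $ d *\<^sub>R B a d x) = 0" if "normal x w" for w a
        by (rule normal_contract[OF x that]) (rule E_B2[OF x])
      have "(\<Sum>a\<in>UNIV. \<Sum>d\<in>UNIV. delta c (E a) x $ d *\<^sub>R B a d x)
          = (\<Sum>a\<in>UNIV. \<Sum>d\<in>UNIV. \<Sum>b\<in>UNIV. (B c b x $ a * E b x $ d) *\<^sub>R B a d x)"
        using 1[OF normal_B[OF x]] by (simp add: delta_E[OF x] scaleR_add_left sum.distrib scaleR_sum_left)
      also have "\<dots> = (\<Sum>a\<in>UNIV. \<Sum>b\<in>UNIV. B c b x $ a *\<^sub>R (\<Sum>d\<in>UNIV. E b x $ d *\<^sub>R B a d x))"
        unfolding scaleR_sum_right by (rule sum.cong[OF refl], subst sum.swap) simp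
      also have "\<dots> = (\<Sum>b\<in>UNIV. \<Sum>a\<in>UNIV. B c b x $ a *\<^sub>R B b a x)"
        unfolding E_B2[OF x] by (subst sum.swap) (simp add: B_commute[OF x])
      finally show ?thesis by (simp add: 1 x)
    qed
    finally show ?thesis by (simp add: inner_sum_right)
  qed
  also have "delta c (\<lambda>y. \<Sum>a\<in>UNIV. B a a y) x = delta c (\<lambda>y. 4 *\<^sub>R H y) x"
    by (rule delta_cong[OF x]) (simp add: H_eq)
  finally show ?thesis
    by (simp add: delta_cscaleR x D_def inner_normal_proj n)
qed

section \<open>The divergence of the translation current\<close>

text \<open>The tangential and the normal part of the translation current.\<close>

definition stress :: "'m \<Rightarrow> 'm \<Rightarrow> real^4 \<Rightarrow> real" where
  "stress a b x = energy_density x * E a x $ b + B a b x \<bullet> Z x - 2 * (D a H x \<bullet> D b H x) + 2 * A2 a b x"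

definition flux :: "'m \<Rightarrow> real^4 \<Rightarrow> real^'m" where
  "flux a x = D a Z x - (2 * BDH a x) *\<^sub>R H x + 2 *\<^sub>R ADH a x + 2 *\<^sub>R normal_proj x (divAH a x)"

lemma con_V_stress_flux:
  "x \<in> S \<Longrightarrow> con x (\<lambda>j. V j x) a = (\<Sum>b\<in>UNIV. stress a b x *\<^sub>R E b x) + flux a x"
  by (simp add: con_V stress_def flux_def)

lemma sm_stress [intro!, simp]: "sm (stress a b)"
  unfolding stress_def[abs_def] by simp

lemma sm_flux [intro!, simp]: "sm (flux a)"
  unfolding flux_def[abs_def] by simp

lemma normal_flux [simp]: "x \<in> S \<Longrightarrow> normal x (flux a x)"
  by (simp add: flux_def)

lemma A2_commute: "A2 a b x = A2 b a x"
  by (simp add: A2_def mult.commute)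

lemma stress_commute: "x \<in> S \<Longrightarrow> stress a b x = stress b a x"
  by (simp add: stress_def E_commute[of x a b] B_commute[of x a b] A2_commute[of a b] inner_commute)

lemma E_A2:
  assumes x: "x \<in> S"
  shows "(\<Sum>b\<in>UNIV. E c x $ b * A2 b a x) = A2 c a x"
proof -
  have "(\<Sum>b\<in>UNIV. E c x $ b * A2 b a x) = (\<Sum>d\<in>UNIV. (\<Sum>b\<in>UNIV. E c x $ b * A b d x) * A a d x)"
    unfolding A2_def sum_distrib_left sum_distrib_right by (subst sum.swap) (simp add: mult.assoc)
  then show ?thesis by (simp add: E_A[OF x] A2_def)
qed

lemma E_E_nth:
  assumes x: "x \<in> S"
  shows "(\<Sum>b\<in>UNIV. E a x $ b * E b x $ d) = E a x $ d"
  using arg_cong[OF E_E_sum[OF x, of a], of "\<lambda>v. v $ d"] by simp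

lemma E_stress:
  assumes x: "x \<in> S"
  shows "(\<Sum>b\<in>UNIV. E c x $ b * stress b a x) = stress c a x"
proof -
  have "(\<Sum>b\<in>UNIV. E c x $ b * stress b a x) = energy_density x * (\<Sum>b\<in>UNIV. E c x $ b * E b x $ a)
      + (\<Sum>b\<in>UNIV. E c x $ b *\<^sub>R B b a x) \<bullet> Z x - 2 * ((\<Sum>b\<in>UNIV. E c x $ b *\<^sub>R D b H x) \<bullet> D a H x)
      + 2 * (\<Sum>b\<in>UNIV. E c x $ b * A2 b a x)"
    by (simp add: stress_def sum.distrib sum_subtractf sum_distrib_left inner_sum_left algebra_simps)
  then show ?thesis
    by (simp add: E_E_nth E_B1 E_D E_A2 stress_def x)
qed

lemma normal_stress:
  assumes x: "x \<in> S" and w: "normal x w"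
  shows "(\<Sum>b\<in>UNIV. stress a b x * w $ b) = 0"
  using normal_contract[OF x w, of "\<lambda>b. stress a b x"] E_stress[OF x, of _ a]
  by (simp add: stress_commute[OF x, of a] mult.commute)

lemma inner_E_delta_E:
  assumes x: "x \<in> S"
  shows "delta a (E b) x \<bullet> E c x = B a c x $ b"
proof -
  have "(\<Sum>d\<in>UNIV. B a d x $ b * E d x $ c) = B a c x $ b"
    using arg_cong[OF E_B2[OF x, of c a], of "\<lambda>v. v $ b"] by (simp add: E_commute[OF x, of c] mult.commute)
  then show ?thesis
    using x by (simp add: delta_E inner_add_left inner_sum_left normalD E_E)
qed

lemma delta_con_V:
  assumes x: "x \<in> S"
  shows "delta a (\<lambda>y. con y (\<lambda>j. V j y) a) x
    = (\<Sum>b\<in>UNIV. delta a (stress a b) x *\<^sub>R E b x + stress a b x *\<^sub>R delta a (E b) x) + delta a (flux a) x"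
proof -
  have "delta a (\<lambda>y. con y (\<lambda>j. V j y) a) x = delta a (\<lambda>y. (\<Sum>b\<in>UNIV. stress a b y *\<^sub>R E b y) + flux a y) x"
    by (rule delta_cong[OF x]) (rule con_V_stress_flux)
  then show ?thesis by (simp add: delta_add delta_sum delta_scaleR x)
qed

text \<open>Only the stress contracted with \<open>B\<close> and the normal divergence of the flux are normal. In the flux,
passing from \<open>\<pi>_n divAH\<close> to \<open>divAH\<close> produces another \<open>2 A^2\<close> contracted with \<open>B\<close>, which together with the
one in the stress matches the term \<open>- 4 (H \<bullet> h_ij) (H \<bullet> h^i_k) h^jk\<close> of the operator.\<close>

lemma normal_part_div_V:
  assumes x: "x \<in> S"
  shows "normal_proj x (\<Sum>a\<in>UNIV. delta a (\<lambda>y. con y (\<lambda>j. V j y) a) x) = - willmore x"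
proof -
  have dflux: "normal_proj x (delta a (flux a) x) = normal_proj x (delta a (D a Z) x)
     - 2 *\<^sub>R normal_proj x (delta a (\<lambda>y. BDH a y *\<^sub>R H y) x) + 2 *\<^sub>R normal_proj x (delta a (ADH a) x)
     + 2 *\<^sub>R normal_proj x (delta a (divAH a) x) + 2 *\<^sub>R (\<Sum>b\<in>UNIV. A2 a b x *\<^sub>R B a b x)" for a
  proof -
    have "delta a (flux a) x = delta a (\<lambda>y. D a Z y - 2 *\<^sub>R (BDH a y *\<^sub>R H y) + 2 *\<^sub>R ADH a y
       + 2 *\<^sub>R (divAH a y + (\<Sum>b\<in>UNIV. A2 a b y *\<^sub>R E b y))) x"
    proof (rule delta_cong[OF x])
      fix y assume "y \<in> S"
      from divAH_tangential[OF this, of a]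
      have "normal_proj y (divAH a y) = divAH a y + (\<Sum>b\<in>UNIV. A2 a b y *\<^sub>R E b y)"
        by (simp add: algebra_simps)
      then show "flux a y = D a Z y - 2 *\<^sub>R (BDH a y *\<^sub>R H y) + 2 *\<^sub>R ADH a y
       + 2 *\<^sub>R (divAH a y + (\<Sum>b\<in>UNIV. A2 a b y *\<^sub>R E b y))"
        by (simp add: flux_def)
    qed
    also have "\<dots> = delta a (D a Z) x - 2 *\<^sub>R delta a (\<lambda>y. BDH a y *\<^sub>R H y) x + 2 *\<^sub>R delta a (ADH a) x
       + 2 *\<^sub>R (delta a (divAH a) x + (\<Sum>b\<in>UNIV. delta a (A2 a b) x *\<^sub>R E b x + A2 a b x *\<^sub>R delta a (E b) x))"
      by (simp only: delta_add delta_minus delta_cscaleR x sm_add sm_minus sm_scaleR sm_const sm_sum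
          sm_D sm_Z sm_BDH sm_H sm_ADH sm_divAH sm_A2 sm_E) (simp add: delta_sum delta_scaleR x)
    finally show ?thesis
      by (simp add: normal_proj_simps x B_def D_def scaleR_add_right)
  qed
  have st: "(\<Sum>a\<in>UNIV. \<Sum>b\<in>UNIV. stress a b x *\<^sub>R B a b x) = (4 * energy_density x) *\<^sub>R H x
     + (\<Sum>a\<in>UNIV. \<Sum>b\<in>UNIV. (Z x \<bullet> B a b x) *\<^sub>R B a b x)
     - 2 *\<^sub>R (\<Sum>a\<in>UNIV. \<Sum>b\<in>UNIV. (D a H x \<bullet> D b H x) *\<^sub>R B a b x)
     + 2 *\<^sub>R (\<Sum>a\<in>UNIV. \<Sum>b\<in>UNIV. A2 a b x *\<^sub>R B a b x)"
  proof -
    have "(\<Sum>a\<in>UNIV. \<Sum>b\<in>UNIV. (energy_density x * E a x $ b) *\<^sub>R B a b x) = energy_density x *\<^sub>R (\<Sum>a\<in>UNIV. \<Sum>b\<in>UNIV. E a x $ b *\<^sub>R B a b x)"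
      by (simp add: scaleR_sum_right)
    also have "\<dots> = (4 * energy_density x) *\<^sub>R H x"
      by (simp add: E_B2[OF x] H_eq[OF x])
    finally show ?thesis
      by (simp add: stress_def scaleR_add_left scaleR_diff_left sum.distrib sum_subtractf scaleR_sum_right inner_commute[of "Z x"])
  qed
  have "normal_proj x (\<Sum>a\<in>UNIV. delta a (\<lambda>y. con y (\<lambda>j. V j y) a) x)
     = (\<Sum>a\<in>UNIV. \<Sum>b\<in>UNIV. stress a b x *\<^sub>R B a b x) + (\<Sum>a\<in>UNIV. normal_proj x (delta a (flux a) x))"
    by (simp add: delta_con_V[OF x] normal_proj_simps x B_def D_def sum.distrib)
  then show ?thesis
    unfolding willmore_eq[OF x] st dflux lap_perp_eq[OF x sm_Z]
    by (simp add: normal_proj_simps x sum.distrib sum_subtractf scaleR_sum_right[symmetric] algebra_simps scaleR_add_left[symmetric] del: scaleR_scaleR)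
qed

lemma delta_A:
  assumes x: "x \<in> S"
  shows "delta c (A a b) x = D c H x \<bullet> B a b x + H x \<bullet> delta c (B a b) x"
proof -
  have "delta c (A a b) x = delta c H x \<bullet> B a b x + H x \<bullet> delta c (B a b) x"
    unfolding A_def[abs_def] by (simp add: delta_inner x)
  then show ?thesis by (simp add: D_def inner_normal_proj' x)
qed

lemma delta_H_sq:
  assumes x: "x \<in> S"
  shows "delta c H_sq x = 2 * (H x \<bullet> D c H x)"
  unfolding H_sq_def[abs_def] by (simp add: delta_inner x D_def inner_normal_proj inner_commute)

lemma delta_energy_density:
  assumes x: "x \<in> S"
  shows "delta c energy_density x = 2 * (\<Sum>a\<in>UNIV. D a H x \<bullet> delta c (D a H) x)
    - 2 * (\<Sum>a\<in>UNIV. \<Sum>b\<in>UNIV. A a b x * delta c (A a b) x) + 28 * H_sq x * (H x \<bullet> D c H x)"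
proof -
  have "delta c energy_density x = delta c (\<lambda>y. (\<Sum>a\<in>UNIV. D a H y \<bullet> D a H y) - (\<Sum>a\<in>UNIV. \<Sum>b\<in>UNIV. A a b y * A a b y)
      + 7 * (H_sq y * H_sq y)) x"
    by (rule delta_cong[OF x]) (simp add: energy_density_def pgradH_sq_eq Hh_sq_eq power2_eq_square)
  also have "\<dots> = 2 * (\<Sum>a\<in>UNIV. D a H x \<bullet> delta c (D a H) x)
    - 2 * (\<Sum>a\<in>UNIV. \<Sum>b\<in>UNIV. A a b x * delta c (A a b) x) + 28 * H_sq x * (H x \<bullet> D c H x)"
    by (simp add: delta_add delta_minus delta_sum delta_inner delta_mult x delta_H_sq)
      (simp add: inner_commute[of "delta c _ x"] mult.commute[of "delta c _ x"] sum_distrib_left)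
  finally show ?thesis .
qed

lemma inner_delta_D:
  assumes x: "x \<in> S" and n: "normal x n"
  shows "n \<bullet> delta c (D a H) x = n \<bullet> delta c (delta a H) x + (\<Sum>d\<in>UNIV. A a d x * (n \<bullet> B c d x))"
proof -
  have "delta c (D a H) x = delta c (\<lambda>y. delta a H y + (\<Sum>d\<in>UNIV. A a d y *\<^sub>R E d y)) x"
    by (rule delta_cong[OF x]) (simp add: delta_normal[of _ H a] A_def)
  also have "\<dots> = delta c (delta a H) x + (\<Sum>d\<in>UNIV. delta c (A a d) x *\<^sub>R E d x + A a d x *\<^sub>R delta c (E d) x)"
    by (simp add: delta_add delta_sum delta_scaleR x)
  finally show ?thesis
    by (simp add: inner_add_right inner_sum_right normalD[OF n] inner_delta_E[OF x n])
qed

lemma inner_trace_delta_D: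
  assumes x: "x \<in> S" and n: "normal x n"
  shows "n \<bullet> lap_perp H x = (\<Sum>a\<in>UNIV. n \<bullet> delta a (D a H) x)"
  by (simp add: lap_perp_eq x inner_normal_proj n inner_sum_right)

text \<open>The Hessian of \<open>H\<close> is symmetric, so the two iterated normal derivatives of \<open>H\<close> differ only by the
Weingarten terms of \<open>DH\<close>: the curvature of the normal bundle is quadratic in \<open>B\<close>.\<close>

lemma normal_ricci:
  assumes x: "x \<in> S"
  shows "(\<Sum>a\<in>UNIV. D a H x \<bullet> delta c (D a H) x)
      - (\<Sum>a\<in>UNIV. \<Sum>b\<in>UNIV. E c x $ b * (D a H x \<bullet> delta a (D b H) x))
    = (\<Sum>a\<in>UNIV. \<Sum>d\<in>UNIV. A a d x * (D a H x \<bullet> B c d x)) - (\<Sum>a\<in>UNIV. A c a x * BDH a x)"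
proof -
  have 1: "(\<Sum>a\<in>UNIV. D a H x \<bullet> delta c (D a H) x) = (\<Sum>a\<in>UNIV. D a H x \<bullet> delta c (delta a H) x)
      + (\<Sum>a\<in>UNIV. \<Sum>d\<in>UNIV. A a d x * (D a H x \<bullet> B c d x))"
    by (simp add: inner_delta_D x sum.distrib)
  have "(\<Sum>a\<in>UNIV. \<Sum>b\<in>UNIV. E c x $ b * (D a H x \<bullet> delta a (D b H) x))
     = (\<Sum>a\<in>UNIV. \<Sum>b\<in>UNIV. E c x $ b * (D a H x \<bullet> delta a (delta b H) x))
     + (\<Sum>a\<in>UNIV. \<Sum>b\<in>UNIV. \<Sum>d\<in>UNIV. E c x $ b * A b d x * (D a H x \<bullet> B a d x))"
    by (simp add: inner_delta_D x sum.distrib distrib_left sum_distrib_left mult.assoc)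
  also have "(\<Sum>a\<in>UNIV. \<Sum>b\<in>UNIV. E c x $ b * (D a H x \<bullet> delta a (delta b H) x))
     = (\<Sum>a\<in>UNIV. D a H x \<bullet> (\<Sum>b\<in>UNIV. E c x $ b *\<^sub>R delta a (delta b H) x))"
    by (simp add: inner_sum_right)
  also have "\<dots> = (\<Sum>a\<in>UNIV. \<Sum>b\<in>UNIV. E a x $ b * (D a H x \<bullet> delta c (delta b H) x))"
    unfolding hessian_commute[OF x sm_H, of c] by (simp add: inner_sum_right)
  also have "\<dots> = (\<Sum>b\<in>UNIV. (\<Sum>a\<in>UNIV. E b x $ a *\<^sub>R D a H x) \<bullet> delta c (delta b H) x)"
    by (subst sum.swap) (simp add: inner_sum_left E_commute[OF x])
  also have "\<dots> = (\<Sum>b\<in>UNIV. D b H x \<bullet> delta c (delta b H) x)"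
    by (simp only: E_D[OF x])
  also have "(\<Sum>a\<in>UNIV. \<Sum>b\<in>UNIV. \<Sum>d\<in>UNIV. E c x $ b * A b d x * (D a H x \<bullet> B a d x))
     = (\<Sum>a\<in>UNIV. \<Sum>d\<in>UNIV. A c d x * (D a H x \<bullet> B a d x))"
    unfolding E_A[OF x, of c, symmetric] sum_distrib_right
    by (rule sum.cong[OF refl], subst sum.swap) simp
  also have "\<dots> = (\<Sum>d\<in>UNIV. A c d x * BDH d x)"
    unfolding BDH_def sum_distrib_left by (subst sum.swap) (simp add: inner_commute B_commute[OF x])
  finally show ?thesis using 1 by simp
qed

lemma codazzi_A:
  assumes x: "x \<in> S"
  shows "(\<Sum>a\<in>UNIV. \<Sum>d\<in>UNIV. A a d x * (\<Sum>b\<in>UNIV. E c x $ b * (H x \<bullet> delta a (B b d) x)))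
    = (\<Sum>a\<in>UNIV. \<Sum>d\<in>UNIV. A a d x * (H x \<bullet> delta c (B a d) x))"
  by (rule codazzi[OF x normal_H[OF x] E_A[OF x] A_commute[OF x]])

text \<open>The Noether identity for reparametrizations. By the Weingarten formula the claim is
\<open>\<nabla>^b stress_bc = \<Sum>_a flux_a \<bullet> B_ac\<close>. In the abbreviations of the proof, \<open>\<kappa>\<close> is the term with a derivative
of \<open>B\<close> that appears in the gradient of \<open>|A|^2\<close> and, by the Codazzi equation, also in the divergence of
\<open>A^2\<close>; the terms \<open>\<gamma>\<close> and \<open>\<zeta>\<close> occur on both sides; \<open>Y - X = \<alpha> - \<beta>\<close> is the Ricci equation.\<close>

lemma tangential_part_div_V:
  assumes x: "x \<in> S"
  shows "(\<Sum>a\<in>UNIV. delta a (\<lambda>y. con y (\<lambda>j. V j y) a) x) \<bullet> E c x = 0"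
proof -
  define X where "X = (\<Sum>a\<in>UNIV. \<Sum>b\<in>UNIV. E c x $ b * (D a H x \<bullet> delta a (D b H) x))"
  define Y where "Y = (\<Sum>a\<in>UNIV. D a H x \<bullet> delta c (D a H) x)"
  define \<alpha> where "\<alpha> = (\<Sum>a\<in>UNIV. \<Sum>d\<in>UNIV. A a d x * (D a H x \<bullet> B c d x))"
  define \<beta> where "\<beta> = (\<Sum>a\<in>UNIV. A c a x * BDH a x)"
  define \<gamma> where "\<gamma> = (\<Sum>a\<in>UNIV. \<Sum>d\<in>UNIV. delta a (A a d) x * A c d x)"
  define \<kappa> where "\<kappa> = (\<Sum>a\<in>UNIV. \<Sum>d\<in>UNIV. A a d x * (H x \<bullet> delta c (B a d) x))"
  define \<zeta> where "\<zeta> = (\<Sum>a\<in>UNIV. B a c x \<bullet> D a Z x)"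
  have s1: "(\<Sum>a\<in>UNIV. \<Sum>b\<in>UNIV. E c x $ b * delta a (\<lambda>y. energy_density y * E a y $ b) x) = delta c energy_density x"
  proof -
    have "(\<Sum>b\<in>UNIV. E c x $ b * delta a (\<lambda>y. energy_density y * E a y $ b) x)
        = E c x $ a * delta a energy_density x + energy_density x * (delta a (E a) x \<bullet> E c x)" for a
    proof -
      have "(\<Sum>b\<in>UNIV. E c x $ b * delta a (\<lambda>y. energy_density y * E a y $ b) x)
         = delta a energy_density x * (\<Sum>b\<in>UNIV. E a x $ b * E c x $ b) + energy_density x * (\<Sum>b\<in>UNIV. delta a (E a) x $ b * E c x $ b)"
        by (simp add: delta_mult delta_nth x distrib_left sum.distrib sum_distrib_left mult_ac)
      then show ?thesis
        using E_E[OF x, of a c] by (simp add: inner_vec_def E_commute[OF x, of a c])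
    qed
    then have "(\<Sum>a\<in>UNIV. \<Sum>b\<in>UNIV. E c x $ b * delta a (\<lambda>y. energy_density y * E a y $ b) x)
        = (\<Sum>a\<in>UNIV. E c x $ a *\<^sub>R delta a energy_density x) + energy_density x * (\<Sum>a\<in>UNIV. B a c x $ a)"
      by (simp add: inner_E_delta_E[OF x] sum.distrib sum_distrib_left)
    then show ?thesis by (simp only: E_delta[OF x] trace_B[OF x])
  qed
  have s2: "(\<Sum>a\<in>UNIV. \<Sum>b\<in>UNIV. E c x $ b * delta a (\<lambda>y. B a b y \<bullet> Z y) x) = 4 * (Z x \<bullet> D c H x) + \<zeta>"
  proof -
    have "(\<Sum>b\<in>UNIV. E c x $ b * delta a (\<lambda>y. B a b y \<bullet> Z y) x)
        = (\<Sum>b\<in>UNIV. E c x $ b * (Z x \<bullet> delta a (B a b) x)) + (\<Sum>b\<in>UNIV. E c x $ b *\<^sub>R B a b x) \<bullet> delta a Z x" for a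
      by (simp add: delta_inner x distrib_left sum.distrib inner_sum_left inner_commute[of "Z x"])
    then show ?thesis
      by (simp add: sum.distrib codazzi_trace x E_B2[OF x] \<zeta>_def D_def inner_normal_proj)
  qed
  have s3: "(\<Sum>a\<in>UNIV. \<Sum>b\<in>UNIV. E c x $ b * delta a (\<lambda>y. D a H y \<bullet> D b H y) x) = lap_perp H x \<bullet> D c H x + X"
  proof -
    have "(\<Sum>b\<in>UNIV. E c x $ b * delta a (\<lambda>y. D a H y \<bullet> D b H y) x)
        = (\<Sum>b\<in>UNIV. E c x $ b *\<^sub>R D b H x) \<bullet> delta a (D a H) x + (\<Sum>b\<in>UNIV. E c x $ b * (D a H x \<bullet> delta a (D b H) x))" for a
      by (simp add: delta_inner x distrib_left sum.distrib inner_sum_left inner_sum_right inner_commute)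
    then show ?thesis
      using inner_trace_delta_D[OF x, of "D c H x"]
      by (simp add: sum.distrib E_D[OF x] X_def x inner_commute[of _ "D c H x"])
  qed
  have s4: "(\<Sum>a\<in>UNIV. \<Sum>b\<in>UNIV. E c x $ b * delta a (A2 a b) x) = \<gamma> + \<alpha> + \<kappa>"
  proof -
    have dA2: "delta a (A2 a b) x = (\<Sum>d\<in>UNIV. delta a (A a d) x * A b d x + A a d x * delta a (A b d) x)" for a b
      unfolding A2_def[abs_def] by (simp add: delta_sum delta_mult x)
    have "(\<Sum>b\<in>UNIV. E c x $ b * delta a (A2 a b) x)
       = (\<Sum>d\<in>UNIV. delta a (A a d) x * (\<Sum>b\<in>UNIV. E c x $ b * A b d x))
        + (\<Sum>d\<in>UNIV. A a d x * (D a H x \<bullet> (\<Sum>b\<in>UNIV. E c x $ b *\<^sub>R B b d x)))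
        + (\<Sum>d\<in>UNIV. A a d x * (\<Sum>b\<in>UNIV. E c x $ b * (H x \<bullet> delta a (B b d) x)))" for a
    proof -
      have "(\<Sum>b\<in>UNIV. E c x $ b * delta a (A2 a b) x)
         = (\<Sum>d\<in>UNIV. \<Sum>b\<in>UNIV. E c x $ b * (delta a (A a d) x * A b d x + A a d x * delta a (A b d) x))"
        unfolding dA2 sum_distrib_left by (rule sum.swap)
      then show ?thesis
        by (simp add: delta_A[OF x, of a b for b] distrib_left sum.distrib sum_distrib_left inner_sum_right mult_ac)
    qed
    then show ?thesis
      by (simp add: sum.distrib E_A[OF x] E_B1[OF x] codazzi_A[OF x] \<alpha>_def \<gamma>_def \<kappa>_def)
  qed
  have d1: "(\<Sum>a\<in>UNIV. \<Sum>b\<in>UNIV. E c x $ b * delta a (stress a b) x)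
      = delta c energy_density x + (4 * (Z x \<bullet> D c H x) + \<zeta>) - 2 * (lap_perp H x \<bullet> D c H x + X) + 2 * (\<gamma> + \<alpha> + \<kappa>)"
  proof -
    have "delta a (stress a b) x = delta a (\<lambda>y. energy_density y * E a y $ b) x + delta a (\<lambda>y. B a b y \<bullet> Z y) x
       - 2 *\<^sub>R delta a (\<lambda>y. D a H y \<bullet> D b H y) x + 2 *\<^sub>R delta a (A2 a b) x" for a b
      unfolding stress_def[abs_def] real_scaleR_def[symmetric, of 2]
      by (simp only: delta_add delta_minus delta_cscaleR x sm_add sm_minus sm_scaleR sm_const sm_mult sm_inner sm_nth
          sm_energy_density sm_E sm_B sm_Z sm_D sm_H sm_A2)
    then show ?thesis
      unfolding s1[symmetric] s2[symmetric] s3[symmetric] s4[symmetric]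
      by (simp add: distrib_left right_diff_distrib sum.distrib sum_subtractf sum_distrib_left mult.left_commute)
  qed
  have n4: "(\<Sum>a\<in>UNIV. divAH a x \<bullet> B a c x) = \<gamma> + \<alpha>"
  proof -
    have "(\<Sum>a\<in>UNIV. divAH a x \<bullet> B a c x)
       = (\<Sum>a\<in>UNIV. \<Sum>d\<in>UNIV. E a x $ d * ((\<Sum>b\<in>UNIV. delta b (\<lambda>y. A d b y *\<^sub>R H y) x) \<bullet> B a c x))"
      by (simp add: divAH_def inner_sum_left)
    also have "\<dots> = (\<Sum>d\<in>UNIV. (\<Sum>b\<in>UNIV. delta b (\<lambda>y. A d b y *\<^sub>R H y) x) \<bullet> (\<Sum>a\<in>UNIV. E d x $ a *\<^sub>R B a c x))"
      by (subst sum.swap) (simp add: inner_sum_right E_commute[OF x])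
    also have "\<dots> = (\<Sum>d\<in>UNIV. \<Sum>b\<in>UNIV. delta b (A d b) x * A c d x + A d b x * (D b H x \<bullet> B c d x))"
    proof -
      have "H x \<bullet> B d c x = A c d x" "delta b H x \<bullet> B d c x = D b H x \<bullet> B c d x" for b d
        by (simp_all add: A_def D_def inner_normal_proj' x B_commute[OF x, of d c])
      then show ?thesis by (simp add: E_B1[OF x] inner_sum_left delta_scaleR x inner_add_left)
    qed
    also have "\<dots> = (\<Sum>b\<in>UNIV. \<Sum>d\<in>UNIV. delta b (A b d) x * A c d x + A b d x * (D b H x \<bullet> B c d x))"
    proof (subst sum.swap, intro sum.cong refl)
      fix b d
      have "delta b (A d b) x = delta b (A b d) x"
        by (rule delta_cong[OF x]) (rule A_commute)
      then show "delta b (A d b) x * A c d x + A d b x * (D b H x \<bullet> B c d x)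
          = delta b (A b d) x * A c d x + A b d x * (D b H x \<bullet> B c d x)"
        by (simp add: A_commute[OF x, of d b])
    qed
    finally show ?thesis by (simp add: sum.distrib \<alpha>_def \<gamma>_def)
  qed
  have n3: "(\<Sum>a\<in>UNIV. ADH a x \<bullet> B a c x) = \<alpha>"
    unfolding ADH_def \<alpha>_def inner_sum_left
    by (subst sum.swap) (simp add: A_commute[OF x] B_commute[OF x, of _ c])
  have d2: "(\<Sum>a\<in>UNIV. flux a x \<bullet> B a c x) = \<zeta> - 2 * \<beta> + 2 * \<alpha> + 2 * (\<gamma> + \<alpha>)"
  proof -
    have "flux a x \<bullet> B a c x = B a c x \<bullet> D a Z x - 2 * (A c a x * BDH a x) + 2 * (ADH a x \<bullet> B a c x)
        + 2 * (divAH a x \<bullet> B a c x)" for a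
      by (simp add: flux_def inner_add_left inner_diff_left inner_normal_proj' x A_def B_commute[OF x, of c a]
          inner_commute[of "D a Z x"])
    then show ?thesis
      by (simp add: sum.distrib sum_subtractf sum_distrib_left[symmetric] n3 n4 \<zeta>_def \<beta>_def)
  qed
  have d3: "delta c energy_density x = 2 * Y - 2 * (D c H x \<bullet> Hhh x + \<kappa>) + 28 * H_sq x * (H x \<bullet> D c H x)"
    unfolding delta_energy_density[OF x] Y_def \<kappa>_def Hhh_eq[OF x]
    by (simp add: delta_A[OF x] distrib_left sum.distrib inner_sum_right)
  have d4: "4 * (Z x \<bullet> D c H x) = 2 * (lap_perp H x \<bullet> D c H x) + 2 * (D c H x \<bullet> Hhh x) - 28 * H_sq x * (H x \<bullet> D c H x)"
    by (simp add: Z_def inner_add_left inner_diff_left inner_commute[of "Hhh x"])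
  have "(\<Sum>a\<in>UNIV. delta a (\<lambda>y. con y (\<lambda>j. V j y) a) x) \<bullet> E c x
     = (\<Sum>a\<in>UNIV. \<Sum>b\<in>UNIV. E c x $ b * delta a (stress a b) x) - (\<Sum>a\<in>UNIV. flux a x \<bullet> B a c x)"
  proof -
    have "delta a (\<lambda>y. con y (\<lambda>j. V j y) a) x \<bullet> E c x
        = (\<Sum>b\<in>UNIV. E c x $ b * delta a (stress a b) x) - flux a x \<bullet> B a c x" for a
      using normal_stress[OF x normal_B[OF x], of a a c]
      by (simp add: delta_con_V[OF x] inner_add_left inner_sum_left inner_E_delta_E[OF x] sum.distrib
          delta_normal_E x E_E E_commute[OF x, of c] mult.commute)
    then show ?thesis by (simp add: inner_sum_left sum_subtractf)
  qed
  also have "\<dots> = 0"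
    using normal_ricci[OF x, of c] unfolding d1 d2 d3 d4 X_def[symmetric] Y_def[symmetric] \<alpha>_def[symmetric] \<beta>_def[symmetric]
    by simp
  finally show ?thesis .
qed

lemma div_con_V_eq_0:
  assumes x: "x \<in> S" and W: "willmore x = 0"
  shows "(\<Sum>a\<in>UNIV. delta a (\<lambda>y. con y (\<lambda>j. V j y) a) x) = 0"
  using normal_part_div_V[OF x] tangential_part_div_V[OF x] W
  by (simp add: normal_proj_inner[OF x])

lemma sm_V [intro!, simp]: "sm (V j)"
  unfolding V_def[abs_def]
  by (simp add: smooth_f)

theorem translation_law:
  assumes x: "x \<in> S" and W: "willmore x = 0"
  shows "dvg V x = 0"
  by (simp add: dvg_eq[OF x] div_con_V_eq_0[OF x W])

section \<open>The dilation current\<close>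

lemma sm_con [intro, simp]: "(\<And>j. sm (T j)) \<Longrightarrow> sm (\<lambda>y. con y (\<lambda>j. T j y) a)"
  unfolding con_def by auto

text \<open>The trace of the stress. The terms quartic in the second fundamental form cancel, and by
\<open>laplacian_H_sq\<close> the remainder is a divergence, as the scaling invariance of the energy in dimension 4
demands.\<close>

lemma dilation_trace:
  assumes x: "x \<in> S"
  shows "(\<Sum>a\<in>UNIV. E a x \<bullet> con x (\<lambda>j. V j x) a) = 2 * pgradH_sq x + 2 * (H x \<bullet> lap_perp H x)"
proof -
  have "E a x \<bullet> con x (\<lambda>j. V j x) a = stress a a x" for a
    using E_stress[OF x, of a a] normalD(2)[OF normal_flux[OF x]]
    by (simp add: con_V_stress_flux[OF x] inner_add_right inner_sum_right E_E[OF x] stress_commute[OF x] mult.commute)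
  moreover have "(\<Sum>a\<in>UNIV. stress a a x) = 4 * energy_density x + 4 * (H x \<bullet> Z x) - 2 * pgradH_sq x + 2 * Hh_sq x"
  proof -
    have "(\<Sum>a\<in>UNIV. B a a x \<bullet> Z x) = 4 * (H x \<bullet> Z x)"
      by (simp add: H_eq[OF x] inner_sum_left)
    then show ?thesis
      by (simp add: stress_def sum.distrib sum_subtractf trace_E[OF x] pgradH_sq_eq[OF x] Hh_sq_eq[OF x] A2_def
          sum_distrib_left[symmetric])
  qed
  moreover have "H x \<bullet> Hhh x = Hh_sq x"
    by (simp add: Hhh_eq[OF x] Hh_sq_eq[OF x] inner_sum_right A_def)
  ultimately show ?thesis
    by (simp add: energy_density_def Z_def inner_add_right inner_diff_right H_sq_def power2_eq_square)
qed

lemma laplacian_H_sq: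
  assumes x: "x \<in> S"
  shows "(\<Sum>a\<in>UNIV. delta a (delta a H_sq) x) = 2 * pgradH_sq x + 2 * (H x \<bullet> lap_perp H x)"
proof -
  have "delta a (delta a H_sq) x = 2 * (D a H x \<bullet> D a H x) + 2 * (H x \<bullet> delta a (D a H) x)" for a
  proof -
    have "delta a (delta a H_sq) x = delta a (\<lambda>y. 2 *\<^sub>R (H y \<bullet> D a H y)) x"
      by (rule delta_cong[OF x]) (simp add: delta_H_sq)
    also have "\<dots> = 2 * (delta a H x \<bullet> D a H x + H x \<bullet> delta a (D a H) x)"
      unfolding delta_cscaleR[OF x sm_inner[OF sm_H sm_D[OF sm_H]]] by (simp add: delta_inner x)
    also have "delta a H x \<bullet> D a H x = D a H x \<bullet> D a H x"
      using inner_normal_proj'[OF x normal_D[OF x], of "delta a H x" a H] by (simp add: D_def)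
    finally show ?thesis by simp
  qed
  then show ?thesis
    by (simp add: sum.distrib sum_distrib_left[symmetric] pgradH_sq_eq x inner_trace_delta_D)
qed

theorem dilation_law:
  assumes x: "x \<in> S" and W: "willmore x = 0"
  shows "dvg (\<lambda>j y. f y \<bullet> V j y - grad_up H_sq j y) x = 0"
proof -
  have "delta a (\<lambda>y. con y (\<lambda>j. f y \<bullet> V j y - grad_up H_sq j y) a) x
      = E a x \<bullet> con x (\<lambda>j. V j x) a + f x \<bullet> delta a (\<lambda>y. con y (\<lambda>j. V j y) a) x - delta a (delta a H_sq) x" for a
  proof -
    have "delta a (\<lambda>y. con y (\<lambda>j. f y \<bullet> V j y - grad_up H_sq j y) a) x
        = delta a (\<lambda>y. f y \<bullet> con y (\<lambda>j. V j y) a - delta a H_sq y) x"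
      by (rule delta_cong[OF x]) (simp add: con_diff bilinear_con con_grad_up)
    then show ?thesis by (simp add: delta_minus delta_inner x smooth_f E_def)
  qed
  then have "dvg (\<lambda>j y. f y \<bullet> V j y - grad_up H_sq j y) x
     = (\<Sum>a\<in>UNIV. E a x \<bullet> con x (\<lambda>j. V j x) a) + f x \<bullet> (\<Sum>a\<in>UNIV. delta a (\<lambda>y. con y (\<lambda>j. V j y) a) x)
       - (\<Sum>a\<in>UNIV. delta a (delta a H_sq) x)"
    by (subst dvg_eq[OF x]) (simp_all add: smooth_f sum.distrib sum_subtractf inner_sum_right)
  then show ?thesis
    by (simp add: dilation_trace[OF x] laplacian_H_sq[OF x] div_con_V_eq_0[OF x W])
qed

section \<open>The rotation current\<close>

lemma wedge_self [simp]: "u \<and>\<and> u = 0"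
  by (simp add: wedge_def vec_eq_iff)

lemma sum_symmetric_wedge:
  assumes "\<And>a b. K a b = K b a"
  shows "(\<Sum>a\<in>UNIV. \<Sum>b\<in>UNIV. K a b *\<^sub>R (X a \<and>\<and> X b)) = (0 :: real^'n^'n)"
proof -
  let ?s = "\<Sum>a\<in>UNIV. \<Sum>b\<in>UNIV. K a b *\<^sub>R (X a \<and>\<and> X b)"
  have "?s = (\<Sum>b\<in>UNIV. \<Sum>a\<in>UNIV. K a b *\<^sub>R (X a \<and>\<and> X b))" by (rule sum.swap)
  also have "\<dots> = - ?s"
    by (subst wedge_commute) (simp add: assms sum_negf)
  finally have "2 *\<^sub>R ?s = 0" by (simp add: scaleR_2)
  then show ?thesis by simp
qed

lemmas sm_wedge [intro!, simp] = sm_bilinear[OF bounded_bilinear_wedge]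
lemmas delta_wedge = delta_bilinear[OF bounded_bilinear_wedge]

lemma sm_M [intro!, simp]: "sm (M j)"
  unfolding M_def[abs_def] by (simp add: smooth_f)

lemma div_E:
  assumes x: "x \<in> S"
  shows "(\<Sum>a\<in>UNIV. delta a (E a) x) = 4 *\<^sub>R H x"
proof -
  have "(\<Sum>a\<in>UNIV. \<Sum>c\<in>UNIV. B a c x $ a *\<^sub>R E c x) = 0"
    by (subst sum.swap) (simp add: scaleR_sum_left[symmetric] trace_B[OF x])
  then show ?thesis by (simp add: delta_E[OF x] sum.distrib H_eq[OF x])
qed

lemma div_DH:
  assumes x: "x \<in> S"
  shows "(\<Sum>a\<in>UNIV. delta a (D a H) x) = lap_perp H x - (\<Sum>c\<in>UNIV. BDH c x *\<^sub>R E c x)"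
proof -
  have "(\<Sum>a\<in>UNIV. delta a (D a H) x) \<bullet> E c x = - BDH c x" for c
    by (simp add: inner_sum_left delta_normal_E x BDH_def sum_negf inner_commute[of "D _ _ _"] B_commute[OF x, of c])
  then show ?thesis
    by (simp add: lap_perp_eq x normal_proj_inner sum_negf)
qed

lemma rotation_trace:
  assumes x: "x \<in> S"
  shows "(\<Sum>a\<in>UNIV. E a x \<and>\<and> con x (\<lambda>j. V j x) a) = - (\<Sum>a\<in>UNIV. flux a x \<and>\<and> E a x)"
proof -
  interpret w: bounded_bilinear "(\<and>\<and>) :: real^'m \<Rightarrow> real^'m \<Rightarrow> real^'m^'m"
    by (rule bounded_bilinear_wedge)
  have "(\<Sum>a\<in>UNIV. E a x \<and>\<and> con x (\<lambda>j. V j x) a)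
     = (\<Sum>a\<in>UNIV. \<Sum>b\<in>UNIV. stress a b x *\<^sub>R (E a x \<and>\<and> E b x)) + (\<Sum>a\<in>UNIV. E a x \<and>\<and> flux a x)"
    by (simp add: con_V_stress_flux[OF x] w.add_right w.sum_right w.scaleR_right sum.distrib)
  also have "(\<Sum>a\<in>UNIV. E a x \<and>\<and> flux a x) = - (\<Sum>a\<in>UNIV. flux a x \<and>\<and> E a x)"
    by (subst wedge_commute) (simp add: sum_negf)
  finally show ?thesis by (simp add: sum_symmetric_wedge stress_commute[OF x])
qed

text \<open>For \<open>Z \<and> E_a\<close> the tangential part of \<open>\<delta>_a Z\<close> is symmetric and drops out, for \<open>H \<and> D_a H\<close> the Weingarten
terms on the two factors give the \<open>ADH\<close> and \<open>BDH\<close> parts of the flux, and for \<open>A_ab H \<and> E_b\<close> one obtains the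
\<open>divAH\<close> part. The remaining purely normal 2-vectors \<open>Z \<and> H\<close>, \<open>H \<and> \<Delta>_\<perp> H\<close> and \<open>H \<and> (H \<bullet> h^ij) h_ij\<close>
cancel because \<open>H \<and> H = 0\<close>.\<close>

lemma div_con_M:
  assumes x: "x \<in> S"
  shows "(\<Sum>a\<in>UNIV. delta a (\<lambda>y. con y (\<lambda>j. M j y) a) x) = (\<Sum>a\<in>UNIV. flux a x \<and>\<and> E a x)"
proof -
  interpret w: bounded_bilinear "(\<and>\<and>) :: real^'m \<Rightarrow> real^'m \<Rightarrow> real^'m^'m"
    by (rule bounded_bilinear_wedge)
  note wl = w.add_left w.add_right w.diff_left w.diff_right w.scaleR_left w.scaleR_right w.sum_left w.sum_right
  have m1: "(\<Sum>a\<in>UNIV. delta a (\<lambda>y. Z y \<and>\<and> E a y) x) = (\<Sum>a\<in>UNIV. D a Z x \<and>\<and> E a x) + 4 *\<^sub>R (Z x \<and>\<and> H x)"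
  proof -
    have 0: "(\<Sum>a\<in>UNIV. \<Sum>b\<in>UNIV. (Z x \<bullet> B a b x) *\<^sub>R (E b x \<and>\<and> E a x)) = 0"
      by (subst sum.swap) (rule sum_symmetric_wedge, simp add: B_commute[OF x])
    have "(\<Sum>a\<in>UNIV. delta a (\<lambda>y. Z y \<and>\<and> E a y) x)
        = (\<Sum>a\<in>UNIV. delta a Z x \<and>\<and> E a x) + Z x \<and>\<and> (\<Sum>a\<in>UNIV. delta a (E a) x)"
      by (simp add: delta_wedge x sum.distrib w.sum_right)
    also have "(\<Sum>a\<in>UNIV. delta a Z x \<and>\<and> E a x) = (\<Sum>a\<in>UNIV. D a Z x \<and>\<and> E a x)"
      using 0 by (simp add: delta_normal x wl sum_subtractf)
    finally show ?thesis by (simp add: div_E[OF x] wl)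
  qed
  have m2: "(\<Sum>a\<in>UNIV. delta a (\<lambda>y. H y \<and>\<and> D a H y) x)
     = (\<Sum>a\<in>UNIV. ADH a x \<and>\<and> E a x) + H x \<and>\<and> lap_perp H x - (\<Sum>a\<in>UNIV. BDH a x *\<^sub>R (H x \<and>\<and> E a x))"
  proof -
    have "(\<Sum>a\<in>UNIV. delta a H x \<and>\<and> D a H x) = (\<Sum>a\<in>UNIV. \<Sum>b\<in>UNIV. A a b x *\<^sub>R (D a H x \<and>\<and> E b x))"
    proof (rule sum.cong[OF refl])
      fix a
      have "delta a H x \<and>\<and> D a H x = - (\<Sum>b\<in>UNIV. A a b x *\<^sub>R (E b x \<and>\<and> D a H x))"
        by (simp add: delta_normal[of x H a] x wl A_def)
      also have "\<dots> = (\<Sum>b\<in>UNIV. A a b x *\<^sub>R (D a H x \<and>\<and> E b x))"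
        by (subst wedge_commute) (simp add: sum_negf)
      finally show "delta a H x \<and>\<and> D a H x = (\<Sum>b\<in>UNIV. A a b x *\<^sub>R (D a H x \<and>\<and> E b x))" .
    qed
    also have "\<dots> = (\<Sum>b\<in>UNIV. ADH b x \<and>\<and> E b x)"
      by (subst sum.swap) (simp add: ADH_def wl A_commute[OF x])
    finally have 1: "(\<Sum>a\<in>UNIV. delta a H x \<and>\<and> D a H x) = (\<Sum>b\<in>UNIV. ADH b x \<and>\<and> E b x)" .
    have "(\<Sum>a\<in>UNIV. delta a (\<lambda>y. H y \<and>\<and> D a H y) x)
        = (\<Sum>a\<in>UNIV. delta a H x \<and>\<and> D a H x) + H x \<and>\<and> (\<Sum>a\<in>UNIV. delta a (D a H) x)"
      by (simp add: delta_wedge x sum.distrib w.sum_right)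
    then show ?thesis unfolding 1 div_DH[OF x] by (simp add: wl)
  qed
  have m3: "(\<Sum>a\<in>UNIV. delta a (\<lambda>y. \<Sum>b\<in>UNIV. A a b y *\<^sub>R (H y \<and>\<and> E b y)) x)
     = (\<Sum>a\<in>UNIV. normal_proj x (divAH a x) \<and>\<and> E a x) + H x \<and>\<and> Hhh x"
  proof -
    have e: "delta a (\<lambda>y. \<Sum>b\<in>UNIV. A a b y *\<^sub>R (H y \<and>\<and> E b y)) x
       = (\<Sum>b\<in>UNIV. delta a (\<lambda>y. A b a y *\<^sub>R H y) x \<and>\<and> E b x + A a b x *\<^sub>R (H x \<and>\<and> delta a (E b) x))" for a
    proof -
      have "delta a (\<lambda>y. \<Sum>b\<in>UNIV. A a b y *\<^sub>R (H y \<and>\<and> E b y)) x = delta a (\<lambda>y. \<Sum>b\<in>UNIV. (A b a y *\<^sub>R H y) \<and>\<and> E b y) x"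
        by (rule delta_cong[OF x]) (simp add: wl A_commute[of _ a])
      also have "\<dots> = (\<Sum>b\<in>UNIV. delta a (\<lambda>y. A b a y *\<^sub>R H y) x \<and>\<and> E b x
          + (A b a x *\<^sub>R H x) \<and>\<and> delta a (E b) x)"
        by (simp add: delta_sum delta_wedge x)
      finally show ?thesis by (simp add: w.scaleR_left A_commute[OF x, of a])
    qed
    have "(\<Sum>a\<in>UNIV. \<Sum>b\<in>UNIV. delta a (\<lambda>y. A b a y *\<^sub>R H y) x \<and>\<and> E b x)
       = (\<Sum>b\<in>UNIV. (\<Sum>a\<in>UNIV. delta a (\<lambda>y. A b a y *\<^sub>R H y) x) \<and>\<and> E b x)"
      by (subst sum.swap) (simp add: w.sum_left)
    also have "\<dots> = (\<Sum>b\<in>UNIV. \<Sum>a\<in>UNIV. E b x $ a *\<^sub>R ((\<Sum>d\<in>UNIV. delta d (\<lambda>y. A b d y *\<^sub>R H y) x) \<and>\<and> E a x))"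
      by (subst E_E_sum[OF x, symmetric]) (simp only: w.sum_right w.scaleR_right)
    also have "\<dots> = (\<Sum>a\<in>UNIV. divAH a x \<and>\<and> E a x)"
      by (subst sum.swap) (simp add: divAH_def w.sum_left[of _ UNIV] w.scaleR_left E_commute[OF x])
    also have "\<dots> = (\<Sum>a\<in>UNIV. normal_proj x (divAH a x) \<and>\<and> E a x) - (\<Sum>a\<in>UNIV. \<Sum>c\<in>UNIV. A2 a c x *\<^sub>R (E c x \<and>\<and> E a x))"
      by (subst divAH_tangential[OF x]) (simp add: wl sum_subtractf)
    also have "(\<Sum>a\<in>UNIV. \<Sum>c\<in>UNIV. A2 a c x *\<^sub>R (E c x \<and>\<and> E a x)) = 0"
      by (subst sum.swap) (rule sum_symmetric_wedge, rule A2_commute)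
    finally have 1: "(\<Sum>a\<in>UNIV. \<Sum>b\<in>UNIV. delta a (\<lambda>y. A b a y *\<^sub>R H y) x \<and>\<and> E b x)
       = (\<Sum>a\<in>UNIV. normal_proj x (divAH a x) \<and>\<and> E a x)" by simp
    have z: "(\<Sum>b\<in>UNIV. A a b x *\<^sub>R (\<Sum>c\<in>UNIV. B a c x $ b *\<^sub>R E c x)) = 0" for a
    proof -
      have "(\<Sum>b\<in>UNIV. A a b x * w $ b) = 0" if "normal x w" for w
        using normal_contract[OF x that, of "\<lambda>b. A a b x"] E_A[OF x, of _ a]
        by (simp add: A_commute[OF x, of a] mult.commute)
      note n = this[OF normal_B[OF x]]
      have "(\<Sum>b\<in>UNIV. A a b x *\<^sub>R (\<Sum>c\<in>UNIV. B a c x $ b *\<^sub>R E c x)) = (\<Sum>c\<in>UNIV. (\<Sum>b\<in>UNIV. A a b x * B a c x $ b) *\<^sub>R E c x)"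
        unfolding scaleR_sum_right scaleR_sum_left by (subst sum.swap) simp
      then show ?thesis by (simp add: n)
    qed
    have "(\<Sum>a\<in>UNIV. \<Sum>b\<in>UNIV. A a b x *\<^sub>R (H x \<and>\<and> delta a (E b) x))
       = H x \<and>\<and> (\<Sum>a\<in>UNIV. \<Sum>b\<in>UNIV. A a b x *\<^sub>R delta a (E b) x)"
      by (simp add: w.sum_right w.scaleR_right)
    also have "(\<Sum>a\<in>UNIV. \<Sum>b\<in>UNIV. A a b x *\<^sub>R delta a (E b) x) = Hhh x"
      by (simp add: delta_E[OF x] scaleR_add_right sum.distrib z Hhh_eq[OF x])
    finally show ?thesis by (simp add: e sum.distrib 1)
  qed
  have "delta a (\<lambda>y. con y (\<lambda>j. M j y) a) x = delta a (\<lambda>y. Z y \<and>\<and> E a y) x + 2 *\<^sub>R delta a (\<lambda>y. H y \<and>\<and> D a H y) x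
      + 2 *\<^sub>R delta a (\<lambda>y. \<Sum>b\<in>UNIV. A a b y *\<^sub>R (H y \<and>\<and> E b y)) x" for a
  proof -
    have "delta a (\<lambda>y. con y (\<lambda>j. M j y) a) x = delta a (\<lambda>y. Z y \<and>\<and> E a y + 2 *\<^sub>R (H y \<and>\<and> D a H y)
      + 2 *\<^sub>R (\<Sum>b\<in>UNIV. A a b y *\<^sub>R (H y \<and>\<and> E b y))) x"
      by (rule delta_cong[OF x]) (rule con_M)
    then show ?thesis
      by (simp only: delta_add delta_cscaleR x sm_add sm_scaleR sm_const sm_sum sm_wedge sm_Z sm_E sm_D sm_H sm_A)
  qed
  then have "(\<Sum>a\<in>UNIV. delta a (\<lambda>y. con y (\<lambda>j. M j y) a) x)
      = (\<Sum>a\<in>UNIV. D a Z x \<and>\<and> E a x) + 4 *\<^sub>R (Z x \<and>\<and> H x)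
      + 2 *\<^sub>R ((\<Sum>a\<in>UNIV. ADH a x \<and>\<and> E a x) + H x \<and>\<and> lap_perp H x - (\<Sum>a\<in>UNIV. BDH a x *\<^sub>R (H x \<and>\<and> E a x)))
      + 2 *\<^sub>R ((\<Sum>a\<in>UNIV. normal_proj x (divAH a x) \<and>\<and> E a x) + H x \<and>\<and> Hhh x)"
    by (simp add: sum.distrib scaleR_sum_right[symmetric] m1 m2 m3)
  also have "4 *\<^sub>R (Z x \<and>\<and> H x) = - 2 *\<^sub>R (H x \<and>\<and> lap_perp H x) - 2 *\<^sub>R (H x \<and>\<and> Hhh x)"
    using wedge_commute[of "lap_perp H x" "H x"] wedge_commute[of "Hhh x" "H x"]
    by (simp add: Z_def wl scaleR_diff_right scaleR_add_right)
  finally show ?thesis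
    by (simp add: flux_def wl sum.distrib sum_subtractf scaleR_sum_right algebra_simps)
qed

theorem rotation_law:
  assumes x: "x \<in> S" and W: "willmore x = 0"
  shows "dvg (\<lambda>j y. f y \<and>\<and> V j y + M j y) x = 0"
proof -
  interpret w: bounded_bilinear "(\<and>\<and>) :: real^'m \<Rightarrow> real^'m \<Rightarrow> real^'m^'m"
    by (rule bounded_bilinear_wedge)
  have lin: "linear ((\<and>\<and>) u)" for u :: "real^'m"
    by (rule bounded_linear.linear[OF w.bounded_linear_right])
  have "delta a (\<lambda>y. con y (\<lambda>j. f y \<and>\<and> V j y + M j y) a) x
      = E a x \<and>\<and> con x (\<lambda>j. V j x) a + f x \<and>\<and> delta a (\<lambda>y. con y (\<lambda>j. V j y) a) x
        + delta a (\<lambda>y. con y (\<lambda>j. M j y) a) x" for a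
  proof -
    have "delta a (\<lambda>y. con y (\<lambda>j. f y \<and>\<and> V j y + M j y) a) x
        = delta a (\<lambda>y. f y \<and>\<and> con y (\<lambda>j. V j y) a + con y (\<lambda>j. M j y) a) x"
      by (rule delta_cong[OF x]) (simp add: con_add con_linear[OF lin])
    then show ?thesis by (simp add: delta_add delta_wedge x smooth_f E_def)
  qed
  then have "dvg (\<lambda>j y. f y \<and>\<and> V j y + M j y) x
     = (\<Sum>a\<in>UNIV. E a x \<and>\<and> con x (\<lambda>j. V j x) a) + f x \<and>\<and> (\<Sum>a\<in>UNIV. delta a (\<lambda>y. con y (\<lambda>j. V j y) a) x)
       + (\<Sum>a\<in>UNIV. delta a (\<lambda>y. con y (\<lambda>j. M j y) a) x)"
    by (subst dvg_eq[OF x]) (simp_all add: smooth_f sum.distrib w.sum_right)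
  then show ?thesis
    by (simp add: rotation_trace[OF x] div_con_M[OF x] div_con_V_eq_0[OF x W] w.zero_right)
qed

end

section \<open>Conservation laws on a manifold\<close>

theorem theorem2p4p2:
  fixes X :: "'a topology" and A :: "'a chart set" and \<Phi> :: "'a \<Rightarrow> real^'m"
  assumes manifold: "smooth_manifold4 X A"
    and immersion: "smooth_immersion A \<Phi>"
    and willmore: "\<And>c x. c \<in> A \<Longrightarrow> x \<in> chart_range c \<Longrightarrow>
      parametrization.willmore (local_rep c \<Phi>) x = 0"
  shows "\<forall>c\<in>A. \<forall>x\<in>chart_range c.
    (let f = local_rep c \<Phi> in
      parametrization.dvg f (parametrization.V f) x = 0 \<and>
      parametrization.dvg f
        (\<lambda>j y. f y \<bullet> parametrization.V f j y
               - parametrization.grad_up f (parametrization.H_sq f) j y) x = 0 \<and>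
      parametrization.dvg f
        (\<lambda>j y. f y \<and>\<and> parametrization.V f j y + parametrization.M f j y) x = 0)"
proof (intro ballI)
  fix c x assume c: "c \<in> A" and x: "x \<in> chart_range c"
  have "open (chart_range c)"
    using manifold c by (auto simp: smooth_manifold4_def chart_range_def)
  then interpret immersed_patch "chart_range c" "local_rep c \<Phi>"
    using immersion c by unfold_locales (auto simp: smooth_immersion_def)
  show "let f = local_rep c \<Phi> in
      parametrization.dvg f (parametrization.V f) x = 0 \<and>
      parametrization.dvg f
        (\<lambda>j y. f y \<bullet> parametrization.V f j y
               - parametrization.grad_up f (parametrization.H_sq f) j y) x = 0 \<and>
      parametrization.dvg f
        (\<lambda>j y. f y \<and>\<and> parametrization.V f j y + parametrization.M f j y) x = 0"
    unfolding Let_def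
    using translation_law[OF x willmore[OF c x]] dilation_law[OF x willmore[OF c x]]
      rotation_law[OF x willmore[OF c x]] by blast
qed

end
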